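(* Let $B_1\subseteq\mathbb{R}^{n+1}$ be the unit ball with boundary the unit sphere $\mathbb{S}^n$, where $n=2k+1$ for some integer $k\geq 1$. For $\lambda>0$ let $\hat g^\lambda$ be the homogeneous metric on $\mathbb{S}^n\cong\mathrm{SU}(k+1)/\mathrm{SU}(k)$ which at a point has the standard diagonal form $\hat g^\lambda=\sigma_1^2+\lambda(\sigma_2^2+\cdots+\sigma_n^2)$. Then, as $\lambda$ varies continuously from $\lambda=1$ on the interval $(\frac{1}{n+1},1]$ (resp. on $[1,n+1)$), one of the following holds: (a) for each $\lambda\in(\frac{1}{n+1},1]$ (resp. $\lambda\in[1,n+1)$) there exists a non-positively curved conformally compact Einstein metric on $B_1$ with conformal infinity $(\mathbb{S}^n,[\hat g^\lambda])$; or (b) there exists $\lambda_1\in(\frac{1}{n+1},1]$ (resp. $\lambda_1\in[1,n+1)$) such that for each $\lambda\in[\lambda_1,1]$ (resp. $\lambda\in[1,\lambda_1]$) there exists a non-positively curved conformally compact Einstein metric $g^\lambda$ on $B_1$ with conformal infinity $(\mathbb{S}^n,[\hat g^\lambda])$, there exists $p\in B_1$ such that the sectional curvature of $g^{\lambda_1}$ at $p$ vanishes in some direction, and moreover for any small $\epsilon>0$ there exists $\lambda_2\in(\lambda_1-\epsilon,\lambda_1)$ (resp. $\lambda_2\in(\lambda_1,\lambda_1+\epsilon)$) and a conformally compact Einstein metric $g^{\lambda_2}$ on $B_1$ with conformal infinity $(\mathbb{S}^n,[\hat g^{\lambda_2}])$ whose sectional curvature is positive in some direction at some point of $B_1$.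
   Context: $\sigma_1,\dots,\sigma_n$ are the $1$-forms dual to a basis of $\mathfrak p$ in the $\mathrm{Ad}_{\mathrm{SU}(k)}$-invariant splitting $\mathfrak{su}(k+1)=\mathfrak{su}(k)\oplus\mathfrak p$, where $\mathfrak p=\mathfrak p_0\oplus\mathfrak p_1$ with $\mathfrak p_0$ one-dimensional with trivial $\mathrm{SU}(k)$-action (dual to $\sigma_1$) and $\mathfrak p_1$ the irreducible complement (dual to $\sigma_2,\dots,\sigma_n$); normalized so that $\hat g^1$ is the round metric. A complete metric $g$ on $B_1$ is conformally compact if for some defining function $x$ ($x>0$ in $B_1$, $x=0$ and $dx\ne0$ on $\mathbb{S}^n$) $x^2g$ extends continuously to $\overline{B_1}$; its conformal infinity is the conformal class of $x^2g|_{\mathbb{S}^n}$; it is conformally compact Einstein if in addition $\mathrm{Ric}_g=-ng$. *)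

theory Defs
  imports "HOL-Analysis.Analysis"
begin

text \<open>Riemannian geometry in global coordinates on the open unit ball B_1 of R^(n+1),
  modelled as real^'m with CARD('m) = n+1. A metric is a matrix field g.\<close>

type_synonym 'm mfield = "real^'m \<Rightarrow> real^'m^'m"

fun Ck_on :: "nat \<Rightarrow> ('a::euclidean_space \<Rightarrow> 'b::real_normed_vector) \<Rightarrow> 'a set \<Rightarrow> bool" where
  "Ck_on 0 f S = continuous_on S f"
| "Ck_on (Suc k) f S = ((\<forall>x\<in>S. f differentiable (at x)) \<and>
        (\<forall>v. Ck_on k (\<lambda>x. frechet_derivative f (at x) v) S))"

definition smooth_on_set :: "('a::euclidean_space \<Rightarrow> 'b::real_normed_vector) \<Rightarrow> 'a set \<Rightarrow> bool" where
  "smooth_on_set f S \<longleftrightarrow> (\<forall>k. Ck_on k f S)"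

definition pd :: "(real^('m::finite) \<Rightarrow> 'b::real_normed_vector) \<Rightarrow> 'm \<Rightarrow> real^'m \<Rightarrow> 'b" where
  "pd f i x = frechet_derivative f (at x) (axis i 1)"

definition gform :: "real^('m::finite)^'m \<Rightarrow> real^'m \<Rightarrow> real^'m \<Rightarrow> real" where
  "gform G u v = u \<bullet> (G *v v)"

definition riem_metric :: "('m::finite) mfield \<Rightarrow> bool" where
  "riem_metric g \<longleftrightarrow> smooth_on_set g (ball 0 1) \<and>
     (\<forall>x\<in>ball 0 1. transpose (g x) = g x \<and> (\<forall>v. v \<noteq> 0 \<longrightarrow> gform (g x) v v > 0))"

definition christ :: "('m::finite) mfield \<Rightarrow> 'm \<Rightarrow> 'm \<Rightarrow> 'm \<Rightarrow> real^'m \<Rightarrow> real" where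
  "christ g l i j x = (1/2) * (\<Sum>m\<in>UNIV. matrix_inv (g x) $ l $ m *
       (pd g i x $ j $ m + pd g j x $ i $ m - pd g m x $ i $ j))"

text \<open>Riemann tensor R^l_{ijk}, with R(d_i,d_j)d_k = R^l_{ijk} d_l and
  R(X,Y) = nabla_X nabla_Y - nabla_Y nabla_X - nabla_[X,Y].\<close>
definition riem :: "('m::finite) mfield \<Rightarrow> 'm \<Rightarrow> 'm \<Rightarrow> 'm \<Rightarrow> 'm \<Rightarrow> real^'m \<Rightarrow> real" where
  "riem g l i j k x = pd (christ g l j k) i x - pd (christ g l i k) j x
     + (\<Sum>m\<in>UNIV. christ g m j k x * christ g l i m x - christ g m i k x * christ g l j m x)"

definition ricci :: "('m::finite) mfield \<Rightarrow> 'm \<Rightarrow> 'm \<Rightarrow> real^'m \<Rightarrow> real" where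
  "ricci g j k x = (\<Sum>i\<in>UNIV. riem g i i j k x)"

definition riem_vec :: "('m::finite) mfield \<Rightarrow> real^'m \<Rightarrow> real^'m \<Rightarrow> real^'m \<Rightarrow> real^'m \<Rightarrow> real^'m" where
  "riem_vec g x X Y Z = (\<chi> l. \<Sum>i\<in>UNIV. \<Sum>j\<in>UNIV. \<Sum>k\<in>UNIV. X$i * Y$j * Z$k * riem g l i j k x)"

definition sec_curv :: "('m::finite) mfield \<Rightarrow> real^'m \<Rightarrow> real^'m \<Rightarrow> real^'m \<Rightarrow> real" where
  "sec_curv g x X Y = gform (g x) (riem_vec g x X Y Y) X /
     (gform (g x) X X * gform (g x) Y Y - (gform (g x) X Y)^2)"

definition lin_indep2 :: "real^('m::finite) \<Rightarrow> real^'m \<Rightarrow> bool" where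
  "lin_indep2 X Y \<longleftrightarrow> X \<noteq> 0 \<and> (\<forall>c. Y \<noteq> c *\<^sub>R X)"

definition nonpos_curved :: "('m::finite) mfield \<Rightarrow> bool" where
  "nonpos_curved g \<longleftrightarrow> (\<forall>p\<in>ball 0 1. \<forall>X Y. lin_indep2 X Y \<longrightarrow> sec_curv g p X Y \<le> 0)"

definition einstein_neg :: "('m::finite) mfield \<Rightarrow> bool" where
  "einstein_neg g \<longleftrightarrow> (\<forall>x\<in>ball 0 1. \<forall>j k.
       ricci g j k x = - (real CARD('m) - 1) * (g x $ j $ k))"

definition rlength :: "('m::finite) mfield \<Rightarrow> (real \<Rightarrow> real^'m) \<Rightarrow> real" where
  "rlength g \<gamma> = integral {0..1} (\<lambda>t. sqrt (gform (g (\<gamma> t))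
        (vector_derivative \<gamma> (at t)) (vector_derivative \<gamma> (at t))))"

definition rdist :: "('m::finite) mfield \<Rightarrow> real^'m \<Rightarrow> real^'m \<Rightarrow> real" where
  "rdist g p q = Inf {rlength g \<gamma> | \<gamma>. \<gamma> C1_differentiable_on {0..1} \<and>
        \<gamma> 0 = p \<and> \<gamma> 1 = q \<and> \<gamma> ` {0..1} \<subseteq> ball 0 1}"

definition complete_metric :: "('m::finite) mfield \<Rightarrow> bool" where
  "complete_metric g \<longleftrightarrow> (\<forall>s. (\<forall>n. s n \<in> ball 0 1) \<and>
      (\<forall>e>0. \<exists>N. \<forall>m\<ge>N. \<forall>n\<ge>N. rdist g (s m) (s n) < e) \<longrightarrow>
      (\<exists>q\<in>ball 0 1. (\<lambda>n. rdist g (s n) q) \<longlonglongrightarrow> 0))"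

definition defining_fun :: "(real^('m::finite) \<Rightarrow> real) \<Rightarrow> bool" where
  "defining_fun x \<longleftrightarrow> continuous_on (cball 0 1) x \<and> (\<forall>p\<in>ball 0 1. x p > 0) \<and>
     (\<forall>p\<in>sphere 0 1. x p = 0 \<and> x differentiable (at p) \<and> frechet_derivative x (at p) \<noteq> (\<lambda>_. 0))"

text \<open>The homogeneous metric ghat^lambda = sigma_1^2 + lambda (sigma_2^2+...+sigma_n^2) on
  S^n = SU(k+1)/SU(k) in C^(k+1) = R^(2k+2) with complex structure J: sigma_1 = <J p, .>
  (Hopf fibre direction), and sigma_2^2+...+sigma_n^2 = round metric - sigma_1^2.\<close>
definition ghat :: "real^('m::finite)^'m \<Rightarrow> real \<Rightarrow> real^'m \<Rightarrow> real^'m \<Rightarrow> real^'m \<Rightarrow> real" where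
  "ghat J lam p u v = ((J *v p) \<bullet> u) * ((J *v p) \<bullet> v)
      + lam * (u \<bullet> v - ((J *v p) \<bullet> u) * ((J *v p) \<bullet> v))"

definition CCE_with_infinity :: "real^('m::finite)^'m \<Rightarrow> real \<Rightarrow> 'm mfield \<Rightarrow> bool" where
  "CCE_with_infinity J lam g \<longleftrightarrow> riem_metric g \<and> complete_metric g \<and> einstein_neg g \<and>
     (\<exists>x gbar c. defining_fun x \<and> continuous_on (cball 0 1) gbar \<and>
        (\<forall>p\<in>ball 0 1. gbar p = (x p)^2 *\<^sub>R g p) \<and>
        (\<forall>p\<in>sphere 0 1. c p > 0 \<and> (\<forall>u v. u \<bullet> p = 0 \<longrightarrow> v \<bullet> p = 0 \<longrightarrow>
            gform (gbar p) u v = c p * ghat J lam p u v)))"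

end

theory Submission
  imports Defs "HOL-Computational_Algebra.Polynomial"
begin

text \<open>The metrics are explicit: they form the higher-dimensional Taub-NUT-AdS family. Identify
  \<open>\<real>\<^sup>n\<^sup>+\<^sup>1\<close> with \<open>\<complex>\<^sup>k\<^sup>+\<^sup>1\<close> and put \<open>t = |z|\<^sup>2\<close>, \<open>\<kappa> = 1/\<lambda>\<close>. With a polynomial \<open>P\<close> of degree \<open>k\<close> solving
  a linear first order ODE let \<open>c = (\<kappa> - 1) P(t)\<close> and \<open>u = 1 + t c\<close>; then
  \<open>g = 4\<kappa>/(1-t)\<^sup>2 (I - (c/u) z z\<^sup>T + c (Jz)(Jz)\<^sup>T)\<close> is Einstein, is conformally compact because \<open>u > 0\<close> on \<open>[0,1]\<close>,
  and has the conformal infinity of parameter \<open>\<lambda>\<close> because \<open>u(1) = \<kappa>\<close>. After moving the tangent planes to a fixed Euclidean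
  model by the square root of the matrix in parentheses, the sectional curvature is
  \<open>-1 + (\<lambda> - 1) W\<close> with \<open>W\<close> independent of \<open>\<lambda>\<close>. The function \<open>W\<close> is continuous on the compact set of
  points of the closed ball with an orthonormal pair and vanishes over the sphere, so its extrema
  are the reciprocals of the values of \<open>\<lambda> - 1\<close> at which nonpositivity fails, and they are attained over the
  open ball whenever they matter.\<close>

text \<open>On the plane spanned by \<open>z\<close> and \<open>Jz\<close> the matrix of the
  overview has the eigenvalues 1/u (radial) and u (along the Hopf fibre). They are reciprocal, which
  is the shape dr^2/V + V sigma_1^2 of Taub-NUT metrics, and in this gauge the Einstein equation is
  linear in u; this is why an explicit solution exists. For kap = 1 the function c vanishes and the
  metric is the Poincare metric. The point t = 1 is singular for the ODE, so the equation itself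
  dictates P(1) = 1 there, hence u(1) = kap. The prefactor kap then gives d(1 - t) length 1 on the
  sphere in the compactified metric, as a curvature tending to -1 demands. Linearity in kap - 1 is
  also the reason that W is free of lam: division by kap turns 1 - kap into (1 - kap)/kap = lam - 1.
  What does not come from algebra is u > 0 on all of [0,1] for every kap > 0; it is a barrier
  argument for the ODE. The remaining analytic point is completeness, obtained by comparison with
  the Poincare metric.\<close>

section \<open>The radial profile\<close>

text \<open>Up to the factor \<open>(4k+2)/(k+2)\<close> the profile is the hypergeometric polynomial \<open>F(-k, 2; k+3; t)\<close>,
  the solution of the Einstein ODE that is regular at the origin.\<close>
fun profile_coeff :: "nat \<Rightarrow> nat \<Rightarrow> real" where
  "profile_coeff k 0 = (4 * real k + 2) / (real k + 2)"
| "profile_coeff k (Suc j) =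
     - ((real k - real j) * (real j + 2) / ((real j + 1) * (real k + 3 + real j))) * profile_coeff k j"

definition profile :: "nat \<Rightarrow> real poly" where
  "profile k = (\<Sum>j\<le>k. monom (profile_coeff k j) j)"

lemma profile_coeff_eq_0: "j > k \<Longrightarrow> profile_coeff k j = 0"
proof (induction j)
  case (Suc j)
  show ?case
  proof (cases "j = k")
    case False
    with Suc show ?thesis by simp
  qed simp
qed simp

lemma coeff_profile [simp]: "coeff (profile k) j = profile_coeff k j"
proof -
  have "coeff (profile k) j = (\<Sum>i\<le>k. if i = j then profile_coeff k j else 0)"
    unfolding profile_def coeff_sum by (intro sum.cong) auto
  also have "\<dots> = profile_coeff k j"
    by (simp add: profile_coeff_eq_0)
  finally show ?thesis .
qed

text \<open>The coefficient of t^(j+2) in the first order ODE. The definition has instead the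
  two-term recursion of a hypergeometric series: its step from j+1 to j+2 merges the first two
  summands into a multiple of coefficient j+1, and its step from j to j+1 cancels that against the
  last summand.\<close>

lemma profile_coeff_recurrence:
  "(real j + real k + 4) * profile_coeff k (Suc (Suc j)) + 2 * real k * profile_coeff k (Suc j)
     + (real k - real j) * profile_coeff k j = 0"
proof -
  define y where "y = profile_coeff k j"
  define J where "J = real j"
  define K where "K = real k"
  have JK: "J \<ge> 0" "K \<ge> 0" by (auto simp: J_def K_def)
  have nz: "J + 1 \<noteq> 0" "J + 2 \<noteq> 0" "K + 3 + J \<noteq> 0" "K + 4 + J \<noteq> 0" using JK by auto
  have a: "profile_coeff k (Suc j) = - ((K - J) * (J + 2) / ((J + 1) * (K + 3 + J))) * y"
    by (simp add: y_def J_def K_def)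
  have b: "profile_coeff k (Suc (Suc j)) =
      - ((K - J - 1) * (J + 3) / ((J + 2) * (K + 4 + J))) * profile_coeff k (Suc j)"
    by (simp add: J_def K_def algebra_simps)
  have "(J + K + 4) * profile_coeff k (Suc (Suc j)) = - ((K - J - 1) * (J + 3) / (J + 2)) * profile_coeff k (Suc j)"
    unfolding b using nz by (simp add: divide_simps)
  moreover have "2 * K - (K - J - 1) * (J + 3) / (J + 2) = (J + 1) * (K + J + 3) / (J + 2)"
    using nz by (simp add: divide_simps) (simp add: algebra_simps)
  ultimately have "(J + K + 4) * profile_coeff k (Suc (Suc j)) + 2 * K * profile_coeff k (Suc j)
      = (J + 1) * (K + J + 3) / (J + 2) * profile_coeff k (Suc j)"
    by (metis (no_types, lifting) add.commute distrib_right diff_conv_add_uminus)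
  also have "\<dots> = - ((K - J) * y)"
    unfolding a using nz by (simp add: divide_simps)
  finally have "(J + K + 4) * profile_coeff k (Suc (Suc j)) + 2 * K * profile_coeff k (Suc j) + (K - J) * y = 0"
    by linarith
  then show ?thesis unfolding y_def J_def K_def .
qed

text \<open>Kept as an identity of polynomials so that it can be checked coefficientwise and
  differentiated by \<open>pderiv\<close>. Degrees 0 and 1 lie outside the recurrence and fix the
  initial coefficient.\<close>

lemma profile_ode_poly:
  "[:0, 1, 0, -1:] * pderiv (profile k) + [:real k + 2, 2 * real k, real k:] * profile k
     = [:4 * real k + 2:]"
proof (rule poly_eqI)
  fix n
  show "coeff ([:0, 1, 0, -1:] * pderiv (profile k)
      + [:real k + 2, 2 * real k, real k:] * profile k) n = coeff [:4 * real k + 2:] n"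
  proof (cases n)
    case 0
    then show ?thesis by simp
  next
    case (Suc i)
    show ?thesis
    proof (cases i)
      case 0
      have "profile_coeff k (Suc 0) * (real k + 3) = - (2 * real k) * profile_coeff k 0"
        by simp
      with Suc 0 show ?thesis
        by (simp add: coeff_pderiv algebra_simps del: profile_coeff.simps)
    next
      case (Suc j)
      with \<open>n = Suc i\<close> profile_coeff_recurrence[of j k] show ?thesis
        by (cases j) (simp_all add: coeff_pderiv algebra_simps del: profile_coeff.simps)
    qed
  qed
qed

lemma profile_ode:
  "t * (1 - t\<^sup>2) * poly (pderiv (profile k)) t + (real k + 2 + 2 * real k * t + real k * t\<^sup>2) * poly (profile k) t
     = 4 * real k + 2"
  using arg_cong[OF profile_ode_poly[of k], of "\<lambda>p. poly p t"]
  by (simp add: algebra_simps power2_eq_square)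

lemma profile_ode2:
  "t * (1 - t\<^sup>2) * poly (pderiv (pderiv (profile k))) t
     + (real k + 3 + 2 * real k * t + (real k - 3) * t\<^sup>2) * poly (pderiv (profile k)) t
     + 2 * real k * (1 + t) * poly (profile k) t = 0"
  using arg_cong[OF profile_ode_poly[of k], of "\<lambda>p. poly (pderiv p) t"]
  by (simp add: pderiv_mult pderiv_add pderiv_minus pderiv_smult pderiv_pCons) algebra

text \<open>At t = 1 the derivative term of the ODE drops out, so the equation determines the value.
  The right side 4k + 2 is chosen for this normalization.\<close>

lemma profile_1: "poly (profile k) 1 = 1"
proof -
  have "(4 * real k + 2) * (poly (profile k) 1 - 1) = 0"
    using profile_ode[of 1 k] by (simp add: algebra_simps)
  moreover have "4 * real k + 2 \<noteq> 0" using of_nat_0_le_iff[of k] by linarith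
  ultimately show ?thesis by simp
qed

section \<open>Positivity of the length factor of the Hopf fibre\<close>

definition fibre_factor :: "nat \<Rightarrow> real \<Rightarrow> real \<Rightarrow> real" where
  "fibre_factor k kap t = 1 + t * ((kap - 1) * poly (profile k) t)"

text \<open>A barrier argument. In the linear ODE for u the factor of u and the right side are
  positive on (0,1), so u' > 0 wherever u <= 0. At the least point with u <= 0 this makes u still
  smaller just to the left, a contradiction. The endpoints are excluded by u(0) = 1 and u(1) =
  kap.\<close>

lemma fibre_factor_pos:
  assumes kap: "kap > 0" and t: "0 \<le> t" "t \<le> 1"
  shows "fibre_factor k kap t > 0"
proof (rule ccontr)
  let ?u = "fibre_factor k kap"
  define u' where "u' s = (kap - 1) * (poly (profile k) s + s * poly (pderiv (profile k)) s)" for s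
  have der: "(?u has_real_derivative u' s) (at s)" for s
    unfolding fibre_factor_def u'_def
    by (auto intro!: derivative_eq_intros poly_DERIV simp: algebra_simps)
  have u1: "?u 1 = kap" by (simp add: fibre_factor_def profile_1)
  have ode: "s * (1 - s\<^sup>2) * u' s + ((real k + 1) * (1 + s\<^sup>2) + 2 * real k * s) * ?u s
      = (real k + 1) * (1 - s)\<^sup>2 + kap * (4 * real k + 2) * s" for s
  proof -
    have "s * (1 - s\<^sup>2) * u' s + ((real k + 1) * (1 + s\<^sup>2) + 2 * real k * s) * ?u s =
      (kap - 1) * s * (s * (1 - s\<^sup>2) * poly (pderiv (profile k)) s
         + (real k + 2 + 2 * real k * s + real k * s\<^sup>2) * poly (profile k) s)
       + ((real k + 1) * (1 + s\<^sup>2) + 2 * real k * s)"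
      unfolding u'_def fibre_factor_def by algebra
    then show ?thesis unfolding profile_ode by algebra
  qed
  assume "\<not> ?u t > 0"
  define S where "S = {s \<in> {0..1}. ?u s \<le> 0}"
  have "continuous_on {0..1} ?u"
    using der by (meson DERIV_continuous continuous_at_imp_continuous_on)
  then have "closed S"
    unfolding S_def by (intro continuous_on_closed_Collect_le) auto
  moreover have "bounded S"
    by (rule bounded_subset[of "{0..1}"]) (auto simp: S_def)
  ultimately have "compact S" by (simp add: compact_eq_bounded_closed)
  moreover have "S \<noteq> {}" using \<open>\<not> ?u t > 0\<close> t by (auto simp: S_def)
  ultimately obtain s where s: "s \<in> S" "\<And>r. r \<in> S \<Longrightarrow> s \<le> r"
    using compact_attains_inf by metis
  have s01: "0 < s" "s < 1" "?u s \<le> 0"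
  proof -
    have "s \<noteq> 0" using s(1) by (auto simp: S_def fibre_factor_def)
    moreover have "s \<noteq> 1" using s(1) u1 kap by (auto simp: S_def)
    ultimately show "0 < s" "s < 1" "?u s \<le> 0" using s(1) by (auto simp: S_def)
  qed
  have "((real k + 1) * (1 + s\<^sup>2) + 2 * real k * s) * ?u s \<le> 0"
    using s01 by (intro mult_nonneg_nonpos) auto
  moreover have "(real k + 1) * (1 - s)\<^sup>2 + kap * (4 * real k + 2) * s > 0"
    using s01 kap by (intro add_nonneg_pos mult_pos_pos) auto
  ultimately have "s * (1 - s\<^sup>2) * u' s > 0" using ode[of s] by linarith
  moreover have "s * (1 - s\<^sup>2) > 0"
    using s01 by (simp add: power_less_one_iff)
  ultimately have "u' s > 0" using zero_less_mult_pos by blast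
  then obtain d where d: "d > 0" "\<And>h. 0 < h \<Longrightarrow> h < d \<Longrightarrow> ?u (s - h) < ?u s"
    using DERIV_pos_inc_left[OF der] by blast
  define h where "h = min (d / 2) s"
  have h: "0 < h" "h < d" "h \<le> s" using d(1) s01 by (auto simp: h_def)
  have "s - h \<in> S" using d(2)[OF h(1,2)] s01 h by (auto simp: S_def)
  with s(2)[of "s - h"] h show False by auto
qed

section \<open>Calculus of Ck functions\<close>

lemma Ck_on_cong:
  assumes "open S" "\<And>x. x \<in> S \<Longrightarrow> f x = g x" "Ck_on n f S"
  shows "Ck_on n g S"
  using assms(2,3)
proof (induction n arbitrary: f g)
  case 0
  then show ?case by (metis Ck_on.simps(1) continuous_on_cong)
next
  case (Suc n)
  have dg: "g differentiable (at x)" if "x \<in> S" for x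
    using Suc.prems assms(1) that
    by (metis Ck_on.simps(2) differentiable_def has_derivative_transform_within_open)
  moreover have "Ck_on n (\<lambda>x. frechet_derivative g (at x) v) S" for v
  proof (rule Suc.IH)
    show "Ck_on n (\<lambda>x. frechet_derivative f (at x) v) S" using Suc.prems by simp
    show "frechet_derivative f (at x) v = frechet_derivative g (at x) v" if "x \<in> S" for x
      using Suc.prems assms(1) that
      by (metis Ck_on.simps(2) frechet_derivative_transform_within_open)
  qed
  ultimately show ?case by simp
qed

lemma Ck_on_SucD: "Ck_on (Suc n) f S \<Longrightarrow> Ck_on n f S"
proof (induction n arbitrary: f)
  case 0
  then show ?case
    by (auto intro!: continuous_at_imp_continuous_on differentiable_imp_continuous_within)
next
  case (Suc n)
  then show ?case by (metis Ck_on.simps(2))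
qed

text \<open>Replaces the \<open>frechet_derivative\<close> in the definition by any explicit
  derivative; the product and inverse rules below are inductions through this rule.\<close>

lemma Ck_on_SucI:
  assumes "open S" "\<And>x. x \<in> S \<Longrightarrow> (f has_derivative f' x) (at x)"
    and "\<And>v. Ck_on n (\<lambda>x. f' x v) S"
  shows "Ck_on (Suc n) f S"
proof -
  have "Ck_on n (\<lambda>x. frechet_derivative f (at x) v) S" for v
    using assms(1) _ assms(3)[of v]
    by (rule Ck_on_cong) (use assms(2) frechet_derivative_at in metis)
  then show ?thesis using assms(2) by (auto simp: differentiable_def)
qed

lemma Ck_on_SucE:
  assumes "Ck_on (Suc n) f S" "x \<in> S"
  shows "(f has_derivative frechet_derivative f (at x)) (at x)"
  using assms frechet_derivative_works by auto

lemma Ck_on_const: "open S \<Longrightarrow> Ck_on n (\<lambda>x. c) S"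
  by (induction n arbitrary: c) (auto intro!: Ck_on_SucI)

lemma Ck_on_linear:
  assumes "open S" "bounded_linear L"
  shows "Ck_on n L S"
proof (cases n)
  case 0
  then show ?thesis by (simp add: assms linear_continuous_on)
next
  case (Suc j)
  show ?thesis unfolding Suc
    using assms by (intro Ck_on_SucI[where f' = "\<lambda>x. L"] Ck_on_const)
      (auto intro: bounded_linear_imp_has_derivative)
qed

lemma Ck_on_add:
  assumes "open S" "Ck_on n f S" "Ck_on n g S"
  shows "Ck_on n (\<lambda>x. f x + g x) S"
  using assms(2,3)
proof (induction n arbitrary: f g)
  case 0
  then show ?case by (simp add: continuous_on_add)
next
  case (Suc n)
  show ?case
    by (rule Ck_on_SucI[OF assms(1) has_derivative_add[OF Ck_on_SucE[OF Suc.prems(1)] Ck_on_SucE[OF Suc.prems(2)]]])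
       (use Suc in auto)
qed

lemma Ck_on_scaleR:
  fixes f :: "'a::euclidean_space \<Rightarrow> real" and g :: "'a \<Rightarrow> 'b::real_normed_vector"
  assumes "open S" "Ck_on n f S" "Ck_on n g S"
  shows "Ck_on n (\<lambda>x. f x *\<^sub>R g x) S"
  using assms(2,3)
proof (induction n arbitrary: f g)
  case 0
  then show ?case by (simp add: continuous_on_scaleR)
next
  case (Suc n)
  show ?case
    using Suc.prems[THEN Ck_on_SucD] Suc.prems
    by (intro Ck_on_SucI[OF assms(1) has_derivative_scaleR[OF Ck_on_SucE[OF Suc.prems(1)] Ck_on_SucE[OF Suc.prems(2)]]]
        Ck_on_add assms(1) Suc.IH) auto
qed

lemma Ck_on_mult:
  fixes f g :: "'a::euclidean_space \<Rightarrow> real"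
  assumes "open S" "Ck_on n f S" "Ck_on n g S"
  shows "Ck_on n (\<lambda>x. f x * g x) S"
  using Ck_on_scaleR[OF assms] by simp

lemma Ck_on_inverse:
  fixes f :: "'a::euclidean_space \<Rightarrow> real"
  assumes "open S" "\<And>x. x \<in> S \<Longrightarrow> f x \<noteq> 0" "Ck_on n f S"
  shows "Ck_on n (\<lambda>x. inverse (f x)) S"
  using assms(3)
proof (induction n)
  case 0
  then show ?case using assms(2) by (simp add: continuous_on_inverse)
next
  case (Suc n)
  have IH: "Ck_on n (\<lambda>x. inverse (f x)) S" using Suc Ck_on_SucD by blast
  have der: "((\<lambda>x. inverse (f x)) has_derivative
      (\<lambda>v. (-1) * (inverse (f x) * frechet_derivative f (at x) v * inverse (f x)))) (at x)"
    if "x \<in> S" for x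
    using Deriv.has_derivative_inverse[OF assms(2)[OF that] Ck_on_SucE[OF Suc.prems that]] by simp
  show ?case
    using Suc.prems by (intro Ck_on_SucI[OF assms(1) der] Ck_on_mult assms(1) IH Ck_on_const) auto
qed

lemma Ck_on_sum:
  assumes "open S" "\<And>i. i \<in> I \<Longrightarrow> Ck_on n (f i) S"
  shows "Ck_on n (\<lambda>x. \<Sum>i\<in>I. f i x) S"
  using assms(2)
  by (induction I rule: infinite_finite_induct) (auto intro!: Ck_on_const Ck_on_add assms(1))

lemma Ck_on_poly:
  fixes f :: "'a::euclidean_space \<Rightarrow> real"
  assumes "open S" "Ck_on n f S"
  shows "Ck_on n (\<lambda>x. poly p (f x)) S"
  by (induction p) (auto intro!: Ck_on_const Ck_on_add Ck_on_mult assms)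

lemma Ck_on_nth:
  "open S \<Longrightarrow> Ck_on n (\<lambda>x::real^'m. x $ i) S"
  by (rule Ck_on_linear) auto

lemma Ck_on_inner_self: "open S \<Longrightarrow> Ck_on n (\<lambda>x::real^'m. x \<bullet> x) S"
  unfolding inner_vec_def by (auto intro!: Ck_on_sum Ck_on_mult Ck_on_nth)

text \<open>A matrix field is a finite sum of constant matrix units with its entries as scalar
  factors, so the scalar rules suffice.\<close>

lemma Ck_on_matrix:
  fixes F :: "'a::euclidean_space \<Rightarrow> real^'n^'m"
  assumes "open S" "\<And>i j. Ck_on n (\<lambda>x. F x $ i $ j) S"
  shows "Ck_on n F S"
proof (rule Ck_on_cong[OF assms(1)])
  show "Ck_on n (\<lambda>x. \<Sum>i\<in>UNIV. \<Sum>j\<in>UNIV. F x $ i $ j *\<^sub>R axis i (axis j 1)) S"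
    by (intro Ck_on_sum Ck_on_scaleR Ck_on_const assms)
  show "(\<Sum>i\<in>UNIV. \<Sum>j\<in>UNIV. F x $ i $ j *\<^sub>R axis i (axis j 1)) = F x" for x
  proof -
    have "(\<Sum>i\<in>UNIV. \<Sum>j\<in>UNIV. F x $ i $ j *\<^sub>R axis i (axis j 1)) $ p $ q = F x $ p $ q" for p q
    proof -
      have "(\<Sum>i\<in>UNIV. \<Sum>j\<in>UNIV. F x $ i $ j *\<^sub>R axis i (axis j 1)) $ p $ q
        = (\<Sum>i\<in>UNIV. \<Sum>j\<in>UNIV. if i = p then (if j = q then F x $ i $ j else 0) else 0)"
        unfolding sum_component by (intro sum.cong refl) (auto simp: axis_def)
      also have "\<dots> = (\<Sum>i\<in>UNIV. if i = p then F x $ i $ q else 0)"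
        by (intro sum.cong) auto
      finally show ?thesis by simp
    qed
    then show ?thesis by (simp add: vec_eq_iff)
  qed
qed

section \<open>Completeness\<close>

lemma gform_continuous:
  assumes "continuous_on S G" "continuous_on S f"
  shows "continuous_on S (\<lambda>t. gform (G t) (f t) (f t))"
proof -
  have "continuous_on S (\<lambda>t. G t *v f t)"
    unfolding matrix_vector_mult_def
    by (intro continuous_on_vec_lambda continuous_on_sum continuous_on_mult
        continuous_on_component assms)
  then show ?thesis unfolding gform_def by (intro continuous_on_inner assms)
qed

lemma norm_matrix_vector_le:
  fixes A :: "real^'n^'m"
  shows "norm (A *v x) \<le> norm A * norm x"
proof -
  have "norm (A *v x) \<le> L2_set (\<lambda>i. norm (A $ i) * norm x) UNIV"
    unfolding norm_vec_def[of "A *v x"]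
    by (intro L2_set_mono) (auto simp: matrix_vector_mul_component Cauchy_Schwarz_ineq2)
  also have "\<dots> = norm A * norm x"
    by (simp add: norm_vec_def[of A] L2_set_left_distrib)
  finally show ?thesis .
qed

lemma gform_le: "gform G v v \<le> norm G * (norm v)\<^sup>2"
proof -
  have "gform G v v \<le> norm v * norm (G *v v)"
    unfolding gform_def by (rule norm_cauchy_schwarz)
  also have "\<dots> \<le> norm v * (norm G * norm v)"
    by (intro mult_left_mono norm_matrix_vector_le) auto
  finally show ?thesis by (simp add: power2_eq_square algebra_simps)
qed

lemma norm_diff_le_integral:
  fixes h :: "real \<Rightarrow> 'b::euclidean_space"
  assumes "\<And>t. t \<in> {0..1} \<Longrightarrow> (h has_vector_derivative h' t) (at t)"
    and "\<And>t. t \<in> {0..1} \<Longrightarrow> norm (h' t) \<le> F t" and "continuous_on {0..1} F"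
  shows "norm (h 1 - h 0) \<le> integral {0..1} F"
proof -
  have "(h' has_integral h 1 - h 0) {0..1}"
    using assms(1) by (intro fundamental_theorem_of_calculus)
      (auto intro: has_vector_derivative_at_within)
  then show ?thesis
    using integral_norm_bound_integral[of h' "{0..1}" F] assms(2,3)
    by (metis has_integral_integrable_integral integrable_continuous_real)
qed

lemma norm_less_1_iff: "x \<in> ball 0 1 \<longleftrightarrow> (norm x)\<^sup>2 < 1"
  by (simp add: power_less_one_iff abs_square_less_1)

text \<open>The bound compares \<open>g\<close> with a multiple of the Poincare metric. It makes
  both the position and the function ln (1 - |x|^2) Lipschitz for the distance of \<open>g\<close>;
  the second keeps Cauchy sequences away from the sphere.\<close>

locale hyperbolic_lower_bound =
  fixes g :: "('m::finite) mfield" and eps :: real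
  assumes cont: "continuous_on (ball 0 1) g" and eps: "eps > 0"
    and lower: "\<And>x v. x \<in> ball 0 1 \<Longrightarrow> gform (g x) v v \<ge> (eps * norm v / (1 - (norm x)\<^sup>2))\<^sup>2"
begin

abbreviation speed :: "(real \<Rightarrow> real^'m) \<Rightarrow> real \<Rightarrow> real" where
  "speed \<gamma> t \<equiv> sqrt (gform (g (\<gamma> t)) (vector_derivative \<gamma> (at t)) (vector_derivative \<gamma> (at t)))"

lemma speed_continuous:
  assumes "\<gamma> C1_differentiable_on {0..1}" "\<gamma> ` {0..1} \<subseteq> ball 0 1"
  shows "continuous_on {0..1} (speed \<gamma>)"
proof -
  have "continuous_on {0..1} \<gamma>"
    using assms(1) C1_diff_imp_diff differentiable_imp_continuous_on by blast
  then have "continuous_on {0..1} (\<lambda>t. g (\<gamma> t))"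
    using continuous_on_compose2[OF cont] assms(2) by blast
  then show ?thesis
    using assms(1) by (intro continuous_on_real_sqrt gform_continuous)
      (auto simp: C1_differentiable_on_eq)
qed

lemma speed_lower:
  assumes "\<gamma> t \<in> ball 0 1"
  shows "eps * norm (vector_derivative \<gamma> (at t)) / (1 - (norm (\<gamma> t))\<^sup>2) \<le> speed \<gamma> t"
    and "eps * norm (vector_derivative \<gamma> (at t)) \<le> speed \<gamma> t"
proof -
  have pos: "1 - (norm (\<gamma> t))\<^sup>2 > 0" using assms norm_less_1_iff[of "\<gamma> t"] by simp
  show *: "eps * norm (vector_derivative \<gamma> (at t)) / (1 - (norm (\<gamma> t))\<^sup>2) \<le> speed \<gamma> t"
    using lower[OF assms, of "vector_derivative \<gamma> (at t)"] by (intro real_le_rsqrt)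
  have "eps * norm (vector_derivative \<gamma> (at t)) \<le>
      eps * norm (vector_derivative \<gamma> (at t)) / (1 - (norm (\<gamma> t))\<^sup>2)"
    using pos eps by (simp add: field_simps mult_nonneg_nonneg)
  with * show "eps * norm (vector_derivative \<gamma> (at t)) \<le> speed \<gamma> t" by linarith
qed

lemma rlength_lower:
  assumes C1: "\<gamma> C1_differentiable_on {0..1}" and im: "\<gamma> ` {0..1} \<subseteq> ball 0 1"
  shows "eps * norm (\<gamma> 1 - \<gamma> 0) \<le> rlength g \<gamma>"
    and "eps * \<bar>ln (1 - (norm (\<gamma> 1))\<^sup>2) - ln (1 - (norm (\<gamma> 0))\<^sup>2)\<bar> \<le> 2 * rlength g \<gamma>"
proof -
  have der: "(\<gamma> has_vector_derivative vector_derivative \<gamma> (at t)) (at t)" if "t \<in> {0..1}" for t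
    using C1 that by (simp add: C1_differentiable_on_eq vector_derivative_works)
  have inb: "\<gamma> t \<in> ball 0 1" if "t \<in> {0..1}" for t using im that by blast
  have "norm (eps *\<^sub>R \<gamma> 1 - eps *\<^sub>R \<gamma> 0) \<le> integral {0..1} (speed \<gamma>)"
  proof (rule norm_diff_le_integral[OF _ _ speed_continuous[OF C1 im]])
    show "((\<lambda>t. eps *\<^sub>R \<gamma> t) has_vector_derivative eps *\<^sub>R vector_derivative \<gamma> (at t)) (at t)"
      if "t \<in> {0..1}" for t
      using der[OF that] by (rule has_vector_derivative_scaleR[OF DERIV_const, simplified])
    show "norm (eps *\<^sub>R vector_derivative \<gamma> (at t)) \<le> speed \<gamma> t" if "t \<in> {0..1}" for t
      using speed_lower(2)[of \<gamma> t, OF inb[OF that]] eps by simp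
  qed
  then show "eps * norm (\<gamma> 1 - \<gamma> 0) \<le> rlength g \<gamma>"
    using eps by (simp add: rlength_def scaleR_diff_right[symmetric])
  \<comment> \<open>The derivative of ln (1 - |x|^2) along the curve is at most 2 |x'| / (1 - |x|^2)
    in absolute value; the factor eps/2 brings it below the speed.\<close>
  define h where "h t = eps / 2 * ln (1 - (norm (\<gamma> t))\<^sup>2)" for t
  define h' where "h' t = eps * (- (\<gamma> t \<bullet> vector_derivative \<gamma> (at t)) / (1 - (norm (\<gamma> t))\<^sup>2))" for t
  have "norm (h 1 - h 0) \<le> integral {0..1} (speed \<gamma>)"
  proof (rule norm_diff_le_integral[OF _ _ speed_continuous[OF C1 im]])
    fix t :: real assume t: "t \<in> {0..1}"
    have pos: "1 - (norm (\<gamma> t))\<^sup>2 > 0" using inb[OF t] norm_less_1_iff[of "\<gamma> t"] by simp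
    then have pos': "1 - \<gamma> t \<bullet> \<gamma> t > 0" by (simp add: power2_norm_eq_inner)
    have "((\<lambda>t. eps / 2 * ln (1 - \<gamma> t \<bullet> \<gamma> t)) has_vector_derivative h' t) (at t)"
      unfolding has_vector_derivative_def h'_def
      using pos'
      by (auto intro!: derivative_eq_intros der[OF t, unfolded has_vector_derivative_def]
          simp: power2_norm_eq_inner inner_commute field_simps)
    then show "(h has_vector_derivative h' t) (at t)"
      unfolding h_def by (simp add: power2_norm_eq_inner)
    have "norm (\<gamma> t) \<le> 1" using inb[OF t] by simp
    then have "\<bar>\<gamma> t \<bullet> vector_derivative \<gamma> (at t)\<bar> \<le> norm (vector_derivative \<gamma> (at t))"
      using Cauchy_Schwarz_ineq2[of "\<gamma> t" "vector_derivative \<gamma> (at t)"]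
      by (meson mult_left_le_one_le norm_ge_zero order_trans)
    then have "norm (h' t) \<le> eps * norm (vector_derivative \<gamma> (at t)) / (1 - (norm (\<gamma> t))\<^sup>2)"
      unfolding h'_def using pos eps by (simp add: abs_mult divide_right_mono)
    then show "norm (h' t) \<le> speed \<gamma> t" using speed_lower(1)[of \<gamma> t, OF inb[OF t]] by linarith
  qed
  moreover have "norm (h 1 - h 0) = eps / 2 * \<bar>ln (1 - (norm (\<gamma> 1))\<^sup>2) - ln (1 - (norm (\<gamma> 0))\<^sup>2)\<bar>"
    unfolding h_def right_diff_distrib[symmetric] using eps by (simp add: abs_mult)
  ultimately show "eps * \<bar>ln (1 - (norm (\<gamma> 1))\<^sup>2) - ln (1 - (norm (\<gamma> 0))\<^sup>2)\<bar> \<le> 2 * rlength g \<gamma>"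
    by (simp add: rlength_def)
qed

lemma rlength_nonneg:
  assumes "\<gamma> C1_differentiable_on {0..1}" "\<gamma> ` {0..1} \<subseteq> ball 0 1"
  shows "rlength g \<gamma> \<ge> 0"
  using rlength_lower(1)[OF assms] eps by (meson mult_nonneg_nonneg norm_ge_zero order_trans less_imp_le)

definition seg :: "real^'m \<Rightarrow> real^'m \<Rightarrow> real \<Rightarrow> real^'m" where
  "seg p q t = p + t *\<^sub>R (q - p)"

lemma seg_ends [simp]: "seg p q 0 = p" "seg p q 1 = q"
  by (auto simp: seg_def)

lemma seg_derivative: "(seg p q has_vector_derivative (q - p)) (at t)"
  unfolding seg_def has_vector_derivative_def by (auto intro!: derivative_eq_intros)

lemma seg_C1: "seg p q C1_differentiable_on {0..1}"
  unfolding C1_differentiable_on_def using seg_derivative by (intro exI[of _ "\<lambda>_. q - p"]) auto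

lemma seg_in_convex:
  assumes "convex K" "p \<in> K" "q \<in> K"
  shows "seg p q ` {0..1} \<subseteq> K"
proof safe
  fix t :: real assume "t \<in> {0..1}"
  then have "(1 - t) *\<^sub>R p + t *\<^sub>R q \<in> K" using assms by (intro convexD) auto
  then show "seg p q t \<in> K" by (simp add: seg_def algebra_simps)
qed

lemma rdist_lower:
  assumes "p \<in> ball 0 1" "q \<in> ball 0 1"
  shows "eps * norm (q - p) \<le> rdist g p q"
    and "eps * \<bar>ln (1 - (norm q)\<^sup>2) - ln (1 - (norm p)\<^sup>2)\<bar> \<le> 2 * rdist g p q"
proof -
  let ?S = "{rlength g \<gamma> | \<gamma>. \<gamma> C1_differentiable_on {0..1} \<and> \<gamma> 0 = p \<and> \<gamma> 1 = q \<and> \<gamma> ` {0..1} \<subseteq> ball 0 1}"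
  have "rlength g (seg p q) \<in> ?S"
    using seg_C1[of p q] seg_in_convex[OF convex_ball assms] by (intro CollectI exI[of _ "seg p q"]) simp
  then have ne: "?S \<noteq> {}" by blast
  show "eps * norm (q - p) \<le> rdist g p q"
    unfolding rdist_def by (rule cInf_greatest[OF ne]) (auto dest: rlength_lower)
  have "eps * \<bar>ln (1 - (norm q)\<^sup>2) - ln (1 - (norm p)\<^sup>2)\<bar> / 2 \<le> rdist g p q"
    unfolding rdist_def by (rule cInf_greatest[OF ne]) (auto dest: rlength_lower(2))
  then show "eps * \<bar>ln (1 - (norm q)\<^sup>2) - ln (1 - (norm p)\<^sup>2)\<bar> \<le> 2 * rdist g p q" by simp
qed

text \<open>The straight segment competes in the infimum, and convexity keeps it where
  \<open>g\<close> is bounded.\<close>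

lemma rdist_upper:
  assumes K: "convex K" "K \<subseteq> ball 0 1" "p \<in> K" "q \<in> K" and B: "\<And>x. x \<in> K \<Longrightarrow> norm (g x) \<le> B"
  shows "rdist g p q \<le> sqrt B * norm (q - p)"
proof -
  have im: "seg p q ` {0..1} \<subseteq> K" using seg_in_convex K by blast
  then have im': "seg p q ` {0..1} \<subseteq> ball 0 1" using K(2) by blast
  have "B \<ge> 0" using B[OF K(3)] norm_ge_zero order_trans by blast
  have "rdist g p q \<le> rlength g (seg p q)"
    unfolding rdist_def
  proof (rule cInf_lower)
    show "rlength g (seg p q) \<in> {rlength g \<gamma> | \<gamma>. \<gamma> C1_differentiable_on {0..1} \<and> \<gamma> 0 = p \<and> \<gamma> 1 = q \<and> \<gamma> ` {0..1} \<subseteq> ball 0 1}"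
      using seg_C1[of p q] im' by (intro CollectI exI[of _ "seg p q"]) simp
    show "bdd_below {rlength g \<gamma> | \<gamma>. \<gamma> C1_differentiable_on {0..1} \<and> \<gamma> 0 = p \<and> \<gamma> 1 = q \<and> \<gamma> ` {0..1} \<subseteq> ball 0 1}"
      by (rule bdd_belowI[of _ 0]) (use rlength_nonneg in auto)
  qed
  also have "\<dots> \<le> integral {0..1::real} (\<lambda>t. sqrt B * norm (q - p))"
    unfolding rlength_def
  proof (rule integral_le)
    show "speed (seg p q) integrable_on {0..1}"
      by (intro integrable_continuous_real speed_continuous seg_C1 im')
    fix t :: real assume t: "t \<in> {0..1}"
    have "vector_derivative (seg p q) (at t) = q - p"
      by (rule vector_derivative_at[OF seg_derivative])
    moreover have "gform (g (seg p q t)) (q - p) (q - p) \<le> B * (norm (q - p))\<^sup>2"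
      using gform_le[of "g (seg p q t)" "q - p"] B[of "seg p q t"] im t
      by (meson image_subset_iff mult_right_mono order_trans zero_le_power2)
    ultimately show "speed (seg p q) t \<le> sqrt B * norm (q - p)"
      by (metis real_sqrt_le_mono real_sqrt_mult real_sqrt_abs abs_norm_cancel)
  qed auto
  finally show ?thesis by simp
qed

lemma complete: "complete_metric g"
  unfolding complete_metric_def
proof (intro allI impI, elim conjE)
  fix s :: "nat \<Rightarrow> real^'m"
  assume inb: "\<forall>n. s n \<in> ball 0 1"
    and cau: "\<forall>e>0. \<exists>N. \<forall>m\<ge>N. \<forall>n\<ge>N. rdist g (s m) (s n) < e"
  obtain N where N: "\<And>m n. m \<ge> N \<Longrightarrow> n \<ge> N \<Longrightarrow> rdist g (s m) (s n) < 1"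
    using cau[rule_format, of 1] by auto
  \<comment> \<open>From index \<open>N\<close> on the distance to \<open>s N\<close> is below 1, so
    ln (1 - |x|^2) changes by less than 2/eps. Thus \<open>L\<close> bounds it from below, and
    \<open>R\<close> is the radius of the closed ball that contains the tail.\<close>
  define L where "L = ln (1 - (norm (s N))\<^sup>2) - 2 / eps"
  define R where "R = sqrt (1 - exp L)"
  have pos: "1 - (norm (s n))\<^sup>2 > 0" for n
    using inb norm_less_1_iff[of "s n"] by simp
  have sR: "norm (s n) \<le> R" and L1: "exp L \<le> 1 - (norm (s n))\<^sup>2" if "n \<ge> N" for n
  proof -
    have "eps * \<bar>ln (1 - (norm (s n))\<^sup>2) - ln (1 - (norm (s N))\<^sup>2)\<bar> < 2"
      using rdist_lower(2)[of "s N" "s n"] N[of N n] inb that by auto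
    then have "\<bar>ln (1 - (norm (s n))\<^sup>2) - ln (1 - (norm (s N))\<^sup>2)\<bar> < 2 / eps"
      using eps by (simp add: field_simps)
    then have "L \<le> ln (1 - (norm (s n))\<^sup>2)" unfolding L_def by linarith
    then show *: "exp L \<le> 1 - (norm (s n))\<^sup>2" using pos[of n] ln_ge_iff by blast
    show "norm (s n) \<le> R" unfolding R_def using * by (intro real_le_rsqrt) linarith
  qed
  have R: "R < 1" unfolding R_def using L1[of N] by simp
  have sub: "cball 0 R \<subseteq> ball (0::real^'m) 1" using R by auto
  have "Cauchy s"
    unfolding Cauchy_def
  proof (intro allI impI)
    fix e :: real assume "e > 0"
    then obtain M where M: "\<And>m n. m \<ge> M \<Longrightarrow> n \<ge> M \<Longrightarrow> rdist g (s m) (s n) < eps * e"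
      using cau[rule_format, of "eps * e"] eps by auto
    have "dist (s m) (s n) < e" if "m \<ge> M" "n \<ge> M" for m n
    proof -
      have "eps * norm (s n - s m) < eps * e"
        using rdist_lower(1)[of "s m" "s n"] M[OF that] inb by auto
      then show ?thesis using eps by (simp add: dist_norm norm_minus_commute)
    qed
    then show "\<exists>M. \<forall>m\<ge>M. \<forall>n\<ge>M. dist (s m) (s n) < e" by blast
  qed
  then obtain q where q: "s \<longlonglongrightarrow> q" using Cauchy_convergent convergent_def by blast
  have qR: "q \<in> cball 0 R"
    using Lim_in_closed_set[OF closed_cball _ sequentially_bot q, of 0 R] sR
    by (auto simp: eventually_sequentially)
  \<comment> \<open>Converting Euclidean convergence back to \<open>rdist\<close> needs a bound on
    \<open>g\<close>, which is available on the smaller closed ball.\<close>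
  have "compact (g ` cball 0 R)"
    by (rule compact_continuous_image[OF continuous_on_subset[OF cont sub] compact_cball])
  then have "bounded (g ` cball 0 R)" by (rule compact_imp_bounded)
  then obtain B where B: "\<And>x. x \<in> cball 0 R \<Longrightarrow> norm (g x) \<le> B"
    unfolding bounded_iff by blast
  have "(\<lambda>n. rdist g (s n) q) \<longlonglongrightarrow> 0"
  proof (rule tendsto_sandwich)
    show "\<forall>\<^sub>F n in sequentially. 0 \<le> rdist g (s n) q"
    proof (intro always_eventually allI)
      fix n
      have "0 \<le> eps * norm (q - s n)" using eps by simp
      also have "\<dots> \<le> rdist g (s n) q" using rdist_lower(1) inb qR sub by blast
      finally show "0 \<le> rdist g (s n) q" .
    qed
    show "\<forall>\<^sub>F n in sequentially. rdist g (s n) q \<le> sqrt B * norm (q - s n)"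
      unfolding eventually_sequentially
      using sR qR B by (intro exI[of _ N]) (auto intro!: rdist_upper[OF convex_cball sub])
    have "(\<lambda>n. sqrt B * norm (q - s n)) \<longlonglongrightarrow> sqrt B * norm (q - q)"
      by (intro tendsto_intros q)
    then show "(\<lambda>n. sqrt B * norm (q - s n)) \<longlonglongrightarrow> 0" by simp
  qed auto
  then show "\<exists>q\<in>ball 0 1. (\<lambda>n. rdist g (s n) q) \<longlonglongrightarrow> 0" using qR sub by blast
qed

end

section \<open>Unitarily invariant connections and their curvature\<close>

definition trace_of :: "(real^'m \<Rightarrow> real^'m) \<Rightarrow> real" where
  "trace_of L = (\<Sum>i\<in>UNIV. L (axis i 1) $ i)"

lemma trace_of_add: "trace_of (\<lambda>v. L v + M v) = trace_of L + trace_of M"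
  by (simp add: trace_of_def sum.distrib)

lemma trace_of_scaleR: "trace_of (\<lambda>v. r *\<^sub>R L v) = r * trace_of L"
  by (simp add: trace_of_def sum_distrib_left)

lemma trace_of_outer: "trace_of (\<lambda>v. (y \<bullet> v) *\<^sub>R U) = y \<bullet> U"
  by (simp add: trace_of_def inner_axis) (simp add: inner_vec_def)

lemma trace_of_id: "trace_of (\<lambda>v::real^'m. v) = real CARD('m)"
  by (simp add: trace_of_def)

lemma trace_of_uminus: "trace_of (\<lambda>v::real^'m. - v) = - real CARD('m)"
  by (simp add: trace_of_def)

lemmas trace_of_simps = trace_of_add trace_of_scaleR trace_of_outer trace_of_id trace_of_uminus

locale complex_structure =
  fixes J :: "real^'m^'m"
  assumes JJ: "J ** J = - mat 1" and JT: "transpose J ** J = mat 1"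
begin

lemma J_J [simp]: "J *v (J *v x) = - x"
proof -
  have "(- mat 1 :: real^'m^'m) *v x = (0 - mat 1) *v x" by simp
  also have "\<dots> = - x" unfolding matrix_vector_mult_diff_rdistrib by simp
  finally show ?thesis by (simp add: matrix_vector_mul_assoc JJ)
qed

lemma J_inner_J [simp]: "(J *v x) \<bullet> (J *v y) = x \<bullet> y"
  by (metis JT dot_lmul_matrix matrix_vector_mul_assoc matrix_vector_mul_lid transpose_matrix_vector)

lemma J_skew: "x \<bullet> (J *v y) = - ((J *v x) \<bullet> y)"
  using J_inner_J[of x "J *v y"] by simp

lemma J_self [simp]: "(J *v x) \<bullet> x = 0" "x \<bullet> (J *v x) = 0"
  using J_skew[of x x] by (simp_all add: inner_commute)

lemma J_pair:
  "y \<bullet> x = x \<bullet> y" "y \<bullet> (J *v x) = (J *v x) \<bullet> y" "(J *v y) \<bullet> x = - ((J *v x) \<bullet> y)"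
  using J_skew[of x y] by (simp_all add: inner_commute)

lemma trace_of_J: "trace_of (\<lambda>v. J *v v) = 0"
proof -
  have "(J *v axis i 1) $ i = 0" for i
    using J_self(1)[of "axis i 1"] by (simp add: inner_axis)
  then show ?thesis by (simp add: trace_of_def)
qed

text \<open>The general shape of the Christoffel symbols of a unitarily invariant metric at \<open>z\<close>; \<open>dconn\<close> is its
  derivative in direction \<open>V\<close> with frozen coefficients \<open>p1, ..., p6\<close>, which depend on \<open>z \<bullet> z\<close> only.\<close>
definition conn :: "real \<Rightarrow> real \<Rightarrow> real \<Rightarrow> real \<Rightarrow> real \<Rightarrow> real \<Rightarrow> real^'m \<Rightarrow> real^'m \<Rightarrow> real^'m \<Rightarrow> real^'m" where
  "conn p1 p2 p3 p4 p5 p6 z X Y =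
     (p1 * (z \<bullet> X)) *\<^sub>R Y + (p1 * (z \<bullet> Y)) *\<^sub>R X
     + (p2 * ((J *v z) \<bullet> Y)) *\<^sub>R (J *v X) + (p2 * ((J *v z) \<bullet> X)) *\<^sub>R (J *v Y)
     + (p3 * (X \<bullet> Y) + p4 * (z \<bullet> X) * (z \<bullet> Y) + p5 * ((J *v z) \<bullet> X) * ((J *v z) \<bullet> Y)) *\<^sub>R z
     + (p6 * ((z \<bullet> X) * ((J *v z) \<bullet> Y) + (z \<bullet> Y) * ((J *v z) \<bullet> X))) *\<^sub>R (J *v z)"

definition dconn :: "real \<Rightarrow> real \<Rightarrow> real \<Rightarrow> real \<Rightarrow> real \<Rightarrow> real \<Rightarrow> real^'m \<Rightarrow> real^'m \<Rightarrow> real^'m \<Rightarrow> real^'m \<Rightarrow> real^'m" where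
  "dconn p1 p2 p3 p4 p5 p6 z V X Y =
     (p1 * (V \<bullet> X)) *\<^sub>R Y + (p1 * (V \<bullet> Y)) *\<^sub>R X
     + (p2 * ((J *v V) \<bullet> Y)) *\<^sub>R (J *v X) + (p2 * ((J *v V) \<bullet> X)) *\<^sub>R (J *v Y)
     + (p4 * ((V \<bullet> X) * (z \<bullet> Y) + (z \<bullet> X) * (V \<bullet> Y))
        + p5 * (((J *v V) \<bullet> X) * ((J *v z) \<bullet> Y) + ((J *v z) \<bullet> X) * ((J *v V) \<bullet> Y))) *\<^sub>R z
     + (p3 * (X \<bullet> Y) + p4 * (z \<bullet> X) * (z \<bullet> Y) + p5 * ((J *v z) \<bullet> X) * ((J *v z) \<bullet> Y)) *\<^sub>R V
     + (p6 * ((V \<bullet> X) * ((J *v z) \<bullet> Y) + (z \<bullet> X) * ((J *v V) \<bullet> Y)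
        + (V \<bullet> Y) * ((J *v z) \<bullet> X) + (z \<bullet> Y) * ((J *v V) \<bullet> X))) *\<^sub>R (J *v z)
     + (p6 * ((z \<bullet> X) * ((J *v z) \<bullet> Y) + (z \<bullet> Y) * ((J *v z) \<bullet> X))) *\<^sub>R (J *v V)"

lemma conn_inner:
  "conn p1 p2 p3 p4 p5 p6 z X Y \<bullet> U =
     p1 * (z \<bullet> X) * (Y \<bullet> U) + p1 * (z \<bullet> Y) * (X \<bullet> U)
     + p2 * ((J *v z) \<bullet> Y) * ((J *v X) \<bullet> U) + p2 * ((J *v z) \<bullet> X) * ((J *v Y) \<bullet> U)
     + (p3 * (X \<bullet> Y) + p4 * (z \<bullet> X) * (z \<bullet> Y) + p5 * ((J *v z) \<bullet> X) * ((J *v z) \<bullet> Y)) * (z \<bullet> U)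
     + p6 * ((z \<bullet> X) * ((J *v z) \<bullet> Y) + (z \<bullet> Y) * ((J *v z) \<bullet> X)) * ((J *v z) \<bullet> U)"
  by (simp add: conn_def inner_add_left)

lemma dconn_inner:
  "dconn p1 p2 p3 p4 p5 p6 z V X Y \<bullet> U =
     p1 * (V \<bullet> X) * (Y \<bullet> U) + p1 * (V \<bullet> Y) * (X \<bullet> U)
     + p2 * ((J *v V) \<bullet> Y) * ((J *v X) \<bullet> U) + p2 * ((J *v V) \<bullet> X) * ((J *v Y) \<bullet> U)
     + (p4 * ((V \<bullet> X) * (z \<bullet> Y) + (z \<bullet> X) * (V \<bullet> Y))
        + p5 * (((J *v V) \<bullet> X) * ((J *v z) \<bullet> Y) + ((J *v z) \<bullet> X) * ((J *v V) \<bullet> Y))) * (z \<bullet> U)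
     + (p3 * (X \<bullet> Y) + p4 * (z \<bullet> X) * (z \<bullet> Y) + p5 * ((J *v z) \<bullet> X) * ((J *v z) \<bullet> Y)) * (V \<bullet> U)
     + p6 * ((V \<bullet> X) * ((J *v z) \<bullet> Y) + (z \<bullet> X) * ((J *v V) \<bullet> Y)
        + (V \<bullet> Y) * ((J *v z) \<bullet> X) + (z \<bullet> Y) * ((J *v V) \<bullet> X)) * ((J *v z) \<bullet> U)
     + p6 * ((z \<bullet> X) * ((J *v z) \<bullet> Y) + (z \<bullet> Y) * ((J *v z) \<bullet> X)) * ((J *v V) \<bullet> U)"
  by (simp add: dconn_def inner_add_left)

text \<open>Here \<open>J\<close> is moved off \<open>W\<close>, so that \<open>W\<close> occurs
  only as the left factor of an inner product. If \<open>W\<close> is itself a value of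
  \<open>conn\<close>, then \<open>conn_inner\<close> applies a second time.\<close>

lemma conn_conn_inner:
  "conn p1 p2 p3 p4 p5 p6 z X W \<bullet> U =
     p1 * (z \<bullet> X) * (W \<bullet> U) + p1 * (W \<bullet> z) * (X \<bullet> U)
     + p2 * (W \<bullet> (J *v z)) * ((J *v X) \<bullet> U) - p2 * ((J *v z) \<bullet> X) * (W \<bullet> (J *v U))
     + (p3 * (W \<bullet> X) + p4 * (z \<bullet> X) * (W \<bullet> z) + p5 * ((J *v z) \<bullet> X) * (W \<bullet> (J *v z))) * (z \<bullet> U)
     + p6 * ((z \<bullet> X) * (W \<bullet> (J *v z)) + (W \<bullet> z) * ((J *v z) \<bullet> X)) * ((J *v z) \<bullet> U)"
  unfolding conn_inner J_skew[of W U] by (simp add: inner_commute)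

lemma conn_linear:
  "linear (conn p1 p2 p3 p4 p5 p6 z X)" "linear (\<lambda>X. conn p1 p2 p3 p4 p5 p6 z X Y)"
  by (rule linearI; simp add: conn_def inner_add_right inner_add_left algebra_simps matrix_vector_right_distrib matrix_vector_mult_scaleR)+

lemma dconn_linear:
  "linear (dconn p1 p2 p3 p4 p5 p6 z V X)" "linear (\<lambda>X. dconn p1 p2 p3 p4 p5 p6 z V X Y)"
  "linear (\<lambda>V. dconn p1 p2 p3 p4 p5 p6 z V X Y)"
  by (rule linearI; simp add: dconn_def inner_add_right inner_add_left algebra_simps matrix_vector_right_distrib matrix_vector_mult_scaleR)+

lemma conn_sym: "conn p1 p2 p3 p4 p5 p6 z X Y = conn p1 p2 p3 p4 p5 p6 z Y X"
  by (simp add: conn_def inner_commute algebra_simps)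

text \<open>Sorted as a linear map of \<open>V\<close>: a multiple of the identity, a multiple of
  \<open>J\<close>, and rank-one maps built on the functionals \<open>z\<close>, \<open>Jz\<close>
  and \<open>W\<close>. Traces can be read off from this form.\<close>

lemma conn_expand:
  "conn p1 p2 p3 p4 p5 p6 z V W =
     (p1 * (z \<bullet> W)) *\<^sub>R V + (p2 * ((J *v z) \<bullet> W)) *\<^sub>R (J *v V)
     + (z \<bullet> V) *\<^sub>R (p1 *\<^sub>R W + (p4 * (z \<bullet> W)) *\<^sub>R z + (p6 * ((J *v z) \<bullet> W)) *\<^sub>R (J *v z))
     + ((J *v z) \<bullet> V) *\<^sub>R (p2 *\<^sub>R (J *v W) + (p5 * ((J *v z) \<bullet> W)) *\<^sub>R z + (p6 * (z \<bullet> W)) *\<^sub>R (J *v z))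
     + (W \<bullet> V) *\<^sub>R (p3 *\<^sub>R z)"
  by (simp add: conn_def inner_commute algebra_simps)

lemma trace_conn:
  "trace_of (\<lambda>V. conn p1 p2 p3 p4 p5 p6 z V W) =
     (z \<bullet> W) * (p1 * (real CARD('m) + 1) + p2 + p3 + (z \<bullet> z) * (p4 + p6))"
  unfolding conn_expand[of _ _ _ _ _ _ _ _ W] trace_of_simps trace_of_J
  by (simp add: inner_add_right inner_commute algebra_simps)

text \<open>Serves \<open>trace_conn_conn\<close>, where the inner connection contributes a
  \<open>J V\<close> term. Skewness of \<open>J\<close> turns each functional of \<open>J V\<close>
  into a functional of \<open>V\<close>.\<close>

lemma trace_conn_J:
  "trace_of (\<lambda>V. conn p1 p2 p3 p4 p5 p6 z (J *v V) W) =
     ((J *v z) \<bullet> W) * (p3 + (z \<bullet> z) * (p5 - p6) - p2 * (real CARD('m) + 1) - p1)"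
proof -
  have skew: "x \<bullet> (J *v V) = (- (J *v x)) \<bullet> V" for x V using J_skew[of x V] by simp
  show ?thesis
    unfolding conn_expand[of _ _ _ _ _ _ _ _ W] skew J_inner_J J_J trace_of_simps trace_of_J
    by (simp add: inner_add_right J_pair[of W z] J_skew[of z W] algebra_simps)
qed

text \<open>The two derivative terms of the Ricci tensor trace over different slots: this lemma over
  the direction of differentiation, \<open>trace_dconn\<close> over an argument of the
  connection.\<close>

lemma trace_dconn_direction:
  "trace_of (\<lambda>V. dconn p1 p2 p3 p4 p5 p6 z V X Y) =
     (X \<bullet> Y) * (2 * p1 - 2 * p2 + real CARD('m) * p3)
      + (z \<bullet> X) * (z \<bullet> Y) * ((real CARD('m) + 2) * p4 - 2 * p6)
      + ((J *v z) \<bullet> X) * ((J *v z) \<bullet> Y) * ((real CARD('m) + 2) * p5 + 2 * p6)"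
proof -
  have expand: "dconn p1 p2 p3 p4 p5 p6 z V X Y =
      (X \<bullet> V) *\<^sub>R (p1 *\<^sub>R Y + (p4 * (z \<bullet> Y)) *\<^sub>R z + (p6 * ((J *v z) \<bullet> Y)) *\<^sub>R (J *v z))
    + (Y \<bullet> V) *\<^sub>R (p1 *\<^sub>R X + (p4 * (z \<bullet> X)) *\<^sub>R z + (p6 * ((J *v z) \<bullet> X)) *\<^sub>R (J *v z))
    + ((J *v X) \<bullet> V) *\<^sub>R (- (p2 *\<^sub>R (J *v Y) + (p5 * ((J *v z) \<bullet> Y)) *\<^sub>R z + (p6 * (z \<bullet> Y)) *\<^sub>R (J *v z)))
    + ((J *v Y) \<bullet> V) *\<^sub>R (- (p2 *\<^sub>R (J *v X) + (p5 * ((J *v z) \<bullet> X)) *\<^sub>R z + (p6 * (z \<bullet> X)) *\<^sub>R (J *v z)))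
    + (p3 * (X \<bullet> Y) + p4 * (z \<bullet> X) * (z \<bullet> Y) + p5 * ((J *v z) \<bullet> X) * ((J *v z) \<bullet> Y)) *\<^sub>R V
    + (p6 * ((z \<bullet> X) * ((J *v z) \<bullet> Y) + (z \<bullet> Y) * ((J *v z) \<bullet> X))) *\<^sub>R (J *v V)" for V
    unfolding dconn_def J_pair(3)[of V X] J_pair(3)[of V Y] inner_commute[of V]
    by (simp add: algebra_simps)
  show ?thesis
    unfolding expand trace_of_simps trace_of_J
    using J_pair[of X z] J_skew[of z X] J_pair[of Y z] J_skew[of z Y] J_pair[of Y X] J_skew[of X Y]
    by (simp add: inner_add_right algebra_simps)
qed

lemma trace_dconn:
  "trace_of (\<lambda>V. dconn p1 p2 p3 p4 p5 p6 z X V Y) =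
     (X \<bullet> Y) * (p1 * (real CARD('m) + 1) + p2 + p3 + (z \<bullet> z) * (p4 + p6))
      + 2 * (z \<bullet> X) * (z \<bullet> Y) * (p4 + p6)"
proof -
  have expand: "dconn p1 p2 p3 p4 p5 p6 z X V Y =
      (X \<bullet> V) *\<^sub>R (p1 *\<^sub>R Y + (p4 * (z \<bullet> Y)) *\<^sub>R z + (p6 * ((J *v z) \<bullet> Y)) *\<^sub>R (J *v z))
    + (Y \<bullet> V) *\<^sub>R (p3 *\<^sub>R X)
    + ((J *v X) \<bullet> V) *\<^sub>R (p2 *\<^sub>R (J *v Y) + (p5 * ((J *v z) \<bullet> Y)) *\<^sub>R z + (p6 * (z \<bullet> Y)) *\<^sub>R (J *v z))
    + (z \<bullet> V) *\<^sub>R ((p4 * (X \<bullet> Y)) *\<^sub>R z + (p4 * (z \<bullet> Y)) *\<^sub>R X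
         + (p6 * ((J *v X) \<bullet> Y)) *\<^sub>R (J *v z) + (p6 * ((J *v z) \<bullet> Y)) *\<^sub>R (J *v X))
    + ((J *v z) \<bullet> V) *\<^sub>R ((p5 * ((J *v X) \<bullet> Y)) *\<^sub>R z + (p5 * ((J *v z) \<bullet> Y)) *\<^sub>R X
         + (p6 * (X \<bullet> Y)) *\<^sub>R (J *v z) + (p6 * (z \<bullet> Y)) *\<^sub>R (J *v X))
    + (p1 * (X \<bullet> Y)) *\<^sub>R V + (p2 * ((J *v X) \<bullet> Y)) *\<^sub>R (J *v V)" for V
    unfolding dconn_def inner_commute[of V] by (simp add: algebra_simps)
  show ?thesis
    unfolding expand trace_of_simps trace_of_J
    using J_pair[of X z] J_skew[of z X] J_pair[of Y z] J_skew[of z Y] J_pair[of Y X] J_skew[of X Y]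
    by (simp add: inner_add_right algebra_simps)
qed

text \<open>Expanding the inner connection by \<open>conn_expand\<close> leaves the two traces
  already known, from its identity and \<open>J\<close> terms, and one scalar product for each
  rank-one term.\<close>

lemma trace_conn_conn:
  "trace_of (\<lambda>V. conn p1 p2 p3 p4 p5 p6 z X (conn p1 p2 p3 p4 p5 p6 z V Y)) =
     p1 * (z \<bullet> Y) * trace_of (\<lambda>V. conn p1 p2 p3 p4 p5 p6 z V X)
     + p2 * ((J *v z) \<bullet> Y) * trace_of (\<lambda>V. conn p1 p2 p3 p4 p5 p6 z (J *v V) X)
     + z \<bullet> conn p1 p2 p3 p4 p5 p6 z X (p1 *\<^sub>R Y + (p4 * (z \<bullet> Y)) *\<^sub>R z + (p6 * ((J *v z) \<bullet> Y)) *\<^sub>R (J *v z))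
     + (J *v z) \<bullet> conn p1 p2 p3 p4 p5 p6 z X (p2 *\<^sub>R (J *v Y) + (p5 * ((J *v z) \<bullet> Y)) *\<^sub>R z + (p6 * (z \<bullet> Y)) *\<^sub>R (J *v z))
     + p3 * (Y \<bullet> conn p1 p2 p3 p4 p5 p6 z X z)"
  unfolding conn_expand[of _ _ _ _ _ _ _ _ Y]
    linear_add[OF conn_linear(1)] linear_scale[OF conn_linear(1)] conn_sym[of _ _ _ _ _ _ z X]
    trace_of_simps inner_scaleR_right
  by simp

end

section \<open>Curvature of an invariant connection as a polynomial in scalar products\<close>

locale conn_coeffs = complex_structure J for J :: "real^'m^'m" +
  fixes p1 p2 p3 p4 p5 p6 q1 q2 q3 q4 q5 q6 :: real
begin

abbreviation gam :: "real^'m \<Rightarrow> real^'m \<Rightarrow> real^'m \<Rightarrow> real^'m" where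
  "gam \<equiv> conn p1 p2 p3 p4 p5 p6"

text \<open>Chain rule: the coefficients are functions of \<open>z \<bullet> z\<close>, whose
  derivative along \<open>V\<close> is 2 (z . V), and \<open>dconn\<close> differentiates the
  explicit occurrences of \<open>z\<close>.\<close>

abbreviation dgam :: "real^'m \<Rightarrow> real^'m \<Rightarrow> real^'m \<Rightarrow> real^'m \<Rightarrow> real^'m" where
  "dgam z V X Y \<equiv> (2 * (z \<bullet> V)) *\<^sub>R conn q1 q2 q3 q4 q5 q6 z X Y + dconn p1 p2 p3 p4 p5 p6 z V X Y"

definition curv :: "real^'m \<Rightarrow> real^'m \<Rightarrow> real^'m \<Rightarrow> real^'m \<Rightarrow> real^'m" where
  "curv z X Y Z = dgam z X Y Z - dgam z Y X Z + gam z X (gam z Y Z) - gam z Y (gam z X Z)"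

lemma curv_inner:
  "curv z X Y Z \<bullet> U = 2 * (z \<bullet> X) * (conn q1 q2 q3 q4 q5 q6 z Y Z \<bullet> U) + dconn p1 p2 p3 p4 p5 p6 z X Y Z \<bullet> U
    - 2 * (z \<bullet> Y) * (conn q1 q2 q3 q4 q5 q6 z X Z \<bullet> U) - dconn p1 p2 p3 p4 p5 p6 z Y X Z \<bullet> U
    + gam z X (gam z Y Z) \<bullet> U - gam z Y (gam z X Z) \<bullet> U"
  by (simp add: curv_def inner_add_left inner_diff_left)

context
  fixes z X Y :: "real^'m" and t a b al be sxx sxy syy om :: real
  defines "t \<equiv> z \<bullet> z" and "a \<equiv> z \<bullet> X" and "b \<equiv> z \<bullet> Y"
    and "al \<equiv> (J *v z) \<bullet> X" and "be \<equiv> (J *v z) \<bullet> Y"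
    and "sxx \<equiv> X \<bullet> X" and "sxy \<equiv> X \<bullet> Y" and "syy \<equiv> Y \<bullet> Y" and "om \<equiv> (J *v X) \<bullet> Y"
begin

text \<open>A normal form: every product among \<open>z\<close>, \<open>X\<close>, \<open>Y\<close>
  and their images under \<open>J\<close> is zero or, up to sign, one of nine scalars. After this
  rewriting each curvature formula is a polynomial identity.\<close>

lemma inner_atoms:
  "z \<bullet> z = t" "(J *v z) \<bullet> (J *v z) = t" "(J *v z) \<bullet> z = 0" "z \<bullet> (J *v z) = 0"
  "z \<bullet> X = a" "X \<bullet> z = a" "(J *v z) \<bullet> X = al" "X \<bullet> (J *v z) = al"
  "(J *v X) \<bullet> z = - al" "z \<bullet> (J *v X) = - al" "(J *v z) \<bullet> (J *v X) = a" "(J *v X) \<bullet> (J *v z) = a"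
  "z \<bullet> Y = b" "Y \<bullet> z = b" "(J *v z) \<bullet> Y = be" "Y \<bullet> (J *v z) = be"
  "(J *v Y) \<bullet> z = - be" "z \<bullet> (J *v Y) = - be" "(J *v z) \<bullet> (J *v Y) = b" "(J *v Y) \<bullet> (J *v z) = b"
  "X \<bullet> X = sxx" "X \<bullet> Y = sxy" "Y \<bullet> X = sxy" "Y \<bullet> Y = syy"
  "(J *v X) \<bullet> Y = om" "Y \<bullet> (J *v X) = om" "(J *v Y) \<bullet> X = - om" "X \<bullet> (J *v Y) = - om"
  "(J *v X) \<bullet> X = 0" "X \<bullet> (J *v X) = 0" "(J *v Y) \<bullet> Y = 0" "Y \<bullet> (J *v Y) = 0"
  "(J *v X) \<bullet> (J *v X) = sxx" "(J *v X) \<bullet> (J *v Y) = sxy" "(J *v Y) \<bullet> (J *v X) = sxy" "(J *v Y) \<bullet> (J *v Y) = syy"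
  unfolding t_def a_def b_def al_def be_def sxx_def sxy_def syy_def om_def
  using J_pair[of X z] J_skew[of z X] J_pair[of Y z] J_skew[of z Y] J_pair[of Y X] J_skew[of X Y] by (simp_all add: inner_commute)

text \<open>Lowering an index with a metric built from the identity, \<open>z\<close> and
  \<open>Jz\<close> only tests R(X,Y)Y against \<open>X\<close>, \<open>z\<close> and
  \<open>Jz\<close>. This lemma and the next two provide these three products.\<close>

lemma curv_inner_X:
  "curv z X Y Y \<bullet> X =
     (p2 * p4 + p2 * p5 - p3 * p5 + p3 * p6 - p4 * p5 * t - p4 * p6 * t + p5 * p6 * t + p6^2 * t - 2 * q5 + 2 * q6) * (a * al * b * be)
     + (- p1 * p4 * t - p1^2 - p3 * p4 * t - p3^2 + 2 * q1 - 2 * q3) * (a * b * sxy)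
     + (- 3 * p2 * p3 + p2 * p6 * t + p2^2 + 3 * p5 + p6 - 4 * q2) * (a * be * om)
     + (- 2 * p2 * p4 - p2 * p5 + p2 * p6 + p3 * p5 - p3 * p6 + p4 * p5 * t - p5 * p6 * t + 2 * q5) * (a^2 * be^2)
     + (p3 * p4 * t + p3^2 - p4 + 2 * q3) * (a^2 * syy)
     + (p2 * p6 * t + p2^2 + 4 * p6 + 2 * q2) * (al * b * om)
     + (2 * p1 * p2 - p1 * p5 * t - p2 * p3 - p2^2 - p3 * p6 * t - p5 + p6) * (al * be * sxy)
     + (p2 * p4 - p2 * p6 + p4 * p6 * t - p6^2 * t - 2 * q6) * (al^2 * b^2)
     + (p2 * p3 + p3 * p6 * t - p6) * (al^2 * syy)
     + (p1 * p4 * t + p1^2 + p4 - 2 * q1) * (b^2 * sxx)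
     + (- 2 * p1 * p2 + p1 * p5 * t + p2^2 + p5) * (be^2 * sxx)
     + (- 3 * p2) * (om^2)
     + (- p1 + p1 * p3 * t + p3) * (sxx * syy)
     + (p1 - p1 * p3 * t - p3) * (sxy^2)"
  unfolding curv_inner conn_conn_inner[where W = "gam z _ _"]
  unfolding conn_inner dconn_inner J_J inner_minus_right inner_atoms by algebra

lemma curv_inner_z:
  "curv z X Y Y \<bullet> z =
     (- 2 * p1 * p2 + p1 * p5 * t - 2 * p2 * p4 * t - p2 * p5 * t + 2 * p2 * p6 * t + 2 * p2^2 + p3 * p5 * t - p3 * p6 * t + p4 * p5 * t^2 + p5 - p5 * p6 * t^2 + p6 - 4 * q2 + 2 * q5 * t) * (a * be^2 - al * b * be)
     + (- p1 + p1 * p3 * t + p3 + p3 * p4 * t^2 + p3^2 * t - p4 * t + 2 * q3 * t) * (a * syy - b * sxy)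
     + (- 3 * p2 - 3 * p2 * p3 * t + 3 * p5 * t) * (be * om)"
  unfolding curv_inner conn_conn_inner[where W = "gam z _ _"]
  unfolding conn_inner dconn_inner J_J inner_minus_right inner_atoms by algebra

lemma curv_inner_Jz:
  "curv z X Y Y \<bullet> (J *v z) =
     (- p1 * p4 * t - p1^2 - p2 * p4 * t + 2 * p2 * p6 * t + p2^2 - p4 - p4 * p6 * t^2 + p6 + p6^2 * t^2 + 2 * q1 + 2 * q2 + 2 * q6 * t) * (a * b * be - al * b^2)
     + (- p1 + p1 * p3 * t + p2 * p3 * t + p3 + p3 * p6 * t^2 - p6 * t) * (al * syy - be * sxy)
     + (3 * p2 + 3 * p6 * t) * (b * om)"
  unfolding curv_inner conn_conn_inner[where W = "gam z _ _"]
  unfolding conn_inner dconn_inner J_J inner_minus_right inner_atoms by algebra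

text \<open>The Ricci form is a combination of the same three symmetric forms as the metric, so the
  Einstein equation is three scalar equations, treated in \<open>ricci_identity\<close>.\<close>

lemma trace_curv:
  "trace_of (\<lambda>V. curv z V X Y) =
     (real CARD('m) * (p1 * p4 * t + p1^2 + p4 - 2 * q1) - p1 * p4 * t - p1^2 + p2 * p4 * t - 2 * p2 * p6 * t - p2^2 - p3 * p4 * t - p3^2 + p4 * p6 * t^2 - 4 * p6 - p6^2 * t^2 + 2 * q1 - 2 * q2 - 2 * q3 - 2 * q6 * t) * (a * b)
     + (real CARD('m) * (- 2 * p1 * p2 + p1 * p5 * t + p2^2 + p5) + 2 * p1 * p2 - p1 * p5 * t - 4 * p2 * p3 - 2 * p2 * p4 * t - p2 * p5 * t + 2 * p2 * p6 * t + p3 * p5 * t - 2 * p3 * p6 * t + p4 * p5 * t^2 + 2 * p5 - p5 * p6 * t^2 + 2 * p6 - 4 * q2 + 2 * q5 * t) * (al * be)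
     + (real CARD('m) * (p1 * p3 * t - p1 + p3) + p1 - p1 * p3 * t - 3 * p2 + p2 * p3 * t - p3 + p3 * p4 * t^2 + p3 * p6 * t^2 + p3^2 * t - p4 * t - p6 * t + 2 * q3 * t) * sxy"
proof -
  have 1: "trace_of (\<lambda>V. curv z V X Y) =
      2 * (z \<bullet> conn q1 q2 q3 q4 q5 q6 z X Y) + trace_of (\<lambda>V. dconn p1 p2 p3 p4 p5 p6 z V X Y)
      - 2 * a * trace_of (\<lambda>V. conn q1 q2 q3 q4 q5 q6 z V Y) - trace_of (\<lambda>V. dconn p1 p2 p3 p4 p5 p6 z X V Y)
      + trace_of (\<lambda>V. gam z V (gam z X Y)) - trace_of (\<lambda>V. gam z X (gam z V Y))"
  proof -
    have eq: "curv z V X Y = (z \<bullet> V) *\<^sub>R (2 *\<^sub>R conn q1 q2 q3 q4 q5 q6 z X Y) + dconn p1 p2 p3 p4 p5 p6 z V X Y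
      + (- 2 * a) *\<^sub>R conn q1 q2 q3 q4 q5 q6 z V Y + (-1) *\<^sub>R dconn p1 p2 p3 p4 p5 p6 z X V Y
      + gam z V (gam z X Y) + (-1) *\<^sub>R gam z X (gam z V Y)" for V
      unfolding curv_def a_def by (simp add: algebra_simps)
    show ?thesis unfolding eq trace_of_simps inner_scaleR_right by simp
  qed
  have 2: "z \<bullet> conn p1 p2 p3 p4 p5 p6 z X (p1 *\<^sub>R Y + (p4 * (z \<bullet> Y)) *\<^sub>R z + (p6 * ((J *v z) \<bullet> Y)) *\<^sub>R (J *v z))
    = p1 * (gam z X Y \<bullet> z) + p4 * b * (gam z X z \<bullet> z) + p6 * be * (gam z X (J *v z) \<bullet> z)"
    unfolding linear_add[OF conn_linear(1)] linear_scale[OF conn_linear(1)] inner_commute[of z "gam _ _ _"]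
      inner_add_right inner_scaleR_right by (simp add: b_def be_def)
  have 3: "(J *v z) \<bullet> conn p1 p2 p3 p4 p5 p6 z X (p2 *\<^sub>R (J *v Y) + (p5 * ((J *v z) \<bullet> Y)) *\<^sub>R z + (p6 * (z \<bullet> Y)) *\<^sub>R (J *v z))
    = p2 * (gam z X (J *v Y) \<bullet> (J *v z)) + p5 * be * (gam z X z \<bullet> (J *v z)) + p6 * b * (gam z X (J *v z) \<bullet> (J *v z))"
    unfolding linear_add[OF conn_linear(1)] linear_scale[OF conn_linear(1)] inner_commute[of "J *v z" "gam _ _ _"]
      inner_add_right inner_scaleR_right by (simp add: b_def be_def)
  show ?thesis
    unfolding 1 trace_conn_conn 2 3 trace_conn trace_conn_J trace_dconn trace_dconn_direction
    unfolding inner_commute[of z "conn _ _ _ _ _ _ _ _ _"] inner_commute[of Y "conn _ _ _ _ _ _ _ _ _"]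
    unfolding conn_inner J_J inner_minus_left inner_minus_right inner_atoms by algebra
qed

end

end

text \<open>The values at one point of the coefficients of the connection: \<open>q1, ..., q6\<close> are the derivatives of
  \<open>p1, ..., p6\<close> with respect to \<open>t\<close>, and \<open>f = 2/(1-t)\<close>. Using \<open>e\<close> instead of \<open>c1\<close>
  keeps all of them polynomial.\<close>
locale profile_point =
  fixes c e e1 f t u u1 iu c1 c2 p1 p2 p3 p4 p5 p6 q1 q2 q3 q4 q5 q6 bb :: real
  assumes ft: "f * t = f - 2" and iu: "u * iu = 1"
    and u: "u = 1 + t * c" and c1: "c1 = u * e + c\<^sup>2" and u1: "u1 = c + t * c1"
    and c2: "c2 = u1 * e + u * e1 + 2 * c * c1" and bb: "bb = - c * iu"
    and p1: "p1 = f" and p2: "p2 = c" and p3: "p3 = - (c + u * f)" and p4: "p4 = c * f - e"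
    and p5: "p5 = - (2 * c\<^sup>2 + u * (c1 + c * f))" and p6: "p6 = e"
    and q1: "q1 = f\<^sup>2 / 2" and q2: "q2 = c1" and q3: "q3 = - (c1 + u1 * f + u * f\<^sup>2 / 2)"
    and q4: "q4 = c1 * f + c * f\<^sup>2 / 2 - e1"
    and q5: "q5 = - (4 * c * c1 + u1 * (c1 + c * f) + u * (c2 + c1 * f + c * f\<^sup>2 / 2))"
    and q6: "q6 = e1"
begin

text \<open>Here \<open>sx, sz, sw\<close> are the products of \<open>R(X,Y)Y\<close> with \<open>X\<close>, \<open>z\<close>, \<open>Jz\<close>; both sides are compared
  monomial by monomial in the remaining scalar products.\<close>
lemma sec_identity:
  fixes a b al be sxx sxy syy om :: real
  defines "hxx \<equiv> sxx + bb * a * a + c * al * al" and "hxy \<equiv> sxy + bb * a * b + c * al * be"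
    and "hyy \<equiv> syy + bb * b * b + c * be * be"
  assumes sx: "sx = (p2 * p4 + p2 * p5 - p3 * p5 + p3 * p6 - p4 * p5 * t - p4 * p6 * t + p5 * p6 * t + p6^2 * t - 2 * q5 + 2 * q6) * (a * al * b * be)
     + (- p1 * p4 * t - p1^2 - p3 * p4 * t - p3^2 + 2 * q1 - 2 * q3) * (a * b * sxy)
     + (- 3 * p2 * p3 + p2 * p6 * t + p2^2 + 3 * p5 + p6 - 4 * q2) * (a * be * om)
     + (- 2 * p2 * p4 - p2 * p5 + p2 * p6 + p3 * p5 - p3 * p6 + p4 * p5 * t - p5 * p6 * t + 2 * q5) * (a^2 * be^2)
     + (p3 * p4 * t + p3^2 - p4 + 2 * q3) * (a^2 * syy)
     + (p2 * p6 * t + p2^2 + 4 * p6 + 2 * q2) * (al * b * om)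
     + (2 * p1 * p2 - p1 * p5 * t - p2 * p3 - p2^2 - p3 * p6 * t - p5 + p6) * (al * be * sxy)
     + (p2 * p4 - p2 * p6 + p4 * p6 * t - p6^2 * t - 2 * q6) * (al^2 * b^2)
     + (p2 * p3 + p3 * p6 * t - p6) * (al^2 * syy)
     + (p1 * p4 * t + p1^2 + p4 - 2 * q1) * (b^2 * sxx)
     + (- 2 * p1 * p2 + p1 * p5 * t + p2^2 + p5) * (be^2 * sxx)
     + (- 3 * p2) * (om^2)
     + (- p1 + p1 * p3 * t + p3) * (sxx * syy)
     + (p1 - p1 * p3 * t - p3) * (sxy^2)"
    and sz: "sz = (- 2 * p1 * p2 + p1 * p5 * t - 2 * p2 * p4 * t - p2 * p5 * t + 2 * p2 * p6 * t + 2 * p2^2 + p3 * p5 * t - p3 * p6 * t + p4 * p5 * t^2 + p5 - p5 * p6 * t^2 + p6 - 4 * q2 + 2 * q5 * t) * (a * be^2 - al * b * be)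
     + (- p1 + p1 * p3 * t + p3 + p3 * p4 * t^2 + p3^2 * t - p4 * t + 2 * q3 * t) * (a * syy - b * sxy)
     + (- 3 * p2 - 3 * p2 * p3 * t + 3 * p5 * t) * (be * om)"
    and sw: "sw = (- p1 * p4 * t - p1^2 - p2 * p4 * t + 2 * p2 * p6 * t + p2^2 - p4 - p4 * p6 * t^2 + p6 + p6^2 * t^2 + 2 * q1 + 2 * q2 + 2 * q6 * t) * (a * b * be - al * b^2)
     + (- p1 + p1 * p3 * t + p2 * p3 * t + p3 + p3 * p6 * t^2 - p6 * t) * (al * syy - be * sxy)
     + (3 * p2 + 3 * p6 * t) * (b * om)"
  shows "sx + bb * a * sz + c * al * sw = - (f\<^sup>2 + c * (f - 1)\<^sup>2) * (hxx * hyy - hxy\<^sup>2)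
     - (f * c + (f - 1) * c1) * ((a\<^sup>2 * iu + u * al\<^sup>2) * hyy + (b\<^sup>2 * iu + u * be\<^sup>2) * hxx
          - 2 * (a * b * iu + u * al * be) * hxy)
     - 3 * c * om\<^sup>2 - 6 * c1 * (a * be - b * al) * om - 2 * c2 * (a * be - b * al)\<^sup>2"
proof -
  \<comment> \<open>Write q for the form with q(X,X) = a^2/u + u al^2; it is t times the part of h
    on the span of \<open>z\<close> and \<open>Jz\<close>. Then \<open>N\<close> multiplies the Gram
    determinant of h, and \<open>M\<close> multiplies the Kulkarni-Nomizu product of h and
    q.\<close>
  define N where "N = f\<^sup>2 + c * (f - 1)\<^sup>2"
  define M where "M = f * c + (f - 1) * c1"
  note defs = N_def M_def bb p1 p2 p3 p4 p5 p6 q1 q2 q3 q4 q5 q6 c2 u1 c1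
  have E0: "(- p1 + p1 * p3 * t + p3)
      = - N"
    unfolding defs using ft iu u by algebra
  have E1: "(p3 * p4 * t + p3^2 - p4 + 2 * q3) + bb * (- p1 + p1 * p3 * t + p3 + p3 * p4 * t^2 + p3^2 * t - p4 * t + 2 * q3 * t)
      = - (N * bb + M * iu)"
    unfolding defs using ft iu u by algebra
  have E2: "(- p1 * p4 * t - p1^2 - p3 * p4 * t - p3^2 + 2 * q1 - 2 * q3) + bb * (p1 - p1 * p3 * t - p3 - p3 * p4 * t^2 - p3^2 * t + p4 * t - 2 * q3 * t)
      = 2 * (N * bb + M * iu)"
    unfolding defs using ft iu u by algebra
  have E3: "(p1 * p4 * t + p1^2 + p4 - 2 * q1)
      = - (N * bb + M * iu)"
    unfolding defs using ft iu u by algebra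
  have E4: "(p2 * p3 + p3 * p6 * t - p6) + c * (- p1 + p1 * p3 * t + p2 * p3 * t + p3 + p3 * p6 * t^2 - p6 * t)
      = - (N * c + M * u)"
    unfolding defs using ft iu u by algebra
  have E5: "(2 * p1 * p2 - p1 * p5 * t - p2 * p3 - p2^2 - p3 * p6 * t - p5 + p6) + c * (p1 - p1 * p3 * t - p2 * p3 * t - p3 - p3 * p6 * t^2 + p6 * t)
      = 2 * (N * c + M * u)"
    unfolding defs using ft iu u by algebra
  have E6: "(- 2 * p1 * p2 + p1 * p5 * t + p2^2 + p5)
      = - (N * c + M * u)"
    unfolding defs using ft iu u by algebra
  have E7: "(- 3 * p2 * p3 + p2 * p6 * t + p2^2 + 3 * p5 + p6 - 4 * q2) + bb * (- 3 * p2 - 3 * p2 * p3 * t + 3 * p5 * t)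
      = - 6 * c1"
    unfolding defs using ft iu u by algebra
  have E8: "(p2 * p6 * t + p2^2 + 4 * p6 + 2 * q2) + c * (3 * p2 + 3 * p6 * t)
      = 6 * c1"
    unfolding defs using ft iu u by algebra
  have E9: "(- 2 * p2 * p4 - p2 * p5 + p2 * p6 + p3 * p5 - p3 * p6 + p4 * p5 * t - p5 * p6 * t + 2 * q5) + bb * (- 2 * p1 * p2 + p1 * p5 * t - 2 * p2 * p4 * t - p2 * p5 * t + 2 * p2 * p6 * t + 2 * p2^2 + p3 * p5 * t - p3 * p6 * t + p4 * p5 * t^2 + p5 - p5 * p6 * t^2 + p6 - 4 * q2 + 2 * q5 * t)
      = - (N * bb * c + M * (iu * c + u * bb) + 2 * c2)"
    unfolding defs using ft iu u by algebra
  have E10: "(p2 * p4 - p2 * p6 + p4 * p6 * t - p6^2 * t - 2 * q6) + c * (p1 * p4 * t + p1^2 + p2 * p4 * t - 2 * p2 * p6 * t - p2^2 + p4 + p4 * p6 * t^2 - p6 - p6^2 * t^2 - 2 * q1 - 2 * q2 - 2 * q6 * t)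
      = - (N * bb * c + M * (iu * c + u * bb) + 2 * c2)"
    unfolding defs using ft iu u by algebra
  have E11: "(p2 * p4 + p2 * p5 - p3 * p5 + p3 * p6 - p4 * p5 * t - p4 * p6 * t + p5 * p6 * t + p6^2 * t - 2 * q5 + 2 * q6) + bb * (2 * p1 * p2 - p1 * p5 * t + 2 * p2 * p4 * t + p2 * p5 * t - 2 * p2 * p6 * t - 2 * p2^2 - p3 * p5 * t + p3 * p6 * t - p4 * p5 * t^2 - p5 + p5 * p6 * t^2 - p6 + 4 * q2 - 2 * q5 * t) + c * (- p1 * p4 * t - p1^2 - p2 * p4 * t + 2 * p2 * p6 * t + p2^2 - p4 - p4 * p6 * t^2 + p6 + p6^2 * t^2 + 2 * q1 + 2 * q2 + 2 * q6 * t)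
      = 2 * (N * bb * c + M * (iu * c + u * bb) + 2 * c2)"
    unfolding defs using ft iu u by algebra
  have "sx + bb * a * sz + c * al * sw =
    ((- p1 + p1 * p3 * t + p3)) * (sxx * syy)
     + ((p3 * p4 * t + p3^2 - p4 + 2 * q3) + bb * (- p1 + p1 * p3 * t + p3 + p3 * p4 * t^2 + p3^2 * t - p4 * t + 2 * q3 * t)) * (a^2 * syy)
     + ((- p1 * p4 * t - p1^2 - p3 * p4 * t - p3^2 + 2 * q1 - 2 * q3) + bb * (p1 - p1 * p3 * t - p3 - p3 * p4 * t^2 - p3^2 * t + p4 * t - 2 * q3 * t)) * (a * b * sxy)
     + ((p1 * p4 * t + p1^2 + p4 - 2 * q1)) * (b^2 * sxx)
     + ((p2 * p3 + p3 * p6 * t - p6) + c * (- p1 + p1 * p3 * t + p2 * p3 * t + p3 + p3 * p6 * t^2 - p6 * t)) * (al^2 * syy)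
     + ((2 * p1 * p2 - p1 * p5 * t - p2 * p3 - p2^2 - p3 * p6 * t - p5 + p6) + c * (p1 - p1 * p3 * t - p2 * p3 * t - p3 - p3 * p6 * t^2 + p6 * t)) * (al * be * sxy)
     + ((- 2 * p1 * p2 + p1 * p5 * t + p2^2 + p5)) * (be^2 * sxx)
     + ((- 3 * p2 * p3 + p2 * p6 * t + p2^2 + 3 * p5 + p6 - 4 * q2) + bb * (- 3 * p2 - 3 * p2 * p3 * t + 3 * p5 * t)) * (a * be * om)
     + ((p2 * p6 * t + p2^2 + 4 * p6 + 2 * q2) + c * (3 * p2 + 3 * p6 * t)) * (al * b * om)
     + ((- 2 * p2 * p4 - p2 * p5 + p2 * p6 + p3 * p5 - p3 * p6 + p4 * p5 * t - p5 * p6 * t + 2 * q5) + bb * (- 2 * p1 * p2 + p1 * p5 * t - 2 * p2 * p4 * t - p2 * p5 * t + 2 * p2 * p6 * t + 2 * p2^2 + p3 * p5 * t - p3 * p6 * t + p4 * p5 * t^2 + p5 - p5 * p6 * t^2 + p6 - 4 * q2 + 2 * q5 * t)) * (a^2 * be^2)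
     + ((p2 * p4 - p2 * p6 + p4 * p6 * t - p6^2 * t - 2 * q6) + c * (p1 * p4 * t + p1^2 + p2 * p4 * t - 2 * p2 * p6 * t - p2^2 + p4 + p4 * p6 * t^2 - p6 - p6^2 * t^2 - 2 * q1 - 2 * q2 - 2 * q6 * t)) * (al^2 * b^2)
     + ((p2 * p4 + p2 * p5 - p3 * p5 + p3 * p6 - p4 * p5 * t - p4 * p6 * t + p5 * p6 * t + p6^2 * t - 2 * q5 + 2 * q6) + bb * (2 * p1 * p2 - p1 * p5 * t + 2 * p2 * p4 * t + p2 * p5 * t - 2 * p2 * p6 * t - 2 * p2^2 - p3 * p5 * t + p3 * p6 * t - p4 * p5 * t^2 - p5 + p5 * p6 * t^2 - p6 + 4 * q2 - 2 * q5 * t) + c * (- p1 * p4 * t - p1^2 - p2 * p4 * t + 2 * p2 * p6 * t + p2^2 - p4 - p4 * p6 * t^2 + p6 + p6^2 * t^2 + 2 * q1 + 2 * q2 + 2 * q6 * t)) * (a * al * b * be)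
     - (- p1 + p1 * p3 * t + p3) * (sxy^2) + (- 3 * p2) * (om^2)"
    unfolding sx sz sw by algebra
  also have "\<dots> = - N * (hxx * hyy - hxy\<^sup>2)
     - M * ((a\<^sup>2 * iu + u * al\<^sup>2) * hyy + (b\<^sup>2 * iu + u * be\<^sup>2) * hxx
          - 2 * (a * b * iu + u * al * be) * hxy)
     - 3 * c * om\<^sup>2 - 6 * c1 * (a * be - b * al) * om - 2 * c2 * (a * be - b * al)\<^sup>2"
    unfolding E1 E2 E3 E4 E5 E6 E7 E8 E9 E10 E11 unfolding E0 hxx_def hxy_def hyy_def p2 by algebra
  finally show ?thesis unfolding N_def M_def .
qed

text \<open>The first component uses only the first order ODE. The second equals c times the first,
  and the third bb times the first, up to multiples of the differentiated ODE; these two comparisons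
  are polynomial only after multiplication by 1 - t^2, hence the conditions on t.\<close>

lemma ricci_identity:
  fixes k kap m :: real
  defines "m \<equiv> 2 * k + 2"
  assumes ode1: "t * (1 - t\<^sup>2) * c1 + (k + 2 + 2 * k * t + k * t\<^sup>2) * c = (4 * k + 2) * (kap - 1)"
    and t1: "t \<noteq> 1" "t \<noteq> -1"
    and ode2: "t * (1 - t\<^sup>2) * c2 + (k + 3 + 2 * k * t + (k - 3) * t\<^sup>2) * c1 + 2 * k * (1 + t) * c = 0"
  shows "m * (p1 * p3 * t - p1 + p3) + p1 - p1 * p3 * t - 3 * p2 + p2 * p3 * t - p3 + p3 * p4 * t^2 + p3 * p6 * t^2 + p3^2 * t - p4 * t - p6 * t + 2 * q3 * t
       = - (m - 1) * kap * f\<^sup>2" (is "?Al = _")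
    and "m * (- 2 * p1 * p2 + p1 * p5 * t + p2^2 + p5) + 2 * p1 * p2 - p1 * p5 * t - 4 * p2 * p3 - 2 * p2 * p4 * t - p2 * p5 * t + 2 * p2 * p6 * t + p3 * p5 * t - 2 * p3 * p6 * t + p4 * p5 * t^2 + 2 * p5 - p5 * p6 * t^2 + 2 * p6 - 4 * q2 + 2 * q5 * t
       = - (m - 1) * kap * f\<^sup>2 * c" (is "?Bl = _")
    and "m * (p1 * p4 * t + p1^2 + p4 - 2 * q1) - p1 * p4 * t - p1^2 + p2 * p4 * t - 2 * p2 * p6 * t - p2^2 - p3 * p4 * t - p3^2 + p4 * p6 * t^2 - 4 * p6 - p6^2 * t^2 + 2 * q1 - 2 * q2 - 2 * q3 - 2 * q6 * t
       = - (m - 1) * kap * f\<^sup>2 * bb" (is "?Cl = _")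
proof -
  let ?ode2 = "t * (1 - t\<^sup>2) * c2 + (k + 3 + 2 * k * t + (k - 3) * t\<^sup>2) * c1 + 2 * k * (1 + t) * c"
  note defs = m_def p1 p2 p3 p4 p5 p6 q1 q2 q3 q4 q5 q6
  have nz: "1 - t\<^sup>2 \<noteq> 0" using t1 by (auto simp: power2_eq_1_iff)
  show A: "?Al = - (m - 1) * kap * f\<^sup>2" unfolding defs using ft u c1 u1 ode1 by algebra
  have "(?Bl - c * ?Al) * (1 - t\<^sup>2) = - 2 * u * ?ode2"
    unfolding defs c2 u1 c1 u using ft by algebra
  then have "?Bl = c * ?Al" using nz ode2 by simp
  then show "?Bl = - (m - 1) * kap * f\<^sup>2 * c" unfolding A by simp
  have "(u * ?Cl + c * ?Al) * (1 - t\<^sup>2) = - 2 * ?ode2"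
    unfolding defs c2 u1 c1 u using ft by algebra
  then have "u * ?Cl = - c * ?Al" using nz ode2 by simp
  then have "?Cl = - c * iu * ?Al" using iu by algebra
  then show "?Cl = - (m - 1) * kap * f\<^sup>2 * bb" unfolding A bb by simp
qed

end

section \<open>The Levi-Civita connection of the metric\<close>

lemma matrix_inv_eqI:
  fixes A B :: "real^'n^'n"
  assumes "A ** B = mat 1" "B ** A = mat 1"
  shows "matrix_inv A = B"
proof -
  have "A ** matrix_inv A = mat 1 \<and> matrix_inv A ** A = mat 1"
    unfolding matrix_inv_def by (rule someI[of _ B]) (simp add: assms)
  then show ?thesis by (metis assms(2) matrix_mul_assoc matrix_mul_lid matrix_mul_rid)
qed

lemma has_derivative_matrix:
  fixes F :: "'a::real_normed_vector \<Rightarrow> real^'n^'m"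
  assumes "\<And>i j. ((\<lambda>x. F x $ i $ j) has_derivative (\<lambda>v. F' v $ i $ j)) (at x)"
  shows "(F has_derivative F') (at x)"
  unfolding has_derivative_componentwise_within[of F]
  using assms by (auto simp: Basis_vec_def inner_axis)

lemma pd_eqI:
  assumes "(f has_derivative f') (at x)"
  shows "pd f i x = f' (axis i 1)"
  unfolding pd_def frechet_derivative_at[OF assms, symmetric] ..

lemma linear_axis_expand:
  fixes L :: "real^'m \<Rightarrow> real^'n"
  assumes "linear L"
  shows "(\<Sum>i\<in>UNIV. v $ i * L (axis i 1) $ l) = L v $ l"
proof -
  have "L v = L (\<Sum>i\<in>UNIV. v $ i *\<^sub>R axis i 1)"
    using basis_expansion[of v] by (simp add: scalar_mult_eq_scaleR)
  also have "\<dots> = (\<Sum>i\<in>UNIV. v $ i *\<^sub>R L (axis i 1))"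
    by (simp add: linear_sum[OF assms] linear_scale[OF assms])
  finally show ?thesis by simp
qed

lemma has_derivative_of_inner_self:
  assumes "(P has_real_derivative Q) (at (z \<bullet> z))"
  shows "((\<lambda>z. P (z \<bullet> z)) has_derivative (\<lambda>v. 2 * (z \<bullet> v) * Q)) (at z)"
proof -
  have "((\<lambda>z. z \<bullet> z) has_derivative (\<lambda>v. 2 * (z \<bullet> v))) (at z)"
    by (auto intro!: derivative_eq_intros simp: inner_commute)
  from has_derivative_compose[OF this assms[unfolded has_field_derivative_def]]
  show ?thesis by (simp add: mult_ac)
qed

context complex_structure
begin

lemma has_derivative_J: "((\<lambda>z. J *v z) has_derivative (\<lambda>v. J *v v)) (at z)"
  by (rule bounded_linear_imp_has_derivative) simp

definition rank2 :: "real \<Rightarrow> real \<Rightarrow> real \<Rightarrow> real^'m \<Rightarrow> real^'m^'m" where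
  "rank2 r p q z = (\<chi> i j. r * (axis i 1 \<bullet> (axis j 1 :: real^'m) + p * (z $ i) * (z $ j)
      + q * ((J *v z) $ i) * ((J *v z) $ j)))"

lemma rank2_mult:
  "rank2 r p q z *v Y = r *\<^sub>R (Y + (p * (z \<bullet> Y)) *\<^sub>R z + (q * ((J *v z) \<bullet> Y)) *\<^sub>R (J *v z))"
proof -
  have "(rank2 r p q z *v Y) $ i = r * (Y $ i + p * (z \<bullet> Y) * z $ i + q * ((J *v z) \<bullet> Y) * (J *v z) $ i)" for i
  proof -
    have "(rank2 r p q z *v Y) $ i = (\<Sum>j\<in>UNIV. r * (((axis i 1 :: real^'m) $ j) * Y $ j
        + p * (z $ i) * (z $ j * Y $ j) + q * ((J *v z) $ i) * ((J *v z) $ j * Y $ j)))"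
      unfolding matrix_vector_mult_def rank2_def
      by (auto intro!: sum.cong simp: inner_axis algebra_simps)
    also have "\<dots> = r * (axis i 1 \<bullet> Y + p * (z $ i) * (z \<bullet> Y) + q * ((J *v z) $ i) * ((J *v z) \<bullet> Y))"
      unfolding inner_vec_def sum_distrib_left[symmetric] sum.distrib by simp
    finally show ?thesis by (simp add: inner_axis')
  qed
  then show ?thesis by (simp add: vec_eq_iff)
qed

lemma rank2_gform:
  "gform (rank2 r p q z) X Y = r * (X \<bullet> Y + p * (z \<bullet> X) * (z \<bullet> Y) + q * ((J *v z) \<bullet> X) * ((J *v z) \<bullet> Y))"
  unfolding gform_def rank2_mult
  by (simp add: inner_add_right inner_commute[of X z] inner_commute[of X "J *v z"])

lemma rank2_scaleR: "a *\<^sub>R rank2 r p q z = rank2 (a * r) p q z"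
  by (simp add: rank2_def vec_eq_iff)

lemma rank2_transpose: "transpose (rank2 r p q z) = rank2 r p q z"
  by (simp add: transpose_def rank2_def vec_eq_iff inner_commute)

text \<open>\<open>z\<close> and \<open>Jz\<close> are orthogonal of equal length, so the product
  differs from the identity only by p + q + p q |z|^2 times their two projectors. The hypothesis
  says that the two eigenvalues are reciprocal, and inversion then merely exchanges p and q. The
  metric and its square root both have this property.\<close>

lemma rank2_inverse:
  assumes "r \<noteq> 0" "p + q + p * q * (z \<bullet> z) = 0"
  shows "rank2 r p q z ** rank2 (1 / r) q p z = mat 1"
proof -
  have "rank2 r p q z *v (rank2 (1 / r) q p z *v Y) = Y" for Y
  proof -
    have "rank2 r p q z *v (rank2 (1 / r) q p z *v Y) = Y
       + ((p + q + p * q * (z \<bullet> z)) * (z \<bullet> Y)) *\<^sub>R z + ((p + q + p * q * (z \<bullet> z)) * ((J *v z) \<bullet> Y)) *\<^sub>R (J *v z)"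
      unfolding rank2_mult using assms(1)
      by (simp add: inner_add_right algebra_simps)
    then show ?thesis using assms(2) by simp
  qed
  then show ?thesis by (simp add: matrix_eq matrix_vector_mul_assoc)
qed

lemma conn_has_derivative:
  assumes "(P1 has_real_derivative q1) (at (z \<bullet> z))" "(P2 has_real_derivative q2) (at (z \<bullet> z))"
    "(P3 has_real_derivative q3) (at (z \<bullet> z))" "(P4 has_real_derivative q4) (at (z \<bullet> z))"
    "(P5 has_real_derivative q5) (at (z \<bullet> z))" "(P6 has_real_derivative q6) (at (z \<bullet> z))"
  shows "((\<lambda>z. conn (P1 (z \<bullet> z)) (P2 (z \<bullet> z)) (P3 (z \<bullet> z)) (P4 (z \<bullet> z)) (P5 (z \<bullet> z)) (P6 (z \<bullet> z)) z X Y)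
     has_derivative (\<lambda>V. (2 * (z \<bullet> V)) *\<^sub>R conn q1 q2 q3 q4 q5 q6 z X Y
        + dconn (P1 (z \<bullet> z)) (P2 (z \<bullet> z)) (P3 (z \<bullet> z)) (P4 (z \<bullet> z)) (P5 (z \<bullet> z)) (P6 (z \<bullet> z)) z V X Y)) (at z)"
  unfolding conn_def
  by (rule derivative_eq_intros has_derivative_J assms[THEN has_derivative_of_inner_self] refl)+
     (simp add: fun_eq_iff dconn_def conn_def algebra_simps)

end

text \<open>Connection and curvature are computed for an arbitrary radial function \<open>c\<close>
  with positive u; the ODE enters only with the choice of \<open>c\<close> in
  \<open>taub_nut\<close>.\<close>

locale ansatz = complex_structure J for J :: "real^'m^'m" +
  fixes c c1 c2 :: "real \<Rightarrow> real" and kap :: real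
  assumes c_deriv: "\<And>t. (c has_real_derivative c1 t) (at t)"
    and c1_deriv: "\<And>t. (c1 has_real_derivative c2 t) (at t)"
    and kap_pos: "kap > 0"
    and u_pos: "\<And>t. 0 \<le> t \<Longrightarrow> t \<le> 1 \<Longrightarrow> 1 + t * c t > 0"
begin

definition u :: "real \<Rightarrow> real" where "u t = 1 + t * c t"
definition u1 :: "real \<Rightarrow> real" where "u1 t = c t + t * c1 t"
text \<open>Chosen so that bb' = - e/u; it is also the coefficient \<open>p6\<close> of the mixed
  radial-fibre term of the connection.\<close>

definition e :: "real \<Rightarrow> real" where "e t = (c1 t - (c t)\<^sup>2) / u t"
definition e1 :: "real \<Rightarrow> real" where "e1 t = (c2 t - 2 * c t * c1 t - u1 t * e t) / u t"
definition f :: "real \<Rightarrow> real" where "f t = 2 / (1 - t)"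
definition bb :: "real \<Rightarrow> real" where "bb t = - c t / u t"

definition p3 :: "real \<Rightarrow> real" where "p3 t = - (c t + u t * f t)"
definition p4 :: "real \<Rightarrow> real" where "p4 t = c t * f t - e t"
definition p5 :: "real \<Rightarrow> real" where "p5 t = - (2 * (c t)\<^sup>2 + u t * (c1 t + c t * f t))"
definition q1 :: "real \<Rightarrow> real" where "q1 t = (f t)\<^sup>2 / 2"
definition q3 :: "real \<Rightarrow> real" where "q3 t = - (c1 t + u1 t * f t + u t * (f t)\<^sup>2 / 2)"
definition q4 :: "real \<Rightarrow> real" where "q4 t = c1 t * f t + c t * (f t)\<^sup>2 / 2 - e1 t"
definition q5 :: "real \<Rightarrow> real" where
  "q5 t = - (4 * c t * c1 t + u1 t * (c1 t + c t * f t) + u t * (c2 t + c1 t * f t + c t * (f t)\<^sup>2 / 2))"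

definition g :: "'m mfield" where
  "g z = rank2 (kap * (f (z \<bullet> z))\<^sup>2) (bb (z \<bullet> z)) (c (z \<bullet> z)) z"

abbreviation gamma :: "real^'m \<Rightarrow> real^'m \<Rightarrow> real^'m \<Rightarrow> real^'m" where
  "gamma z \<equiv> conn (f (z \<bullet> z)) (c (z \<bullet> z)) (p3 (z \<bullet> z)) (p4 (z \<bullet> z)) (p5 (z \<bullet> z)) (e (z \<bullet> z)) z"

abbreviation curvature :: "real^'m \<Rightarrow> real^'m \<Rightarrow> real^'m \<Rightarrow> real^'m \<Rightarrow> real^'m" where
  "curvature z \<equiv> conn_coeffs.curv J
     (f (z \<bullet> z)) (c (z \<bullet> z)) (p3 (z \<bullet> z)) (p4 (z \<bullet> z)) (p5 (z \<bullet> z)) (e (z \<bullet> z))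
     (q1 (z \<bullet> z)) (c1 (z \<bullet> z)) (q3 (z \<bullet> z)) (q4 (z \<bullet> z)) (q5 (z \<bullet> z)) (e1 (z \<bullet> z)) z"

lemma u_gt_0: "0 \<le> t \<Longrightarrow> t \<le> 1 \<Longrightarrow> u t > 0"
  using u_pos by (simp add: u_def)

lemma ball_inner: "z \<in> ball 0 1 \<Longrightarrow> 0 \<le> z \<bullet> z \<and> z \<bullet> z < 1"
  by (simp add: power2_norm_eq_inner[symmetric] abs_square_less_1)

context
  fixes t :: real assumes t0: "0 \<le> t" and t1: "t < 1"
begin

lemma u_nz: "u t \<noteq> 0" using u_gt_0[of t] t0 t1 by simp

lemma f_ge: "f t \<ge> 2" using t0 t1 by (simp add: f_def field_simps)

lemma u_deriv: "(u has_real_derivative u1 t) (at t)"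
  unfolding u_def u1_def by (auto intro!: derivative_eq_intros c_deriv)

lemma f_deriv: "(f has_real_derivative q1 t) (at t)"
  unfolding f_def q1_def using t1
  by (auto intro!: derivative_eq_intros simp: power2_eq_square)

lemma bb_deriv: "(bb has_real_derivative - e t / u t) (at t)"
  unfolding bb_def using u_nz
  by (auto intro!: derivative_eq_intros c_deriv u_deriv simp: e_def u1_def)
     (simp add: u_def field_simps power2_eq_square)

lemma e_deriv: "(e has_real_derivative e1 t) (at t)"
  unfolding e_def using u_nz
  by (auto intro!: derivative_eq_intros c_deriv c1_deriv u_deriv simp: e1_def e_def field_simps power2_eq_square)

lemma p3_deriv: "(p3 has_real_derivative q3 t) (at t)"
  unfolding p3_def
  by (auto intro!: derivative_eq_intros c_deriv c1_deriv u_deriv f_deriv simp: q3_def q1_def)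

lemma p4_deriv: "(p4 has_real_derivative q4 t) (at t)"
  unfolding p4_def
  by (auto intro!: derivative_eq_intros c_deriv c1_deriv u_deriv f_deriv e_deriv simp: q4_def q1_def)

lemma p5_deriv: "(p5 has_real_derivative q5 t) (at t)"
  unfolding p5_def
  by (auto intro!: derivative_eq_intros c_deriv c1_deriv u_deriv f_deriv simp: q5_def q1_def algebra_simps)

text \<open>From here on only relations between values at one t are used. The divisions in
  \<open>e\<close> and \<open>e1\<close> are replaced by the products that
  \<open>profile_point\<close> assumes.\<close>

lemma point: "profile_point (c t) (e t) (e1 t) (f t) t (u t) (u1 t) (1 / u t) (c1 t) (c2 t)
    (f t) (c t) (p3 t) (p4 t) (p5 t) (e t) (q1 t) (c1 t) (q3 t) (q4 t) (q5 t) (e1 t) (bb t)"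
proof
  show "f t * t = f t - 2" using t1 by (simp add: f_def field_simps)
  show "c1 t = u t * e t + (c t)\<^sup>2" using u_nz by (simp add: e_def)
  show "c2 t = u1 t * e t + u t * e1 t + 2 * c t * c1 t" using u_nz by (simp add: e1_def)
  show "u t = 1 + t * c t" by (rule u_def)
qed (use u_nz in \<open>simp_all add: u1_def bb_def p3_def p4_def p5_def q1_def q3_def q4_def q5_def\<close>)

end

lemma gamma_has_derivative:
  assumes "z \<in> ball 0 1"
  shows "((\<lambda>z. gamma z X Y) has_derivative
    (\<lambda>V. (2 * (z \<bullet> V)) *\<^sub>R conn (q1 (z \<bullet> z)) (c1 (z \<bullet> z)) (q3 (z \<bullet> z)) (q4 (z \<bullet> z)) (q5 (z \<bullet> z)) (e1 (z \<bullet> z)) z X Y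
      + dconn (f (z \<bullet> z)) (c (z \<bullet> z)) (p3 (z \<bullet> z)) (p4 (z \<bullet> z)) (p5 (z \<bullet> z)) (e (z \<bullet> z)) z V X Y)) (at z)"
  using ball_inner[OF assms]
  by (intro conn_has_derivative f_deriv c_deriv p3_deriv p4_deriv p5_deriv e_deriv) auto

definition dG :: "real^'m \<Rightarrow> real^'m \<Rightarrow> real^'m \<Rightarrow> real^'m \<Rightarrow> real" where
  "dG z V X Y = (let t = z \<bullet> z; w = J *v z in kap * (f t)\<^sup>2 *
     (2 * (z \<bullet> V) * f t * (X \<bullet> Y + bb t * (z \<bullet> X) * (z \<bullet> Y) + c t * (w \<bullet> X) * (w \<bullet> Y))
      + 2 * (z \<bullet> V) * (- e t / u t) * (z \<bullet> X) * (z \<bullet> Y)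
      + bb t * ((V \<bullet> X) * (z \<bullet> Y) + (z \<bullet> X) * (V \<bullet> Y))
      + 2 * (z \<bullet> V) * c1 t * (w \<bullet> X) * (w \<bullet> Y)
      + c t * (((J *v V) \<bullet> X) * (w \<bullet> Y) + (w \<bullet> X) * ((J *v V) \<bullet> Y))))"

lemma g_has_derivative:
  assumes "z \<in> ball 0 1"
  shows "(g has_derivative (\<lambda>V. \<chi> i j. dG z V (axis i 1) (axis j 1))) (at z)"
proof (rule has_derivative_matrix)
  fix i j
  note t = ball_inner[OF assms, THEN conjunct1] ball_inner[OF assms, THEN conjunct2]
  have "((\<lambda>z. kap * (f (z \<bullet> z))\<^sup>2 * (axis i 1 \<bullet> (axis j 1 :: real^'m) + bb (z \<bullet> z) * (z \<bullet> axis i 1) * (z \<bullet> axis j 1)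
      + c (z \<bullet> z) * ((J *v z) \<bullet> axis i 1) * ((J *v z) \<bullet> axis j 1)))
     has_derivative (\<lambda>V. dG z V (axis i 1) (axis j 1))) (at z)"
    by (rule derivative_eq_intros has_derivative_J refl
        f_deriv[OF t, THEN has_derivative_of_inner_self] bb_deriv[OF t, THEN has_derivative_of_inner_self]
        c_deriv[THEN has_derivative_of_inner_self])+
       (simp add: fun_eq_iff dG_def Let_def q1_def algebra_simps power2_eq_square)
  then show "((\<lambda>x. g x $ i $ j) has_derivative (\<lambda>V. (\<chi> i j. dG z V (axis i 1) (axis j 1)) $ i $ j)) (at z)"
    by (simp add: g_def rank2_def inner_axis)
qed

definition gamma_flat :: "real^'m \<Rightarrow> real^'m \<Rightarrow> real^'m \<Rightarrow> real^'m" where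
  "gamma_flat z X Y = (let t = z \<bullet> z; w = J *v z in
      f t *\<^sub>R ((z \<bullet> X) *\<^sub>R Y + (z \<bullet> Y) *\<^sub>R X)
      + ((bb t - f t) * (X \<bullet> Y) + (bb t * f t - e t / u t) * (z \<bullet> X) * (z \<bullet> Y)
          - (c1 t + c t * f t) * (w \<bullet> X) * (w \<bullet> Y)) *\<^sub>R z
      + ((c1 t + c t * f t) * ((z \<bullet> X) * (w \<bullet> Y) + (z \<bullet> Y) * (w \<bullet> X))) *\<^sub>R w
      + c t *\<^sub>R ((w \<bullet> Y) *\<^sub>R (J *v X) + (w \<bullet> X) *\<^sub>R (J *v Y)))"

text \<open>The Koszul formula for constant fields \<open>X\<close>, \<open>Y\<close>,
  \<open>W\<close>. \<open>gamma_flat\<close> is the covariant derivative with its index lowered and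
  the conformal factor taken out.\<close>

lemma koszul:
  "dG z X Y W + dG z Y X W - dG z W X Y = 2 * (kap * (f (z \<bullet> z))\<^sup>2) * (gamma_flat z X Y \<bullet> W)"
  unfolding dG_def gamma_flat_def Let_def
  unfolding inner_add_left inner_scaleR_left
    J_skew[of W] J_pair(3)[of W X] J_pair(3)[of W Y] J_pair(3)[of Y X]
    inner_commute[of W X] inner_commute[of W Y] inner_commute[of Y X] by algebra

text \<open>Raising the index: the left side applies the inverse of the matrix without the conformal
  factor, in which \<open>c\<close> and \<open>bb\<close> have changed places.\<close>

lemma gamma_flat_raise:
  assumes "z \<in> ball 0 1"
  shows "gamma_flat z X Y + (c (z \<bullet> z) * (z \<bullet> gamma_flat z X Y)) *\<^sub>R z
      + (bb (z \<bullet> z) * ((J *v z) \<bullet> gamma_flat z X Y)) *\<^sub>R (J *v z) = gamma z X Y"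
proof -
  define t where "t = z \<bullet> z"
  have t: "0 \<le> t" "t < 1" using ball_inner[OF assms] by (auto simp: t_def)
  interpret profile_point "c t" "e t" "e1 t" "f t" t "u t" "u1 t" "1 / u t" "c1 t" "c2 t"
    "f t" "c t" "p3 t" "p4 t" "p5 t" "e t" "q1 t" "c1 t" "q3 t" "q4 t" "q5 t" "e1 t" "bb t"
    by (rule point[OF t])
  define iu where "iu = 1 / u t"
  have eu: "e t / u t = e t * iu" by (simp add: iu_def)
  define a b al be s where "a = z \<bullet> X" and "b = z \<bullet> Y" and "al = (J *v z) \<bullet> X" and "be = (J *v z) \<bullet> Y"
    and "s = X \<bullet> Y"
  define kz where "kz = (bb t - f t) * s + (bb t * f t - e t * iu) * a * b - (c1 t + c t * f t) * al * be"
  define kw where "kw = (c1 t + c t * f t) * (a * be + b * al)"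
  have flat: "gamma_flat z X Y = f t *\<^sub>R (a *\<^sub>R Y + b *\<^sub>R X) + kz *\<^sub>R z + kw *\<^sub>R (J *v z)
      + c t *\<^sub>R (be *\<^sub>R (J *v X) + al *\<^sub>R (J *v Y))"
    unfolding gamma_flat_def Let_def t_def[symmetric] a_def[symmetric] b_def[symmetric] al_def[symmetric]
      be_def[symmetric] s_def[symmetric] eu kz_def kw_def by simp
  have z: "z \<bullet> gamma_flat z X Y = 2 * f t * a * b + kz * t - 2 * c t * al * be"
    unfolding flat by (simp add: inner_add_right J_skew[of z X] J_skew[of z Y] t_def[symmetric]
        a_def[symmetric] b_def[symmetric] al_def[symmetric] be_def[symmetric] algebra_simps)
  have w: "(J *v z) \<bullet> gamma_flat z X Y = f t * (a * be + b * al) + kw * t + c t * (a * be + b * al)"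
    unfolding flat by (simp add: inner_add_right t_def[symmetric]
        a_def[symmetric] b_def[symmetric] al_def[symmetric] be_def[symmetric] algebra_simps)
  have kz: "kz + c t * (2 * f t * a * b + kz * t - 2 * c t * al * be)
      = p3 t * s + p4 t * a * b + p5 t * al * be"
    unfolding kz_def p3 p4 p5 bb iu_def[symmetric] using iu[folded iu_def] u c1 by algebra
  have kw: "kw + bb t * (f t * (a * be + b * al) + kw * t + c t * (a * be + b * al))
      = e t * (a * be + b * al)"
    unfolding kw_def bb iu_def[symmetric] using iu[folded iu_def] u c1 by algebra
  have "gamma_flat z X Y + (c t * (z \<bullet> gamma_flat z X Y)) *\<^sub>R z
      + (bb t * ((J *v z) \<bullet> gamma_flat z X Y)) *\<^sub>R (J *v z)
    = (f t * a) *\<^sub>R Y + (f t * b) *\<^sub>R X + (c t * be) *\<^sub>R (J *v X) + (c t * al) *\<^sub>R (J *v Y)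
      + (kz + c t * (z \<bullet> gamma_flat z X Y)) *\<^sub>R z
      + (kw + bb t * ((J *v z) \<bullet> gamma_flat z X Y)) *\<^sub>R (J *v z)"
    by (subst (1) flat) (simp add: algebra_simps)
  also have "\<dots> = gamma z X Y"
    unfolding z w kz kw conn_def t_def[symmetric] a_def[symmetric] b_def[symmetric] al_def[symmetric]
      be_def[symmetric] s_def[symmetric] ..
  finally show ?thesis by (simp add: t_def)
qed

lemma christ_eq:
  assumes "z \<in> ball 0 1"
  shows "christ g l i j z = gamma z (axis i 1) (axis j 1) $ l"
proof -
  define t where "t = z \<bullet> z"
  have t: "0 \<le> t" "t < 1" using ball_inner[OF assms] by (auto simp: t_def)
  define r where "r = kap * (f t)\<^sup>2"
  have r: "r \<noteq> 0" using kap_pos f_ge[OF t] by (simp add: r_def)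
  have bc: "bb t + c t + bb t * c t * t = 0"
    using u_nz[OF t] by (simp add: bb_def field_simps) (simp add: u_def algebra_simps)
  have inv: "matrix_inv (g z) = rank2 (1 / r) (c t) (bb t) z"
  proof (rule matrix_inv_eqI)
    show "g z ** rank2 (1 / r) (c t) (bb t) z = mat 1"
      using rank2_inverse[OF r, of "bb t" "c t" z] bc by (simp add: g_def r_def t_def)
    have "rank2 (1 / r) (c t) (bb t) z ** rank2 (1 / (1 / r)) (bb t) (c t) z = mat 1"
      using r bc by (intro rank2_inverse) (auto simp: t_def algebra_simps)
    then show "rank2 (1 / r) (c t) (bb t) z ** g z = mat 1"
      by (simp add: g_def r_def t_def)
  qed
  have pd: "pd g i z = (\<chi> j m. dG z (axis i 1) (axis j 1) (axis m 1))" for i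
    by (rule pd_eqI[OF g_has_derivative[OF assms]])
  have "christ g l i j z = (\<Sum>m\<in>UNIV. matrix_inv (g z) $ l $ m * (r * gamma_flat z (axis i 1) (axis j 1) $ m))"
    unfolding christ_def pd
    using koszul[of z "axis i 1" "axis j 1"]
    by (simp add: sum_distrib_left r_def t_def inner_axis mult.assoc)
  also have "\<dots> = (matrix_inv (g z) *v (r *\<^sub>R gamma_flat z (axis i 1) (axis j 1))) $ l"
    by (simp add: matrix_vector_mult_def)
  also have "\<dots> = gamma z (axis i 1) (axis j 1) $ l"
    unfolding inv rank2_mult gamma_flat_raise[OF assms, symmetric]
    using r by (simp add: t_def algebra_simps)
  finally show ?thesis .
qed

lemma riem_eq:
  assumes "z \<in> ball 0 1"
  shows "riem g l i j k z = curvature z (axis i 1) (axis j 1) (axis k 1) $ l"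
proof -
  interpret conn_coeffs J "f (z \<bullet> z)" "c (z \<bullet> z)" "p3 (z \<bullet> z)" "p4 (z \<bullet> z)" "p5 (z \<bullet> z)" "e (z \<bullet> z)"
     "q1 (z \<bullet> z)" "c1 (z \<bullet> z)" "q3 (z \<bullet> z)" "q4 (z \<bullet> z)" "q5 (z \<bullet> z)" "e1 (z \<bullet> z)" ..
  have pdc: "pd (christ g l j k) i z = dgam z (axis i 1) (axis j 1) (axis k 1) $ l" for i j k
  \<comment> \<open>\<open>christ_eq\<close> is known only inside the ball, so the derivative is
    transferred along an open set.\<close>
  proof (rule pd_eqI, rule has_derivative_transform_within_open[OF _ open_ball assms])
    show "((\<lambda>z. gamma z (axis j 1) (axis k 1) $ l) has_derivative (\<lambda>V. dgam z V (axis j 1) (axis k 1) $ l)) (at z)"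
      by (rule bounded_linear.has_derivative[OF bounded_linear_vec_nth gamma_has_derivative[OF assms]])
  qed (simp add: christ_eq)
  have sum: "(\<Sum>m\<in>UNIV. christ g m j k z * christ g l i m z) = gamma z (axis i 1) (gamma z (axis j 1) (axis k 1)) $ l" for i j
    unfolding christ_eq[OF assms] by (rule linear_axis_expand[OF conn_linear(1)])
  show ?thesis
    unfolding riem_def pdc sum_subtractf sum curv_def by simp
qed

lemma curvature_linear:
  "linear (\<lambda>X. curvature z X Y Z)" "linear (\<lambda>Y. curvature z X Y Z)" "linear (\<lambda>Z. curvature z X Y Z)"
proof -
  interpret conn_coeffs J "f (z \<bullet> z)" "c (z \<bullet> z)" "p3 (z \<bullet> z)" "p4 (z \<bullet> z)" "p5 (z \<bullet> z)" "e (z \<bullet> z)"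
     "q1 (z \<bullet> z)" "c1 (z \<bullet> z)" "q3 (z \<bullet> z)" "q4 (z \<bullet> z)" "q5 (z \<bullet> z)" "e1 (z \<bullet> z)" ..
  note rules = linear_add[OF conn_linear(1)] linear_scale[OF conn_linear(1)]
    linear_add[OF conn_linear(2)] linear_scale[OF conn_linear(2)]
    linear_add[OF dconn_linear(1)] linear_scale[OF dconn_linear(1)]
    linear_add[OF dconn_linear(2)] linear_scale[OF dconn_linear(2)]
    linear_add[OF dconn_linear(3)] linear_scale[OF dconn_linear(3)]
  show "linear (\<lambda>X. curvature z X Y Z)" "linear (\<lambda>Y. curvature z X Y Z)" "linear (\<lambda>Z. curvature z X Y Z)"
    by (rule linearI; simp add: curv_def rules inner_add_right algebra_simps)+
qed

lemma riem_vec_eq: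
  assumes "z \<in> ball 0 1"
  shows "riem_vec g z X Y Z = curvature z X Y Z"
proof -
  have "riem_vec g z X Y Z $ l = curvature z X Y Z $ l" for l
  proof -
    have "riem_vec g z X Y Z $ l = (\<Sum>i\<in>UNIV. X $ i * (\<Sum>j\<in>UNIV. Y $ j * (\<Sum>k\<in>UNIV. Z $ k * curvature z (axis i 1) (axis j 1) (axis k 1) $ l)))"
      unfolding riem_vec_def riem_eq[OF assms] by (simp add: sum_distrib_left mult.assoc)
    then show ?thesis unfolding curvature_linear[THEN linear_axis_expand] .
  qed
  then show ?thesis by (simp add: vec_eq_iff)
qed

lemma ricci_eq:
  assumes "z \<in> ball 0 1"
  shows "ricci g j k z = trace_of (\<lambda>V. curvature z V (axis j 1) (axis k 1))"
  unfolding ricci_def riem_eq[OF assms] trace_of_def ..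

end

section \<open>The square root of the metric and the sectional curvature\<close>

lemma gram_pos:
  assumes "lin_indep2 X Y"
  shows "(X \<bullet> X) * (Y \<bullet> Y) - (X \<bullet> Y)\<^sup>2 > 0"
proof -
  have X: "X \<bullet> X > 0" using assms by (simp add: lin_indep2_def)
  define v where "v = (X \<bullet> X) *\<^sub>R Y - (X \<bullet> Y) *\<^sub>R X"
  have "v \<noteq> 0"
  proof
    assume "v = 0"
    then have "(X \<bullet> X) *\<^sub>R Y = (X \<bullet> Y) *\<^sub>R X" by (simp add: v_def)
    then have "Y = ((X \<bullet> Y) / (X \<bullet> X)) *\<^sub>R X"
      using X by (metis divideR_right divide_inverse_commute less_irrefl scaleR_scaleR)
    then show False using assms by (auto simp: lin_indep2_def)
  qed
  then have "v \<bullet> v > 0" by simp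
  also have "v \<bullet> v = (X \<bullet> X) * ((X \<bullet> X) * (Y \<bullet> Y) - (X \<bullet> Y)\<^sup>2)"
    unfolding v_def inner_diff_left inner_diff_right inner_scaleR_left inner_scaleR_right inner_commute[of Y X]
    by algebra
  finally show ?thesis using X zero_less_mult_pos by blast
qed

context ansatz
begin

text \<open>With v = sqrt u this stretches \<open>z\<close> by 1/v and \<open>Jz\<close> by v. The
  coefficients are (1/v - 1)/t and (v - 1)/t, rewritten by c t = v^2 - 1 so that they make sense at
  the origin. \<open>hroot_inv\<close> exchanges them.\<close>

definition hroot :: "real^'m \<Rightarrow> real^'m^'m" where
  "hroot z = (let v = sqrt (u (z \<bullet> z)) in rank2 1 (- c (z \<bullet> z) / (v * (v + 1))) (c (z \<bullet> z) / (v + 1)) z)"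

definition hroot_inv :: "real^'m \<Rightarrow> real^'m^'m" where
  "hroot_inv z = (let v = sqrt (u (z \<bullet> z)) in rank2 1 (c (z \<bullet> z) / (v + 1)) (- c (z \<bullet> z) / (v * (v + 1))) z)"

abbreviation h :: "real^'m \<Rightarrow> real^'m \<Rightarrow> real^'m \<Rightarrow> real" where
  "h z X Y \<equiv> X \<bullet> Y + bb (z \<bullet> z) * (z \<bullet> X) * (z \<bullet> Y) + c (z \<bullet> z) * ((J *v z) \<bullet> X) * ((J *v z) \<bullet> Y)"

lemma cball_inner: "z \<in> cball 0 1 \<Longrightarrow> 0 \<le> z \<bullet> z \<and> z \<bullet> z \<le> 1"
  by (simp add: power2_norm_eq_inner[symmetric] abs_square_le_1)

context
  fixes z :: "real^'m" assumes z: "z \<in> cball 0 1"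
begin

lemma root_coeffs:
  defines "v \<equiv> sqrt (u (z \<bullet> z))"
  defines "s1 \<equiv> - c (z \<bullet> z) / (v * (v + 1))" and "s2 \<equiv> c (z \<bullet> z) / (v + 1)"
  shows "v > 0" "v\<^sup>2 = u (z \<bullet> z)" "1 + s1 * (z \<bullet> z) = 1 / v" "1 + s2 * (z \<bullet> z) = v"
    "s1 + s2 + s1 * s2 * (z \<bullet> z) = 0" "2 * s1 + s1\<^sup>2 * (z \<bullet> z) = bb (z \<bullet> z)"
    "2 * s2 + s2\<^sup>2 * (z \<bullet> z) = c (z \<bullet> z)"
proof -
  define t where "t = z \<bullet> z"
  have up: "u t > 0" using cball_inner[OF z] u_gt_0 by (simp add: t_def)
  show v: "v > 0" using up by (simp add: v_def t_def)
  show vv: "v\<^sup>2 = u (z \<bullet> z)" using up by (simp add: v_def t_def)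
  have ct: "c t * t = v\<^sup>2 - 1" unfolding vv u_def t_def by simp
  have bbt: "bb t = - c t / v\<^sup>2" unfolding vv bb_def t_def ..
  have nz: "v \<noteq> 0" "v + 1 \<noteq> 0" using v by auto
  have s2: "s2 * (v + 1) = c t" using nz by (simp add: s2_def t_def)
  have s1: "s1 * v = - s2" using nz by (simp add: s1_def s2_def)
  have "(v + 1) * (s2 * t) = s2 * (v + 1) * t" by simp
  also have "\<dots> = (v + 1) * (v - 1)" unfolding s2 ct by (simp add: power2_eq_square algebra_simps)
  finally have "(v + 1) * (s2 * t) = (v + 1) * (v - 1)" .
  then have s2t: "s2 * t = v - 1" using nz mult_left_cancel by blast
  then show "1 + s2 * (z \<bullet> z) = v" by (simp add: t_def)
  have "v * (s1 * t) = 1 - v" using s1 s2t by algebra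
  then have s1t: "s1 * t = 1 / v - 1" using nz by (simp add: field_simps)
  then show "1 + s1 * (z \<bullet> z) = 1 / v" by (simp add: t_def)
  show "s1 + s2 + s1 * s2 * (z \<bullet> z) = 0" using s2t s1 unfolding t_def by algebra
  show "2 * s2 + s2\<^sup>2 * (z \<bullet> z) = c (z \<bullet> z)" using s2t s2 unfolding t_def by algebra
  have "v\<^sup>2 * (2 * s1 + s1\<^sup>2 * t) = - c t" using s1 s2t s2 by algebra
  moreover have "v\<^sup>2 * bb t = - c t" using nz bbt by simp
  ultimately have "v\<^sup>2 * (2 * s1 + s1\<^sup>2 * t) = v\<^sup>2 * bb t" by simp
  then show "2 * s1 + s1\<^sup>2 * (z \<bullet> z) = bb (z \<bullet> z)" using nz by (simp add: t_def)
qed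

lemma root_inner: "(hroot z *v X) \<bullet> (hroot z *v Y) = h z X Y"
proof -
  define s1 where "s1 = - c (z \<bullet> z) / (sqrt (u (z \<bullet> z)) * (sqrt (u (z \<bullet> z)) + 1))"
  define s2 where "s2 = c (z \<bullet> z) / (sqrt (u (z \<bullet> z)) + 1)"
  have "(hroot z *v X) \<bullet> (hroot z *v Y) = X \<bullet> Y + (2 * s1 + s1\<^sup>2 * (z \<bullet> z)) * (z \<bullet> X) * (z \<bullet> Y)
      + (2 * s2 + s2\<^sup>2 * (z \<bullet> z)) * ((J *v z) \<bullet> X) * ((J *v z) \<bullet> Y)"
    unfolding hroot_def Let_def s1_def[symmetric] s2_def[symmetric] rank2_mult
    by (simp add: inner_add_left inner_add_right inner_commute[of X z] inner_commute[of X "J *v z"]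
        algebra_simps power2_eq_square)
  then show ?thesis unfolding s1_def s2_def root_coeffs(6,7) .
qed

lemma root_z: "z \<bullet> (hroot z *v X) = (z \<bullet> X) / sqrt (u (z \<bullet> z))"
proof -
  have "z \<bullet> (hroot z *v X) = (1 + (- c (z \<bullet> z) / (sqrt (u (z \<bullet> z)) * (sqrt (u (z \<bullet> z)) + 1))) * (z \<bullet> z)) * (z \<bullet> X)"
    unfolding hroot_def Let_def rank2_mult by (simp add: inner_add_right algebra_simps)
  then show ?thesis unfolding root_coeffs(3) by simp
qed

lemma root_Jz: "(J *v z) \<bullet> (hroot z *v X) = sqrt (u (z \<bullet> z)) * ((J *v z) \<bullet> X)"
proof -
  have "(J *v z) \<bullet> (hroot z *v X) = (1 + c (z \<bullet> z) / (sqrt (u (z \<bullet> z)) + 1) * (z \<bullet> z)) * ((J *v z) \<bullet> X)"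
    unfolding hroot_def Let_def rank2_mult by (simp add: inner_add_right algebra_simps)
  then show ?thesis unfolding root_coeffs(4) .
qed

text \<open>The stretchings of \<open>z\<close> and \<open>Jz\<close> are reciprocal, so the root
  preserves the symplectic form <JX, Y>. Hence this term of the curvature acquires no power of
  u.\<close>

lemma root_J: "(J *v (hroot z *v X)) \<bullet> (hroot z *v Y) = (J *v X) \<bullet> Y"
proof -
  define s1 where "s1 = - c (z \<bullet> z) / (sqrt (u (z \<bullet> z)) * (sqrt (u (z \<bullet> z)) + 1))"
  define s2 where "s2 = c (z \<bullet> z) / (sqrt (u (z \<bullet> z)) + 1)"
  have "(J *v (hroot z *v X)) \<bullet> (hroot z *v Y) = (J *v X) \<bullet> Y
     + ((z \<bullet> X) * ((J *v z) \<bullet> Y) - (z \<bullet> Y) * ((J *v z) \<bullet> X)) * (s1 + s2 + s1 * s2 * (z \<bullet> z))"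
    unfolding hroot_def Let_def s1_def[symmetric] s2_def[symmetric] rank2_mult
    using J_pair[of X z] J_pair[of Y z] inner_commute[of "J *v X" "J *v z"]
    by (simp add: matrix_vector_right_distrib matrix_vector_mult_scaleR inner_add_left inner_add_right algebra_simps)
  then show ?thesis using root_coeffs(5) by (simp add: s1_def s2_def)
qed

lemma root_unroot: "hroot z *v (hroot_inv z *v X) = X"
proof -
  have "hroot z ** hroot_inv z = mat 1"
    using rank2_inverse[of 1, OF _ root_coeffs(5)] by (simp add: hroot_def hroot_inv_def Let_def)
  then show ?thesis by (simp add: matrix_vector_mul_assoc)
qed

lemma unroot_root: "hroot_inv z *v (hroot z *v X) = X"
proof -
  have "hroot_inv z ** hroot z = mat 1"
    using rank2_inverse[of 1 "c (z \<bullet> z) / (sqrt (u (z \<bullet> z)) + 1)" "- c (z \<bullet> z) / (sqrt (u (z \<bullet> z)) * (sqrt (u (z \<bullet> z)) + 1))" z]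
      root_coeffs(5) by (simp add: hroot_def hroot_inv_def Let_def algebra_simps)
  then show ?thesis by (simp add: matrix_vector_mul_assoc)
qed

lemma root_lin_indep2:
  assumes "lin_indep2 X Y" shows "lin_indep2 (hroot z *v X) (hroot z *v Y)"
  using assms unroot_root unfolding lin_indep2_def
  by (metis matrix_vector_mult_0_right matrix_vector_mult_scaleR)

lemma unroot_lin_indep2:
  assumes "lin_indep2 X Y" shows "lin_indep2 (hroot_inv z *v X) (hroot_inv z *v Y)"
  using assms root_unroot unfolding lin_indep2_def
  by (metis matrix_vector_mult_0_right matrix_vector_mult_scaleR)

lemma h_pos: "X \<noteq> 0 \<Longrightarrow> h z X X > 0"
  unfolding root_inner[symmetric] using unroot_root[of X] by force

end

lemma gform_g: "gform (g z) X Y = kap * (f (z \<bullet> z))\<^sup>2 * h z X Y"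
  unfolding g_def rank2_gform ..

lemma gform_curvature:
  fixes X Y :: "real^'m"
  assumes "z \<in> ball 0 1"
  defines "t \<equiv> z \<bullet> z"
  defines "D \<equiv> (z \<bullet> X) * ((J *v z) \<bullet> Y) - (z \<bullet> Y) * ((J *v z) \<bullet> X)"
  shows "gform (g z) (riem_vec g z X Y Y) X = kap * (f t)\<^sup>2 *
     (- ((f t)\<^sup>2 + c t * (f t - 1)\<^sup>2) * (h z X X * h z Y Y - (h z X Y)\<^sup>2)
      - (f t * c t + (f t - 1) * c1 t) *
          (((z \<bullet> X)\<^sup>2 * (1 / u t) + u t * ((J *v z) \<bullet> X)\<^sup>2) * h z Y Y
           + ((z \<bullet> Y)\<^sup>2 * (1 / u t) + u t * ((J *v z) \<bullet> Y)\<^sup>2) * h z X X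
           - 2 * ((z \<bullet> X) * (z \<bullet> Y) * (1 / u t) + u t * ((J *v z) \<bullet> X) * ((J *v z) \<bullet> Y)) * h z X Y)
      - 3 * c t * ((J *v X) \<bullet> Y)\<^sup>2 - 6 * c1 t * D * ((J *v X) \<bullet> Y) - 2 * c2 t * D\<^sup>2)"
proof -
  have t: "0 \<le> t" "t < 1" using ball_inner[OF assms(1)] by (auto simp: t_def)
  interpret profile_point "c t" "e t" "e1 t" "f t" t "u t" "u1 t" "1 / u t" "c1 t" "c2 t"
    "f t" "c t" "p3 t" "p4 t" "p5 t" "e t" "q1 t" "c1 t" "q3 t" "q4 t" "q5 t" "e1 t" "bb t"
    by (rule point[OF t])
  interpret conn_coeffs J "f t" "c t" "p3 t" "p4 t" "p5 t" "e t" "q1 t" "c1 t" "q3 t" "q4 t" "q5 t" "e1 t" ..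
  have "gform (g z) (riem_vec g z X Y Y) X = kap * (f t)\<^sup>2 *
      (curv z X Y Y \<bullet> X + bb t * (z \<bullet> X) * (curv z X Y Y \<bullet> z) + c t * ((J *v z) \<bullet> X) * (curv z X Y Y \<bullet> (J *v z)))"
    unfolding gform_g riem_vec_eq[OF assms(1)] t_def[symmetric]
    by (simp add: inner_commute)
  also have "curv z X Y Y \<bullet> X + bb t * (z \<bullet> X) * (curv z X Y Y \<bullet> z) + c t * ((J *v z) \<bullet> X) * (curv z X Y Y \<bullet> (J *v z)) =
     - ((f t)\<^sup>2 + c t * (f t - 1)\<^sup>2) * (h z X X * h z Y Y - (h z X Y)\<^sup>2)
      - (f t * c t + (f t - 1) * c1 t) *
          (((z \<bullet> X)\<^sup>2 * (1 / u t) + u t * ((J *v z) \<bullet> X)\<^sup>2) * h z Y Y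
           + ((z \<bullet> Y)\<^sup>2 * (1 / u t) + u t * ((J *v z) \<bullet> Y)\<^sup>2) * h z X X
           - 2 * ((z \<bullet> X) * (z \<bullet> Y) * (1 / u t) + u t * ((J *v z) \<bullet> X) * ((J *v z) \<bullet> Y)) * h z X Y)
      - 3 * c t * ((J *v X) \<bullet> Y)\<^sup>2 - 6 * c1 t * D * ((J *v X) \<bullet> Y) - 2 * c2 t * D\<^sup>2"
    unfolding D_def t_def[symmetric]
    by (rule sec_identity[OF curv_inner_X[of z X Y, folded t_def] curv_inner_z[of z X Y, folded t_def]
          curv_inner_Jz[of z X Y, folded t_def]])
  finally show ?thesis .
qed

end

section \<open>The Taub-NUT metrics\<close>

context complex_structure
begin

definition gram :: "real^'m \<Rightarrow> real^'m \<Rightarrow> real" where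
  "gram X Y = (X \<bullet> X) * (Y \<bullet> Y) - (X \<bullet> Y)\<^sup>2"

text \<open>The sectional Weyl curvature of the metrics, divided by \<open>\<lambda> - 1\<close> and read in the Euclidean model.\<close>
definition weyl :: "nat \<Rightarrow> real^'m \<Rightarrow> real^'m \<Rightarrow> real^'m \<Rightarrow> real" where
  "weyl k z X Y = (let t = z \<bullet> z; w = J *v z; p = poly (profile k) t; p' = poly (pderiv (profile k)) t;
       p'' = poly (pderiv (pderiv (profile k))) t; om = (J *v X) \<bullet> Y;
       D = (z \<bullet> X) * (w \<bullet> Y) - (z \<bullet> Y) * (w \<bullet> X) in
     (p * (1 + t)\<^sup>2 / 4 - 1) * ((X \<bullet> X) * (Y \<bullet> Y) - (X \<bullet> Y)\<^sup>2)
     + (p * (1 - t) / 2 + p' * (1 - t\<^sup>2) / 4) *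
        (((z \<bullet> X)\<^sup>2 + (w \<bullet> X)\<^sup>2) * (Y \<bullet> Y) + ((z \<bullet> Y)\<^sup>2 + (w \<bullet> Y)\<^sup>2) * (X \<bullet> X)
          - 2 * ((z \<bullet> X) * (z \<bullet> Y) + (w \<bullet> X) * (w \<bullet> Y)) * (X \<bullet> Y))
     + 3 / 4 * (1 - t)\<^sup>2 * p * om\<^sup>2 + 3 / 2 * (1 - t)\<^sup>2 * p' * D * om + 1 / 2 * (1 - t)\<^sup>2 * p'' * D\<^sup>2)"

text \<open>At t = 1 the first coefficient vanishes by P(1) = 1 and all others carry a factor 1 - t.
  A nonzero extremum is therefore attained over the open ball.\<close>

lemma weyl_sphere:
  assumes "norm z = 1"
  shows "weyl k z X Y = 0"
proof -
  have "z \<bullet> z = 1" using assms by (simp add: norm_eq_1)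
  then show ?thesis unfolding weyl_def Let_def by (simp add: profile_1)
qed

text \<open>W is quadratic in the bivector of \<open>X\<close> and \<open>Y\<close>. Triangular
  changes of basis are enough for the Gram-Schmidt step in \<open>weyl_normalize\<close>.\<close>

lemma weyl_gl2: "weyl k z (r *\<^sub>R X) (s *\<^sub>R Y + q *\<^sub>R X) = (r * s)\<^sup>2 * weyl k z X Y"
  unfolding weyl_def Let_def inner_add_left inner_add_right inner_scaleR_left inner_scaleR_right
    matrix_vector_mult_scaleR J_self inner_commute[of Y X] by algebra

lemma weyl_continuous: "continuous_on S (\<lambda>q. weyl k (fst q) (fst (snd q)) (snd (snd q)))"
proof -
  let ?z = "\<lambda>q::(real^'m) \<times> (real^'m) \<times> (real^'m). fst q" and ?X = "\<lambda>q::(real^'m) \<times> (real^'m) \<times> (real^'m). fst (snd q)"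
    and ?Y = "\<lambda>q::(real^'m) \<times> (real^'m) \<times> (real^'m). snd (snd q)"
  have v: "continuous_on S ?z" "continuous_on S ?X" "continuous_on S ?Y"
    by (intro continuous_intros)+
  note Jv = v[THEN bounded_linear.continuous_on[OF matrix_vector_mul_bounded_linear[of J]]]
  have t: "continuous_on S (\<lambda>q. ?z q \<bullet> ?z q)" by (intro continuous_on_inner v)
  have P: "continuous_on S (\<lambda>q. poly P (?z q \<bullet> ?z q))" for P
    by (induction P) (auto intro!: continuous_on_add continuous_on_mult t)
  have quarter: "continuous_on S (\<lambda>q. f q / 4)" "continuous_on S (\<lambda>q. f q / 2)" if "continuous_on S f"
    for f :: "_ \<Rightarrow> real" using that by (auto intro: continuous_on_divide)
  show ?thesis
    unfolding weyl_def Let_def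
    by (intro continuous_on_add continuous_on_diff continuous_on_mult continuous_on_power quarter
        continuous_on_const continuous_on_inner P v Jv)
qed

section \<open>Extremal planes of the sectional Weyl curvature\<close>

definition frames :: "((real^'m) \<times> (real^'m) \<times> (real^'m)) set" where
  "frames = {(z, X, Y). norm z \<le> 1 \<and> norm X = 1 \<and> norm Y = 1 \<and> X \<bullet> Y = 0}"

lemma compact_frames: "compact frames"
proof -
  have eq: "frames = (cball 0 1 \<times> sphere 0 1 \<times> sphere 0 1) \<inter> {q. fst (snd q) \<bullet> snd (snd q) = 0}"
    by (auto simp: frames_def)
  have "closed {q :: (real^'m) \<times> (real^'m) \<times> (real^'m). fst (snd q) \<bullet> snd (snd q) = 0}"
    by (intro closed_Collect_eq continuous_intros)
  then show ?thesis unfolding eq by (intro compact_Int_closed compact_Times compact_cball compact_sphere)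
qed

lemma frames_nonempty: "frames \<noteq> {}"
proof -
  have "norm (J *v axis i 1) = 1" for i by (simp add: norm_eq_1)
  \<comment> \<open>\<open>undefined\<close> stands for an arbitrary index; a unit vector and its
    image under \<open>J\<close> are orthonormal.\<close>
  then have "(0, axis undefined 1, J *v axis undefined 1) \<in> frames" by (simp add: frames_def)
  then show ?thesis by blast
qed

lemma frames_lin_indep2: "(z, X, Y) \<in> frames \<Longrightarrow> lin_indep2 X Y \<and> gram X Y = 1"
  by (auto simp: frames_def lin_indep2_def gram_def norm_eq_1)

lemma weyl_normalize:
  assumes "lin_indep2 X Y" "z \<in> cball 0 1"
  obtains X' Y' where "(z, X', Y') \<in> frames" "weyl k z X Y / gram X Y = weyl k z X' Y'"
proof -
  define a where "a = X \<bullet> X"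
  define b where "b = X \<bullet> Y"
  define G where "G = gram X Y"
  have a: "a > 0" using assms(1) by (simp add: a_def lin_indep2_def)
  have G: "G > 0" using gram_pos[OF assms(1)] by (simp add: G_def gram_def)
  have Geq: "a * (Y \<bullet> Y) = G + b\<^sup>2" by (simp add: G_def gram_def a_def b_def)
  define r where "r = 1 / sqrt a"
  define w where "w = 1 / sqrt (a * G)"
  have r: "r\<^sup>2 * a = 1" using a by (simp add: r_def power_divide)
  have w: "w\<^sup>2 * (a * G) = 1" using a G by (simp add: w_def power_divide)
  define X' where "X' = r *\<^sub>R X"
  \<comment> \<open>Gram-Schmidt without quotients: a Y - b X is orthogonal to \<open>X\<close> and
    has squared length a G, so the factor \<open>w\<close> normalizes it.\<close>
  define Y' where "Y' = (w * a) *\<^sub>R Y + (- w * b) *\<^sub>R X"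
  have "X' \<bullet> X' = 1" unfolding X'_def using r by (simp add: a_def power2_eq_square)
  moreover have "X' \<bullet> Y' = 0" unfolding X'_def Y'_def by (simp add: inner_add_right inner_diff_right a_def b_def)
  moreover have "Y' \<bullet> Y' = 1"
  proof -
    have "Y' \<bullet> Y' = w\<^sup>2 * (a * (a * (Y \<bullet> Y)) - a * b\<^sup>2)"
      unfolding Y'_def inner_add_left inner_add_right inner_scaleR_left inner_scaleR_right
        inner_commute[of Y X] a_def[symmetric] b_def[symmetric] by algebra
    also have "\<dots> = 1" unfolding Geq using w by (simp add: algebra_simps)
    finally show ?thesis .
  qed
  ultimately have "(z, X', Y') \<in> frames" using assms(2) by (simp add: frames_def norm_eq_1)
  moreover have "weyl k z X Y / gram X Y = weyl k z X' Y'"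
  proof -
    have "(r * (w * a))\<^sup>2 * G = (r\<^sup>2 * a) * (w\<^sup>2 * (a * G))" by algebra
    then have "(r * (w * a))\<^sup>2 * G = 1" unfolding r w by simp
    then have "(r * (w * a))\<^sup>2 = 1 / G" using G by (simp add: eq_divide_eq)
    then show ?thesis unfolding X'_def Y'_def weyl_gl2 by (simp add: G_def)
  qed
  ultimately show ?thesis by (rule that)
qed

text \<open>The sign of \<open>s\<close> decides whether a maximum or a minimum of W is taken, so
  one lemma serves both directions of the parameter.\<close>

lemma weyl_extremal:
  fixes s :: real
  obtains z0 X0 Y0 where "(z0, X0, Y0) \<in> frames"
    "\<And>z X Y. z \<in> cball 0 1 \<Longrightarrow> lin_indep2 X Y \<Longrightarrow> s * (weyl k z X Y / gram X Y) \<le> s * weyl k z0 X0 Y0"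
proof -
  have "continuous_on frames (\<lambda>q. s * weyl k (fst q) (fst (snd q)) (snd (snd q)))"
    by (intro continuous_intros weyl_continuous)
  from continuous_attains_sup[OF compact_frames frames_nonempty this]
  obtain q where q: "q \<in> frames"
    "\<And>p. p \<in> frames \<Longrightarrow> s * weyl k (fst p) (fst (snd p)) (snd (snd p)) \<le> s * weyl k (fst q) (fst (snd q)) (snd (snd q))"
    by blast
  obtain z0 X0 Y0 where q_eq: "q = (z0, X0, Y0)" by (cases q)
  show ?thesis
  proof (rule that[of z0 X0 Y0])
    show "(z0, X0, Y0) \<in> frames" using q(1) by (simp add: q_eq)
    fix z X Y :: "real^'m" assume zXY: "z \<in> cball 0 1" "lin_indep2 X Y"
    obtain X' Y' where "(z, X', Y') \<in> frames" "weyl k z X Y / gram X Y = weyl k z X' Y'"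
      using weyl_normalize[OF zXY(2,1)] by metis
    then show "s * (weyl k z X Y / gram X Y) \<le> s * weyl k z0 X0 Y0"
      using q(2)[of "(z, X', Y')"] by (simp add: q_eq)
  qed
qed

end

locale taub_nut = complex_structure J for J :: "real^'m^'m" +
  fixes k :: nat and lam :: real
  assumes card: "CARD('m) = 2 * k + 2" and lam: "lam > 0"
begin

sublocale ansatz J "\<lambda>t. (1 / lam - 1) * poly (profile k) t" "\<lambda>t. (1 / lam - 1) * poly (pderiv (profile k)) t"
  "\<lambda>t. (1 / lam - 1) * poly (pderiv (pderiv (profile k))) t" "1 / lam"
proof
  show "0 < 1 + t * ((1 / lam - 1) * poly (profile k) t)" if "0 \<le> t" "t \<le> 1" for t
    using fibre_factor_pos[of "1 / lam" t k] lam that by (simp add: fibre_factor_def)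
qed (use lam in \<open>auto intro!: derivative_eq_intros poly_DERIV\<close>)

text \<open>Apart from f^2 G every term of the numerator is linear in kap - 1. Splitting f^2 as kap
  f^2 - (kap - 1) f^2 isolates the curvature -1, and the rest is - (kap - 1) f^2 W. The denominator
  contributes one more factor kap f^2, which leaves (1 - kap)/kap = lam - 1.\<close>

lemma sec_curv_eq:
  assumes z: "z \<in> ball 0 1" and XY: "lin_indep2 X Y"
  shows "sec_curv g z X Y = -1 + (lam - 1) * (weyl k z (hroot z *v X) (hroot z *v Y) / gram (hroot z *v X) (hroot z *v Y))"
proof -
  have zc: "z \<in> cball 0 1" using z by simp
  define t where "t = z \<bullet> z"
  have t: "0 \<le> t" "t < 1" using ball_inner[OF z] by (auto simp: t_def)
  define X' where "X' = hroot z *v X"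
  define Y' where "Y' = hroot z *v Y"
  define G where "G = gram X' Y'"
  have G: "G > 0" using gram_pos[OF root_lin_indep2[OF zc XY]] by (simp add: G_def gram_def X'_def Y'_def)
  define v where "v = sqrt (u t)"
  have v: "v > 0" "v\<^sup>2 = u t" using u_gt_0[of t] t by (auto simp: v_def)
  have zX: "z \<bullet> X = v * (z \<bullet> X')" and zY: "z \<bullet> Y = v * (z \<bullet> Y')"
    using v root_z[OF zc] by (auto simp: X'_def Y'_def t_def v_def)
  have wX: "(J *v z) \<bullet> X = ((J *v z) \<bullet> X') / v" and wY: "(J *v z) \<bullet> Y = ((J *v z) \<bullet> Y') / v"
    using v root_Jz[OF zc] by (auto simp: X'_def Y'_def t_def v_def)
  have om: "(J *v X) \<bullet> Y = (J *v X') \<bullet> Y'" using root_J[OF zc] by (simp add: X'_def Y'_def)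
  have hX: "h z X X = X' \<bullet> X'" and hY: "h z Y Y = Y' \<bullet> Y'" and hXY: "h z X Y = X' \<bullet> Y'"
    using root_inner[OF zc] by (auto simp: X'_def Y'_def)
  have D: "(z \<bullet> X) * ((J *v z) \<bullet> Y) - (z \<bullet> Y) * ((J *v z) \<bullet> X)
      = (z \<bullet> X') * ((J *v z) \<bullet> Y') - (z \<bullet> Y') * ((J *v z) \<bullet> X')"
    unfolding zX zY wX wY using v by (simp add: field_simps)
  have e: "(z \<bullet> X)\<^sup>2 * (1 / u t) = (z \<bullet> X')\<^sup>2" "(z \<bullet> Y)\<^sup>2 * (1 / u t) = (z \<bullet> Y')\<^sup>2"
    "(z \<bullet> X) * (z \<bullet> Y) * (1 / u t) = (z \<bullet> X') * (z \<bullet> Y')"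
    "u t * ((J *v z) \<bullet> X)\<^sup>2 = ((J *v z) \<bullet> X')\<^sup>2" "u t * ((J *v z) \<bullet> Y)\<^sup>2 = ((J *v z) \<bullet> Y')\<^sup>2"
    "u t * ((J *v z) \<bullet> X) * ((J *v z) \<bullet> Y) = ((J *v z) \<bullet> X') * ((J *v z) \<bullet> Y')"
    unfolding zX zY wX wY v(2)[symmetric] using v(1) by (simp_all add: field_simps power2_eq_square)
  define p where "p = poly (profile k) t"
  define p' where "p' = poly (pderiv (profile k)) t"
  define p'' where "p'' = poly (pderiv (pderiv (profile k))) t"
  define F where "F = f t"
  define kap where "kap = 1 / lam"
  \<comment> \<open>These two relations absorb the powers of 1 - t and 1 + t in \<open>weyl\<close>
    into powers of \<open>F\<close>, matching the formula for the numerator.\<close>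
  have minus: "F * (1 - t) = 2" using t by (simp add: F_def f_def field_simps)
  then have plus: "F * (1 + t) = 2 * (F - 1)" by (simp add: algebra_simps)
  have F: "F > 0" using f_ge[OF t] by (simp add: F_def)
  have kap: "kap > 0" "kap * lam = 1" using lam by (auto simp: kap_def)
  define om where "om = (J *v X') \<bullet> Y'"
  define D where "D = (z \<bullet> X') * ((J *v z) \<bullet> Y') - (z \<bullet> Y') * ((J *v z) \<bullet> X')"
  define E where "E = ((z \<bullet> X')\<^sup>2 + ((J *v z) \<bullet> X')\<^sup>2) * (Y' \<bullet> Y') + ((z \<bullet> Y')\<^sup>2 + ((J *v z) \<bullet> Y')\<^sup>2) * (X' \<bullet> X')
          - 2 * ((z \<bullet> X') * (z \<bullet> Y') + ((J *v z) \<bullet> X') * ((J *v z) \<bullet> Y')) * (X' \<bullet> Y')"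
  have num: "gform (g z) (riem_vec g z X Y Y) X = kap * F\<^sup>2 *
     (- (F\<^sup>2 + (kap - 1) * p * (F - 1)\<^sup>2) * G
      - (F * ((kap - 1) * p) + (F - 1) * ((kap - 1) * p')) * E
      - 3 * ((kap - 1) * p) * om\<^sup>2 - 6 * ((kap - 1) * p') * D * om - 2 * ((kap - 1) * p'') * D\<^sup>2)"
    unfolding gform_curvature[OF z] hX hY hXY unfolding t_def[symmetric] D e om
    by (simp add: G_def gram_def E_def D_def om_def p_def p'_def p''_def F_def kap_def)
  have W: "weyl k z X' Y' = (p * (1 + t)\<^sup>2 / 4 - 1) * G + (p * (1 - t) / 2 + p' * (1 - t\<^sup>2) / 4) * E
     + 3 / 4 * (1 - t)\<^sup>2 * p * om\<^sup>2 + 3 / 2 * (1 - t)\<^sup>2 * p' * D * om + 1 / 2 * (1 - t)\<^sup>2 * p'' * D\<^sup>2"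
    unfolding weyl_def Let_def t_def[symmetric] p_def[symmetric] p'_def[symmetric] p''_def[symmetric]
      G_def gram_def E_def D_def om_def ..
  have W4: "4 * weyl k z X' Y' = (p * (1 + t)\<^sup>2 - 4) * G + (2 * p * (1 - t) + p' * (1 - t\<^sup>2)) * E
     + 3 * (1 - t)\<^sup>2 * p * om\<^sup>2 + 6 * (1 - t)\<^sup>2 * p' * D * om + 2 * (1 - t)\<^sup>2 * p'' * D\<^sup>2"
    unfolding W by (simp add: field_simps)
  define W0 where "W0 = weyl k z X' Y'"
  have "4 * (F\<^sup>2 * W0) = F\<^sup>2 * (4 * weyl k z X' Y')" by (simp add: W0_def)
  also have "\<dots> = (p * (F * (1 + t))\<^sup>2 - 4 * F\<^sup>2) * G
      + (2 * F * p * (F * (1 - t)) + p' * (F * (1 - t)) * (F * (1 + t))) * E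
     + 3 * (F * (1 - t))\<^sup>2 * p * om\<^sup>2 + 6 * (F * (1 - t))\<^sup>2 * p' * D * om + 2 * (F * (1 - t))\<^sup>2 * p'' * D\<^sup>2"
    unfolding W4 by algebra
  also have "\<dots> = 4 * (((F - 1)\<^sup>2 * p - F\<^sup>2) * G + (F * p + (F - 1) * p') * E
      + 3 * p * om\<^sup>2 + 6 * p' * D * om + 2 * p'' * D\<^sup>2)"
    unfolding minus plus by algebra
  finally have FW: "F\<^sup>2 * W0 = ((F - 1)\<^sup>2 * p - F\<^sup>2) * G + (F * p + (F - 1) * p') * E
      + 3 * p * om\<^sup>2 + 6 * p' * D * om + 2 * p'' * D\<^sup>2"
    by simp
  \<comment> \<open>The substitution kap lam = 1 gives - (kap - 1) = kap (lam - 1).\<close>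
  have "(- (F\<^sup>2 + (kap - 1) * p * (F - 1)\<^sup>2) * G
      - (F * ((kap - 1) * p) + (F - 1) * ((kap - 1) * p')) * E
      - 3 * ((kap - 1) * p) * om\<^sup>2 - 6 * ((kap - 1) * p') * D * om - 2 * ((kap - 1) * p'') * D\<^sup>2)
     = kap * F\<^sup>2 * (- G + (lam - 1) * W0)"
    using kap(2) FW by algebra
  then have "gform (g z) (riem_vec g z X Y Y) X = (kap * F\<^sup>2)\<^sup>2 * (- G + (lam - 1) * W0)"
    unfolding num by (simp add: power2_eq_square)
  moreover have "gform (g z) X X * gform (g z) Y Y - (gform (g z) X Y)\<^sup>2 = (kap * F\<^sup>2)\<^sup>2 * G"
    unfolding gform_g hX hY hXY unfolding t_def[symmetric] F_def[symmetric] kap_def[symmetric] G_def gram_def by algebra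
  ultimately have "sec_curv g z X Y = (- G + (lam - 1) * W0) / G"
    unfolding sec_curv_def using kap F by simp
  also have "\<dots> = -1 + (lam - 1) * (W0 / G)" using G by (simp add: field_simps)
  finally show ?thesis unfolding W0_def G_def X'_def Y'_def .
qed

lemma einstein: "einstein_neg g"
  unfolding einstein_neg_def
proof (intro ballI allI)
  fix z :: "real^'m" and i j assume z: "z \<in> ball 0 1"
  define t where "t = z \<bullet> z"
  have t: "0 \<le> t" "t < 1" using ball_inner[OF z] by (auto simp: t_def)
  let ?c = "(1 / lam - 1) * poly (profile k) t" and ?c1 = "(1 / lam - 1) * poly (pderiv (profile k)) t"
  let ?c2 = "(1 / lam - 1) * poly (pderiv (pderiv (profile k))) t"
  interpret profile_point ?c "e t" "e1 t" "f t" t "u t" "u1 t" "1 / u t" ?c1 ?c2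
    "f t" ?c "p3 t" "p4 t" "p5 t" "e t" "q1 t" ?c1 "q3 t" "q4 t" "q5 t" "e1 t" "bb t"
    by (rule point[OF t])
  interpret conn_coeffs J "f t" ?c "p3 t" "p4 t" "p5 t" "e t" "q1 t" ?c1 "q3 t" "q4 t" "q5 t" "e1 t" ..
  have m: "real CARD('m) = 2 * real k + 2" by (simp add: card)
  have ode1: "t * (1 - t\<^sup>2) * ?c1 + (real k + 2 + 2 * real k * t + real k * t\<^sup>2) * ?c = (4 * real k + 2) * (1 / lam - 1)"
    using profile_ode[of t k] by algebra
  have ode2: "t * (1 - t\<^sup>2) * ?c2 + (real k + 3 + 2 * real k * t + (real k - 3) * t\<^sup>2) * ?c1 + 2 * real k * (1 + t) * ?c = 0"
    using profile_ode2[of t k] by algebra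
  have gij: "g z $ i $ j = 1 / lam * (f t)\<^sup>2 * (axis i 1 \<bullet> (axis j 1 :: real^'m)
      + bb t * (z \<bullet> axis i 1) * (z \<bullet> axis j 1) + ?c * ((J *v z) \<bullet> axis i 1) * ((J *v z) \<bullet> axis j 1))"
    unfolding g_def rank2_def t_def inner_axis by simp
  have "ricci g i j z = trace_of (\<lambda>V. curv z V (axis i 1) (axis j 1))"
    unfolding ricci_eq[OF z] t_def ..
  also have "\<dots> = (- (2 * real k + 2 - 1) * (1 / lam) * (f t)\<^sup>2 * bb t) * ((z \<bullet> axis i 1) * (z \<bullet> axis j 1))
      + (- (2 * real k + 2 - 1) * (1 / lam) * (f t)\<^sup>2 * ?c) * (((J *v z) \<bullet> axis i 1) * ((J *v z) \<bullet> axis j 1))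
      + (- (2 * real k + 2 - 1) * (1 / lam) * (f t)\<^sup>2) * (axis i 1 \<bullet> (axis j 1 :: real^'m))"
    unfolding trace_curv[of z "axis i 1" "axis j 1", folded t_def] m
    using ricci_identity[OF ode1 _ _ ode2] t by simp
  also have "\<dots> = - (real CARD('m) - 1) * (g z $ i $ j)"
    unfolding m gij by algebra
  finally show "ricci g i j z = - (real CARD('m) - 1) * (g z $ i $ j)" .
qed

section \<open>Smoothness, completeness and conformal infinity of the family\<close>

lemma smooth: "smooth_on_set g (ball 0 1)"
  unfolding smooth_on_set_def
proof
  fix n
  let ?B = "ball 0 1 :: (real^'m) set"
  have o: "open ?B" by simp
  have tc: "Ck_on n (\<lambda>z. z \<bullet> z) ?B" by (rule Ck_on_inner_self[OF o])
  have pc: "Ck_on n (\<lambda>z. (1 / lam - 1) * poly (profile k) (z \<bullet> z)) ?B"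
    by (intro Ck_on_mult Ck_on_const Ck_on_poly tc o)
  have unz: "1 + (z \<bullet> z) * ((1 / lam - 1) * poly (profile k) (z \<bullet> z)) \<noteq> 0" if "z \<in> ?B" for z
    using ball_inner[OF that] u_nz[of "z \<bullet> z"] unfolding u_def by blast
  have fnz: "1 + (-1) * (z \<bullet> z) \<noteq> 0" if "z \<in> ?B" for z
    using ball_inner[OF that] by simp
  have uc: "Ck_on n (\<lambda>z. inverse (1 + (z \<bullet> z) * ((1 / lam - 1) * poly (profile k) (z \<bullet> z)))) ?B"
    by (intro Ck_on_inverse Ck_on_add Ck_on_mult[OF o tc] pc Ck_on_const o unz)
  have fc: "Ck_on n (\<lambda>z. 2 * inverse (1 + (-1) * (z \<bullet> z))) ?B"
    by (intro Ck_on_mult Ck_on_inverse Ck_on_add Ck_on_const tc o fnz)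
  have wc: "Ck_on n (\<lambda>z. (J *v z) $ i) ?B" for i
    by (rule Ck_on_linear[OF o])
       (rule bounded_linear_compose[OF bounded_linear_vec_nth matrix_vector_mul_bounded_linear])
  \<comment> \<open>The entries of \<open>g\<close> spelled with sums, products and
    \<open>inverse\<close> only, since these are the operations covered by the \<open>Ck_on\<close>
    rules.\<close>
  let ?E = "\<lambda>i j (z::real^'m). 1 / lam * ((2 * inverse (1 + (-1) * (z \<bullet> z))) * (2 * inverse (1 + (-1) * (z \<bullet> z)))) *
       (axis i 1 \<bullet> (axis j 1 :: real^'m)
         + ((-1) * ((1 / lam - 1) * poly (profile k) (z \<bullet> z)) * inverse (1 + (z \<bullet> z) * ((1 / lam - 1) * poly (profile k) (z \<bullet> z)))) * z $ i * z $ j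
         + ((1 / lam - 1) * poly (profile k) (z \<bullet> z)) * (J *v z) $ i * (J *v z) $ j)"
  show "Ck_on n g ?B"
  proof (rule Ck_on_matrix[OF o])
    fix i j
    have "?E i j z = g z $ i $ j" for z
      unfolding g_def rank2_def f_def bb_def u_def by (simp add: divide_inverse power2_eq_square)
    moreover have "Ck_on n (?E i j) ?B"
      by (intro Ck_on_mult Ck_on_add Ck_on_const Ck_on_nth pc uc fc wc o)
    ultimately show "Ck_on n (\<lambda>z. g z $ i $ j) ?B" by simp
  qed
qed

lemma riem_metric_g: "riem_metric g"
  unfolding riem_metric_def
proof (intro conjI ballI allI impI smooth)
  fix z v :: "real^'m" assume z: "z \<in> ball 0 1"
  show "transpose (g z) = g z" unfolding g_def by (rule rank2_transpose)
  assume "v \<noteq> 0"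
  then have "h z v v > 0" using h_pos[of z v] z by simp
  moreover have "f (z \<bullet> z) > 0" using f_ge[of "z \<bullet> z"] ball_inner[OF z] by simp
  ultimately show "gform (g z) v v > 0" unfolding gform_g using lam by simp
qed

lemma radial_continuous:
  "continuous_on (cball 0 1) (\<lambda>z::real^'m. (1 / lam - 1) * poly (profile k) (z \<bullet> z))"
  "continuous_on (cball 0 1) (\<lambda>z::real^'m. bb (z \<bullet> z))"
proof -
  have P: "continuous_on (cball 0 1) (\<lambda>z::real^'m. poly P (z \<bullet> z))" for P
    by (induction P) (auto intro!: continuous_intros)
  then show "continuous_on (cball 0 1) (\<lambda>z::real^'m. (1 / lam - 1) * poly (profile k) (z \<bullet> z))"
    by (intro continuous_intros)
  show "continuous_on (cball 0 1) (\<lambda>z::real^'m. bb (z \<bullet> z))"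
    unfolding bb_def u_def
  proof (intro continuous_on_divide continuous_on_minus continuous_on_add continuous_on_mult continuous_on_const
      continuous_on_inner continuous_on_id P ballI)
    fix z :: "real^'m" assume "z \<in> cball 0 1"
    then show "1 + (z \<bullet> z) * ((1 / lam - 1) * poly (profile k) (z \<bullet> z)) \<noteq> 0"
      using u_gt_0[of "z \<bullet> z"] cball_inner[of z] unfolding u_def by fastforce
  qed
qed

text \<open>h is continuous and positive definite up to the boundary sphere, because u > 0 also at t
  = 1. So it has a positive minimum on unit vectors over the closed ball, and homogeneity does the
  rest.\<close>

lemma h_lower: obtains d where "d > 0" "\<And>z v. z \<in> cball 0 1 \<Longrightarrow> h z v v \<ge> d * (norm v)\<^sup>2"
proof -
  let ?K = "cball 0 1 \<times> sphere 0 1 :: ((real^'m) \<times> (real^'m)) set"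
  have fst: "continuous_on ?K fst" and snd: "continuous_on ?K snd"
    by (intro continuous_on_fst continuous_on_snd continuous_on_id)+
  have sub: "fst ` ?K \<subseteq> cball 0 1" by auto
  note r = continuous_on_compose2[OF radial_continuous(1) fst sub] continuous_on_compose2[OF radial_continuous(2) fst sub]
  note Jf = bounded_linear.continuous_on[OF matrix_vector_mul_bounded_linear[of J] fst]
  have cont: "continuous_on ?K (\<lambda>q. h (fst q) (snd q) (snd q))"
    by (intro continuous_on_add continuous_on_mult[OF continuous_on_mult] continuous_on_inner r fst snd Jf)
  have comp: "compact ?K" by (intro compact_Times compact_cball compact_sphere)
  have ne: "?K \<noteq> {}"
    using norm_axis_1[of undefined] by (metis mem_sphere_0 centre_in_cball zero_le_one SigmaI empty_iff)
  from continuous_attains_inf[OF comp ne cont] obtain q where q: "q \<in> ?K" "\<And>p. p \<in> ?K \<Longrightarrow> h (fst q) (snd q) (snd q) \<le> h (fst p) (snd p) (snd p)"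
    by blast
  define d where "d = h (fst q) (snd q) (snd q)"
  have "d > 0" unfolding d_def using q(1) by (intro h_pos) auto
  moreover have "h z v v \<ge> d * (norm v)\<^sup>2" if z: "z \<in> cball 0 1" for z v
  proof (cases "v = 0")
    case False
    define w where "w = (1 / norm v) *\<^sub>R v"
    have "norm w = 1" using False by (simp add: w_def)
    then have dw: "d \<le> h z w w" using q(2)[of "(z, w)"] z by (simp add: d_def)
    have "v = norm v *\<^sub>R w" using False by (simp add: w_def)
    then have "hroot z *v v = norm v *\<^sub>R (hroot z *v w)" by (metis matrix_vector_mult_scaleR)
    then have eq: "h z v v = h z w w * (norm v)\<^sup>2"
      unfolding root_inner[OF z, symmetric] by (simp add: power2_eq_square)
    show ?thesis unfolding eq by (rule mult_right_mono[OF dw]) simp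
  qed simp
  ultimately show ?thesis by (rule that)
qed

lemma complete_g: "complete_metric g"
proof -
  obtain d where d: "d > 0" "\<And>z v. z \<in> cball 0 1 \<Longrightarrow> h z v v \<ge> d * (norm v)\<^sup>2"
    using h_lower by blast
  \<comment> \<open>The conformal factor is 4 / (lam (1 - t)^2) and h is at least d |v|^2; the
    constant is the square root of the product without (1 - t)^2.\<close>
  have "hyperbolic_lower_bound g (sqrt (4 / lam * d))"
  proof
    show "continuous_on (ball 0 1) g" using smooth unfolding smooth_on_set_def by (metis Ck_on.simps(1))
    show "sqrt (4 / lam * d) > 0" using d(1) lam by simp
    fix z v :: "real^'m" assume z: "z \<in> ball 0 1"
    have "(sqrt (4 / lam * d) * norm v / (1 - (norm z)\<^sup>2))\<^sup>2 = 1 / lam * (f (z \<bullet> z))\<^sup>2 * (d * (norm v)\<^sup>2)"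
      using d(1) lam by (simp add: f_def power2_norm_eq_inner power_divide power_mult_distrib)
    also have "\<dots> \<le> gform (g z) v v"
      unfolding gform_g using d(2)[of z v] z lam by (intro mult_left_mono) auto
    finally show "(sqrt (4 / lam * d) * norm v / (1 - (norm z)\<^sup>2))\<^sup>2 \<le> gform (g z) v v" .
  qed
  then show ?thesis by (rule hyperbolic_lower_bound.complete)
qed

lemma CCE: "CCE_with_infinity J lam g"
proof -
  define x :: "real^'m \<Rightarrow> real" where "x p = 1 - p \<bullet> p" for p
  \<comment> \<open>The extension is written out, since x^2 g has no usable value on the sphere; the
    factor (1 - t)^2 is already cancelled.\<close>
  define gbar where "gbar p = rank2 (4 / lam) (bb (p \<bullet> p)) ((1 / lam - 1) * poly (profile k) (p \<bullet> p)) p" for p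
  have dx: "(x has_derivative (\<lambda>v. - 2 * (p \<bullet> v))) (at p)" for p
    unfolding x_def by (auto intro!: derivative_eq_intros simp: inner_commute)
  have "defining_fun x"
    unfolding defining_fun_def
  proof (intro conjI ballI)
    show "continuous_on (cball 0 1) x" unfolding x_def by (intro continuous_intros)
    show "x p > 0" if "p \<in> ball 0 1" for p using ball_inner[OF that] by (simp add: x_def)
    fix p :: "real^'m" assume p: "p \<in> sphere 0 1"
    then have pp: "p \<bullet> p = 1" by (simp add: norm_eq_1)
    show "x p = 0" by (simp add: x_def pp)
    show "x differentiable (at p)" using dx differentiable_def by blast
    have "(- 2 * (p \<bullet> p)) \<noteq> 0" by (simp add: pp)
    then show "frechet_derivative x (at p) \<noteq> (\<lambda>_. 0)"
      unfolding frechet_derivative_at[OF dx, symmetric] by metis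
  qed
  moreover have "continuous_on (cball 0 1) gbar"
  proof -
    have "continuous_on (cball 0 1) ((*v) J)" by (intro linear_continuous_on) simp
    moreover have "continuous_on (cball 0 1) (\<lambda>z::real^'m. poly P (z \<bullet> z))" for P
      by (induction P) (auto intro!: continuous_intros)
    ultimately show ?thesis unfolding gbar_def rank2_def
      by (intro continuous_on_vec_lambda continuous_on_add continuous_on_mult[OF continuous_on_const]
          continuous_on_mult[OF continuous_on_mult] continuous_on_const continuous_on_component continuous_on_id
          radial_continuous)
  qed
  moreover have "gbar p = (x p)\<^sup>2 *\<^sub>R g p" if "p \<in> ball 0 1" for p
  proof -
    have eq: "(1 - p \<bullet> p)\<^sup>2 * (1 / lam * (2 / (1 - p \<bullet> p))\<^sup>2) = 4 / lam"
      using ball_inner[OF that] by (simp add: power_divide)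
    show ?thesis unfolding gbar_def g_def x_def f_def rank2_scaleR eq ..
  qed
  \<comment> \<open>On tangent vectors the radial term vanishes, and what remains is 4/lam times the
    horizontal part plus 1/lam times sigma_1^2. Extracting 1/lam gives \<open>ghat\<close> with the
    factor 4/lam^2.\<close>
  moreover have "gform (gbar p) v w = 4 / lam\<^sup>2 * ghat J lam p v w"
    if "p \<in> sphere 0 1" "v \<bullet> p = 0" "w \<bullet> p = 0" for p v w
  proof -
    have pp: "p \<bullet> p = 1" using that(1) by (simp add: norm_eq_1)
    show ?thesis unfolding gbar_def rank2_gform ghat_def pp profile_1
      using that lam by (simp add: inner_commute[of p] field_simps power2_eq_square)
  qed
  ultimately show ?thesis
    unfolding CCE_with_infinity_def using riem_metric_g complete_g einstein lam
    by (intro conjI exI[of _ x] exI[of _ gbar] exI[of _ "\<lambda>_. 4 / lam\<^sup>2"]) auto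
qed

section \<open>The sign of the sectional curvature\<close>

lemma nonpos_curved_g:
  assumes "\<And>z X Y. z \<in> cball 0 1 \<Longrightarrow> lin_indep2 X Y \<Longrightarrow> (lam - 1) * (weyl k z X Y / gram X Y) \<le> 1"
  shows "nonpos_curved g"
  unfolding nonpos_curved_def
  using assms[OF _ root_lin_indep2] by (auto simp: sec_curv_eq)

text \<open>Carries an extremal orthonormal pair of the Euclidean model back to a plane for
  \<open>g\<close>, where the extremal value is realized as a sectional curvature.\<close>

lemma sec_curv_unroot:
  assumes "(z, X, Y) \<in> frames" "z \<in> ball 0 1"
  shows "lin_indep2 (hroot_inv z *v X) (hroot_inv z *v Y) \<and>
    sec_curv g z (hroot_inv z *v X) (hroot_inv z *v Y) = -1 + (lam - 1) * weyl k z X Y"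
proof -
  have z: "z \<in> cball 0 1" using assms(2) by simp
  have li: "lin_indep2 (hroot_inv z *v X) (hroot_inv z *v Y)"
    using frames_lin_indep2[OF assms(1)] unroot_lin_indep2[OF z] by blast
  then show ?thesis
    using sec_curv_eq[OF assms(2) li] frames_lin_indep2[OF assms(1)] by (simp add: root_unroot[OF z])
qed

end

section \<open>The threshold\<close>

context complex_structure
begin

text \<open>With lam = 1 + s r both intervals become r >= 0, for s = -1 and s = 1. If
  \<open>M\<close> is the maximum of s W over the frames, all curvatures are at most 0 as long as r
  M <= 1, and the maximizing plane has curvature -1 + r M.\<close>

lemma curvature_threshold:
  fixes s R :: real and k :: nat
  assumes card: "CARD('m) = 2 * k + 2" and R: "R > 0"
    and pos: "\<And>r. 0 \<le> r \<Longrightarrow> r \<le> R \<Longrightarrow> 1 + s * r > 0"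
  shows "(\<forall>r\<in>{0..<R}. \<exists>g. CCE_with_infinity J (1 + s * r) g \<and> nonpos_curved g)
    \<or> (\<exists>r1\<in>{0..<R}. \<exists>G.
        (\<forall>r\<in>{0..r1}. CCE_with_infinity J (1 + s * r) (G r) \<and> nonpos_curved (G r))
      \<and> (\<exists>p\<in>ball 0 1. \<exists>X Y. lin_indep2 X Y \<and> sec_curv (G r1) p X Y = 0)
      \<and> (\<forall>\<epsilon>>0. \<exists>r2\<in>{r1<..<r1 + \<epsilon>}. \<exists>g. CCE_with_infinity J (1 + s * r2) g \<and>
            (\<exists>p\<in>ball 0 1. \<exists>X Y. lin_indep2 X Y \<and> sec_curv g p X Y > 0)))"
proof -
  obtain z0 X0 Y0 where fr: "(z0, X0, Y0) \<in> frames"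
    and ext: "\<And>z X Y. z \<in> cball 0 1 \<Longrightarrow> lin_indep2 X Y \<Longrightarrow>
        s * (weyl k z X Y / gram X Y) \<le> s * weyl k z0 X0 Y0"
    using weyl_extremal[where s = s] by metis
  define M where "M = s * weyl k z0 X0 Y0"
  define G where "G r = ansatz.g J (\<lambda>t. (1 / (1 + s * r) - 1) * poly (profile k) t) (1 / (1 + s * r))" for r
  have tn: "taub_nut J k (1 + s * r)" if "0 \<le> r" "r \<le> R" for r
    using pos[OF that] card by unfold_locales
  have cce: "CCE_with_infinity J (1 + s * r) (G r)" if "0 \<le> r" "r \<le> R" for r
    unfolding G_def by (rule taub_nut.CCE[OF tn[OF that]])
  have nonpos: "nonpos_curved (G r)" if r: "0 \<le> r" "r \<le> R" "r * M \<le> 1" for r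
    unfolding G_def
  proof (rule taub_nut.nonpos_curved_g[OF tn[OF r(1,2)]])
    fix z X Y :: "real^'m" assume "z \<in> cball 0 1" "lin_indep2 X Y"
    then have "r * (s * (weyl k z X Y / gram X Y)) \<le> r * M"
      using ext r(1) by (intro mult_left_mono) (auto simp: M_def)
    then show "(1 + s * r - 1) * (weyl k z X Y / gram X Y) \<le> 1"
      using r(3) by (simp add: mult_ac)
  qed
  show ?thesis
  proof (cases "R * M \<le> 1")
    case True
    have "nonpos_curved (G r)" if "r \<in> {0..<R}" for r
    proof (rule nonpos)
      show "r * M \<le> 1"
      proof (cases "M \<ge> 0")
        case True
        then show ?thesis using that \<open>R * M \<le> 1\<close> mult_right_mono[of r R M] by auto
      next
        case False
        then have "r * M \<le> 0" using that by (intro mult_nonneg_nonpos) auto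
        then show ?thesis by simp
      qed
    qed (use that in auto)
    then show ?thesis using cce by (intro disjI1 ballI) (metis atLeastLessThan_iff less_imp_le)
  next
    case False
    have M: "M > 0" using False R by (metis mult_nonneg_nonpos not_le less_imp_le order_trans zero_le_one)
    \<comment> \<open>The parameter at which the extremal curvature -1 + r M reaches 0.\<close>
    define r1 where "r1 = 1 / M"
    have r1: "0 < r1" "r1 < R" "r1 * M = 1" using False M by (auto simp: r1_def field_simps)
    \<comment> \<open>Since \<open>M\<close> is positive and W vanishes over the sphere, the
      extremal plane sits at an interior point.\<close>
    have "norm z0 \<noteq> 1" using M weyl_sphere[of z0 k X0 Y0] by (auto simp: M_def)
    then have z0: "z0 \<in> ball 0 1" using fr by (auto simp: frames_def)
    have sec: "\<exists>X Y. lin_indep2 X Y \<and> sec_curv (G r) z0 X Y = - 1 + r * M" if "0 \<le> r" "r \<le> R" for r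
    proof -
      have "(1 + s * r - 1) * weyl k z0 X0 Y0 = r * M" by (simp add: M_def)
      then show ?thesis
        using taub_nut.sec_curv_unroot[OF tn[OF that] fr z0, folded G_def] by metis
    qed
    have "\<forall>r\<in>{0..r1}. CCE_with_infinity J (1 + s * r) (G r) \<and> nonpos_curved (G r)"
    proof
      fix r assume r: "r \<in> {0..r1}"
      then have "r * M \<le> 1" using M r1(3) mult_right_mono[of r r1 M] by auto
      with r r1 show "CCE_with_infinity J (1 + s * r) (G r) \<and> nonpos_curved (G r)"
        using cce[of r] nonpos[of r] by auto
    qed
    moreover have "\<exists>p\<in>ball 0 1. \<exists>X Y. lin_indep2 X Y \<and> sec_curv (G r1) p X Y = 0"
      using sec[of r1] r1 z0 by force
    moreover have "\<exists>r2\<in>{r1<..<r1 + \<epsilon>}. \<exists>g. CCE_with_infinity J (1 + s * r2) g \<and>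
            (\<exists>p\<in>ball 0 1. \<exists>X Y. lin_indep2 X Y \<and> sec_curv g p X Y > 0)" if "\<epsilon> > 0" for \<epsilon>
    proof -
      \<comment> \<open>Capped at \<open>R\<close>, up to which positivity of lam, and with it the
        metric, is guaranteed.\<close>
      define r2 where "r2 = min (r1 + \<epsilon> / 2) R"
      have r2: "r1 < r2" "r2 < r1 + \<epsilon>" "r2 \<le> R" using that r1 by (auto simp: r2_def)
      have "r2 * M > 1" using mult_strict_right_mono[OF r2(1) M] r1(3) by simp
      moreover obtain X Y where "lin_indep2 X Y" "sec_curv (G r2) z0 X Y = - 1 + r2 * M"
        using sec[of r2] r2 r1 by auto
      ultimately have "lin_indep2 X Y \<and> sec_curv (G r2) z0 X Y > 0" by simp
      then have "\<exists>p\<in>ball 0 1. \<exists>X Y. lin_indep2 X Y \<and> sec_curv (G r2) p X Y > 0"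
        using z0 by blast
      moreover have "CCE_with_infinity J (1 + s * r2) (G r2)" using cce[of r2] r1 r2 by simp
      moreover have "r2 \<in> {r1<..<r1 + \<epsilon>}" using r2 by simp
      ultimately show ?thesis by blast
    qed
    ultimately show ?thesis using r1 by (intro disjI2 bexI[of _ r1] exI[of _ G]) auto
  qed
qed

end

section \<open>The two parameter intervals\<close>

theorem theorem1p4:
  fixes J :: "real^'m^'m" and k :: nat
  assumes "k \<ge> 1" and "CARD('m) = 2 * k + 2"
    and "J ** J = - mat 1" and "transpose J ** J = mat 1"
  shows
   "((\<forall>lam\<in>{1 / (real (2*k+1) + 1)<..1}. \<exists>g. CCE_with_infinity J lam g \<and> nonpos_curved g)
     \<or> (\<exists>lam1\<in>{1 / (real (2*k+1) + 1)<..1}. \<exists>G.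
          (\<forall>lam\<in>{lam1..1}. CCE_with_infinity J lam (G lam) \<and> nonpos_curved (G lam))
        \<and> (\<exists>p\<in>ball 0 1. \<exists>X Y. lin_indep2 X Y \<and> sec_curv (G lam1) p X Y = 0)
        \<and> (\<forall>\<epsilon>>0. \<exists>lam2\<in>{lam1 - \<epsilon><..<lam1}. \<exists>g. CCE_with_infinity J lam2 g \<and>
              (\<exists>p\<in>ball 0 1. \<exists>X Y. lin_indep2 X Y \<and> sec_curv g p X Y > 0))))
  \<and> ((\<forall>lam\<in>{1..<real (2*k+1) + 1}. \<exists>g. CCE_with_infinity J lam g \<and> nonpos_curved g)
     \<or> (\<exists>lam1\<in>{1..<real (2*k+1) + 1}. \<exists>G.
          (\<forall>lam\<in>{1..lam1}. CCE_with_infinity J lam (G lam) \<and> nonpos_curved (G lam))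
        \<and> (\<exists>p\<in>ball 0 1. \<exists>X Y. lin_indep2 X Y \<and> sec_curv (G lam1) p X Y = 0)
        \<and> (\<forall>\<epsilon>>0. \<exists>lam2\<in>{lam1<..<lam1 + \<epsilon>}. \<exists>g. CCE_with_infinity J lam2 g \<and>
              (\<exists>p\<in>ball 0 1. \<exists>X Y. lin_indep2 X Y \<and> sec_curv g p X Y > 0))))"
proof -
  interpret complex_structure J using assms(3,4) by unfold_locales
  \<comment> \<open>With these predicates opaque, each half of the theorem is a pure change of
    variable in \<open>curvature_threshold\<close>.\<close>
  define C where "C lam g \<longleftrightarrow> CCE_with_infinity J lam g \<and> nonpos_curved g" for lam g
  define Z where "Z g \<longleftrightarrow> (\<exists>p\<in>ball 0 1. \<exists>X Y. lin_indep2 X Y \<and> sec_curv g p X Y = 0)" for g :: "'m mfield"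
  define P where "P lam g \<longleftrightarrow> CCE_with_infinity J lam g \<and>
      (\<exists>p\<in>ball 0 1. \<exists>X Y. lin_indep2 X Y \<and> sec_curv g p X Y > 0)" for lam g
  define N where "N = real (2*k+1) + 1"
  have N: "N > 1" by (simp add: N_def)
  note threshold = curvature_threshold[OF assms(2), folded C_def Z_def P_def]
  have "(\<forall>lam\<in>{1 / N<..1}. \<exists>g. C lam g) \<or> (\<exists>lam1\<in>{1 / N<..1}. \<exists>G. (\<forall>lam\<in>{lam1..1}. C lam (G lam))
      \<and> Z (G lam1) \<and> (\<forall>\<epsilon>>0. \<exists>lam2\<in>{lam1 - \<epsilon><..<lam1}. \<exists>g. P lam2 g))"
  proof -
    \<comment> \<open>Here s = -1, so lam = 1 - r and the open end lam = 1/N corresponds to r = 1 -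
      1/N.\<close>
    have pos: "1 + (-1) * r > 0" if "r \<le> 1 - 1 / N" for r
    proof -
      have "1 / N > 0" using N by simp
      then show ?thesis using that by linarith
    qed
    have R: "1 - 1 / N > 0" using N by simp
    from threshold[OF R pos] consider
        (a) "\<And>r. r \<in> {0..<1 - 1 / N} \<Longrightarrow> \<exists>g. C (1 + - 1 * r) g"
      | (b) r1 G where "r1 \<in> {0..<1 - 1 / N}" "\<And>r. r \<in> {0..r1} \<Longrightarrow> C (1 + - 1 * r) (G r)" "Z (G r1)"
          "\<And>\<epsilon>. \<epsilon> > 0 \<Longrightarrow> \<exists>r2\<in>{r1<..<r1 + \<epsilon>}. \<exists>g. P (1 + - 1 * r2) g"
      by blast
    then show ?thesis
    proof cases
      case a
      have "\<exists>g. C lam g" if "lam \<in> {1 / N<..1}" for lam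
        using a[of "1 - lam"] that by auto
      then show ?thesis by blast
    next
      case b
      have "C lam (G (1 - lam))" if "lam \<in> {1 - r1..1}" for lam
        using b(2)[of "1 - lam"] that by auto
      moreover have "\<exists>lam2\<in>{1 - r1 - \<epsilon><..<1 - r1}. \<exists>g. P lam2 g" if eps: "\<epsilon> > 0" for \<epsilon>
      proof -
        obtain r2 g where "r2 \<in> {r1<..<r1 + \<epsilon>}" "P (1 + - 1 * r2) g" using b(4)[OF eps] by blast
        then show ?thesis by (intro bexI[of _ "1 - r2"] exI[of _ g]) auto
      qed
      ultimately show ?thesis
        using b(1,3) by (intro disjI2 bexI[of _ "1 - r1"] exI[of _ "\<lambda>lam. G (1 - lam)"]) auto
    qed
  qed
  moreover have "(\<forall>lam\<in>{1..<N}. \<exists>g. C lam g) \<or> (\<exists>lam1\<in>{1..<N}. \<exists>G. (\<forall>lam\<in>{1..lam1}. C lam (G lam))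
      \<and> Z (G lam1) \<and> (\<forall>\<epsilon>>0. \<exists>lam2\<in>{lam1<..<lam1 + \<epsilon>}. \<exists>g. P lam2 g))"
  proof -
    \<comment> \<open>Here s = 1, so lam = 1 + r and the open end lam = N corresponds to r = N -
      1.\<close>
    have pos: "1 + 1 * r > 0" if "0 \<le> r" for r :: real using that by simp
    have R: "N - 1 > 0" using N by simp
    from threshold[OF R pos] consider
        (a) "\<And>r. r \<in> {0..<N - 1} \<Longrightarrow> \<exists>g. C (1 + 1 * r) g"
      | (b) r1 G where "r1 \<in> {0..<N - 1}" "\<And>r. r \<in> {0..r1} \<Longrightarrow> C (1 + 1 * r) (G r)" "Z (G r1)"
          "\<And>\<epsilon>. \<epsilon> > 0 \<Longrightarrow> \<exists>r2\<in>{r1<..<r1 + \<epsilon>}. \<exists>g. P (1 + 1 * r2) g"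
      by blast
    then show ?thesis
    proof cases
      case a
      have "\<exists>g. C lam g" if "lam \<in> {1..<N}" for lam
        using a[of "lam - 1"] that by auto
      then show ?thesis by blast
    next
      case b
      have "C lam (G (lam - 1))" if "lam \<in> {1..1 + r1}" for lam
        using b(2)[of "lam - 1"] that by auto
      moreover have "\<exists>lam2\<in>{1 + r1<..<1 + r1 + \<epsilon>}. \<exists>g. P lam2 g" if eps: "\<epsilon> > 0" for \<epsilon>
      proof -
        obtain r2 g where "r2 \<in> {r1<..<r1 + \<epsilon>}" "P (1 + 1 * r2) g" using b(4)[OF eps] by blast
        then show ?thesis by (intro bexI[of _ "1 + r2"] exI[of _ g]) auto
      qed
      ultimately show ?thesis
        using b(1,3) by (intro disjI2 bexI[of _ "1 + r1"] exI[of _ "\<lambda>lam. G (lam - 1)"]) auto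
    qed
  qed
  ultimately show ?thesis unfolding C_def Z_def P_def N_def by blast
qed

end
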